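(* Let $E\subset\mathbb C$ be any compact set with $\mathrm{cap}(E)>0$, and let $B_k(z)=\sum_{j=0}^kb_{j,k}z^j$ with $b_{k,k}\neq0$ satisfy (2.3). Let $A_0,A_1,\dots$ be complex random variables satisfying Assumptions 1 and 2, such that $A_0$ is independent of $\{A_n\}_{n\ge1}$ and there exists $t>1$ with $$\sup_{z\in\mathbb C}\mathbb E\big[(\log^-|A_0-z|)^t\big]<\infty.$$ Then almost surely the zero counting measures of $P_n(z)=\sum_{k=0}^nA_kB_k(z)$ converge weakly to $\mu_E$ as $n\to\infty$.
   Context: $\log^-x=\max(-\log x,0)$. Condition (2.3): $\limsup_k\|B_k\|_E^{1/k}\le1$ and $\lim_k|b_{k,k}|^{1/k}=1/\mathrm{cap}(E)$, with $\|\cdot\|_E$ the sup norm on $E$, $\mathrm{cap}$ logarithmic capacity, $\mu_E$ the equilibrium measure of $E$. $F_k(x)=\mathbb P(|A_k|\le x)$. Assumption 1: there are $a>1$ and a decreasing $f:[a,\infty)\to[0,1]$ with $\int_a^\infty f(x)\,dx/x<\infty$ and $1-F_k(x)\le f(x)$ for all $x\ge a$, $k\ge0$. Assumption 2: there are $0<b<1$ and an increasing $g:[0,b]\to[0,1]$ with $\int_0^b g(x)\,dx/x<\infty$ and $F_k(x)\le g(x)$ for $x\in[0,b]$, $k\ge0$. Zero counting measure: $\tau_n=\frac1n\sum_j\delta_{Z_j}$ over zeros of $P_n$. *)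

theory Defs
  imports "HOL-Probability.Probability" "HOL-Computational_Algebra.Polynomial"
begin

definition log_minus :: "real \<Rightarrow> ennreal" where
  "log_minus x = (if x = 0 then \<infinity> else ennreal (max (- ln x) 0))"

definition log_minus_pow :: "real \<Rightarrow> real \<Rightarrow> ennreal" where
  "log_minus_pow t x = (if x = 0 then \<infinity> else ennreal ((max (- ln x) 0) powr t))"

definition prob_measures_on :: "complex set \<Rightarrow> complex measure set" where
  "prob_measures_on E = {\<mu>. sets \<mu> = sets borel \<and> prob_space \<mu> \<and> emeasure \<mu> (UNIV - E) = 0}"

(* logarithmic energy I(\<mu>) = \<integral>\<integral> log (1/|z-w|) d\<mu>(z) d\<mu>(w), split into positive and negative parts *)
definition log_energy :: "complex measure \<Rightarrow> ereal" where
  "log_energy \<mu> =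
     enn2ereal (\<integral>\<^sup>+ z. \<integral>\<^sup>+ w. log_minus (cmod (z - w)) \<partial>\<mu> \<partial>\<mu>)
   - enn2ereal (\<integral>\<^sup>+ z. \<integral>\<^sup>+ w. ennreal (max (ln (cmod (z - w))) 0) \<partial>\<mu> \<partial>\<mu>)"

definition robin_const :: "complex set \<Rightarrow> ereal" where
  "robin_const E = (INF \<mu> \<in> prob_measures_on E. log_energy \<mu>)"

definition log_capacity :: "complex set \<Rightarrow> real" where
  "log_capacity E = (if robin_const E = \<infinity> then 0 else exp (- real_of_ereal (robin_const E)))"

(* equilibrium measure: the (unique, when cap(E) > 0) energy minimiser *)
definition equilibrium_measure :: "complex set \<Rightarrow> complex measure" where
  "equilibrium_measure E =
     (THE \<mu>. \<mu> \<in> prob_measures_on E \<and> log_energy \<mu> = robin_const E)"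

definition sup_norm_on :: "complex set \<Rightarrow> complex poly \<Rightarrow> real" where
  "sup_norm_on E p = (SUP z \<in> E. cmod (poly p z))"

(* integral of f against the normalised zero counting measure (1/n) \<Sigma> \<delta>_{Z_j} of p,
   zeros counted with multiplicity *)
definition zero_count_integral :: "nat \<Rightarrow> complex poly \<Rightarrow> (complex \<Rightarrow> real) \<Rightarrow> real" where
  "zero_count_integral n p f = (1 / real n) * (\<Sum>z \<in> {z. poly p z = 0}. real (order z p) * f z)"

definition zeros_weak_conv :: "(nat \<Rightarrow> complex poly) \<Rightarrow> complex measure \<Rightarrow> bool" where
  "zeros_weak_conv p \<mu> \<longleftrightarrow>
     (\<forall>f :: complex \<Rightarrow> real. continuous_on UNIV f \<longrightarrow> bounded (range f) \<longrightarrow>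
        (\<lambda>n. zero_count_integral n (p n) f) \<longlonglongrightarrow> integral\<^sup>L \<mu> f)"

end

theory Submission
  imports Defs "HOL-Real_Asymp.Real_Asymp" "HOL-Computational_Algebra.Fundamental_Theorem_Algebra"
begin

text \<open>
  Write \<open>U\<^sub>n\<close> for the logarithmic potential of the zero counting measure \<open>\<tau>\<^sub>n\<close>, \<open>\<mu>\<close> for the equilibrium
  measure and \<open>\<gamma> = - log cap(E)\<close>. By Borel-Cantelli, almost surely \<open>|A\<^sub>n|\<^sup>1\<^sup>/\<^sup>n \<rightarrow> 1\<close>, so
  \<open>limsup U\<^sub>n \<le> - \<gamma>\<close> uniformly on \<open>E\<close>; and since \<open>P\<^sub>n(z) = b\<^sub>0\<^sub>0 (A\<^sub>0 - Y\<^sub>n(z))\<close> with \<open>Y\<^sub>n(z)\<close> independent of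
  \<open>A\<^sub>0\<close>, the moment condition on \<open>A\<^sub>0\<close> gives \<open>liminf U\<^sub>n(z) \<ge> - \<gamma>\<close> almost surely for each \<open>z\<close> in a
  countable dense set.

  With the smoothed kernel \<open>k\<^sub>\<delta>(x) = - log(|x|\<^sup>2 + \<delta>)/2 \<le> - log |x|\<close> the lower bound yields
  \<open>\<integral>\<integral> k\<^sub>\<delta> d\<tau>\<^sub>n d\<tau>\<^sub>n \<le> \<gamma> + o(1)\<close>, while the upper bound on \<open>E\<close> yields \<open>\<integral>\<integral> k\<^sub>\<delta> d\<tau>\<^sub>n d\<mu> \<ge> \<gamma> - o(1)\<close>, once \<open>\<mu>\<close> is
  restricted to a large compact set on which its potential is uniformly approximated by the smoothed
  one. Hence the energy of \<open>\<tau>\<^sub>n - \<mu>\<close> tends to \<open>0\<close>. On measures of total mass zero \<open>k\<^sub>\<delta>\<close> is a positive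
  mixture of Gaussian kernels, which are positive definite because they are characteristic functions;
  so the integrals of all Gaussians converge, and these determine weak convergence.
\<close>

section \<open>Mutual energies of compactly supported measures\<close>

text \<open>The upper bound on the polynomials holds on \<open>E\<close> alone and \<open>E\<close>
  has no regularity, so no pointwise limit of potentials is taken; everything is done with energies,
  and these are not equally easy. In the self energy of the zeros smoothing goes the right way,
  because \<open>log_kernel\<close> lies below \<open>- ln |x|\<close>. In the cross energy it goes
  the wrong way: an error is paid at every zero, wherever it lies. This is why the equilibrium
  measure is replaced by a restriction whose smoothing error is small uniformly in the plane. The
  zeros have no bound uniform in \<open>n\<close>; the radius in \<open>bdd_prob\<close> depends on
  the measure. Zeros far out are controlled by the cross energy itself, which a large mass at
  distance \<open>R\<close> would push down by a multiple of \<open>ln R\<close>. Lower bounds for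
  the polynomials are used only on a finite net of a disc, with a mesh dictated by the smoothing;
  one countable dense set serves all nets with a single null set. Only the summable half of
  Borel-Cantelli is used, so the coefficients after \<open>A 0\<close> may depend on each other in
  any way.\<close>

definition bdd_prob :: "complex measure \<Rightarrow> bool" where
  "bdd_prob \<mu> \<longleftrightarrow> sets \<mu> = sets borel \<and> prob_space \<mu> \<and> (\<exists>R. AE z in \<mu>. cmod z \<le> R)"

definition mutual_energy :: "(complex \<Rightarrow> real) \<Rightarrow> complex measure \<Rightarrow> complex measure \<Rightarrow> real" where
  "mutual_energy k \<mu> \<nu> = (LINT z|\<mu>. LINT w|\<nu>. k (z - w))"

definition energy_dist :: "(complex \<Rightarrow> real) \<Rightarrow> complex measure \<Rightarrow> complex measure \<Rightarrow> real" where
  "energy_dist k \<mu> \<nu> = mutual_energy k \<mu> \<mu> + mutual_energy k \<nu> \<nu> - 2 * mutual_energy k \<mu> \<nu>"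

lemma bdd_probD:
  assumes "bdd_prob \<mu>"
  shows "sets \<mu> = sets borel" "space \<mu> = UNIV" "prob_space \<mu>" "finite_measure \<mu>" "sigma_finite_measure \<mu>"
proof -
  show s: "sets \<mu> = sets borel" and p: "prob_space \<mu>" using assms by (auto simp: bdd_prob_def)
  show "space \<mu> = UNIV" using sets_eq_imp_space_eq[OF s] by simp
  interpret prob_space \<mu> by (rule p)
  show "finite_measure \<mu>" by unfold_locales
  show "sigma_finite_measure \<mu>" by unfold_locales
qed

lemma bdd_prob_integrable:
  fixes f :: "complex \<Rightarrow> 'b::{banach, second_countable_topology}"
  assumes \<mu>: "bdd_prob \<mu>" and f: "continuous_on UNIV f"
  shows "integrable \<mu> f"
proof -
  interpret prob_space \<mu> by (rule bdd_probD[OF \<mu>])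
  obtain R where R: "AE z in \<mu>. cmod z \<le> R" using \<mu> by (auto simp: bdd_prob_def)
  have "compact (f ` cball 0 R)"
    by (rule compact_continuous_image) (auto intro: continuous_on_subset[OF f])
  then obtain B where B: "\<And>z. cmod z \<le> R \<Longrightarrow> norm (f z) \<le> B"
    by (fastforce dest!: compact_imp_bounded simp: bounded_iff)
  have [measurable]: "f \<in> borel_measurable \<mu>"
    using borel_measurable_continuous_onI[OF f] bdd_probD(1)[OF \<mu>] measurable_cong_sets by blast
  show ?thesis
    by (rule integrable_const_bound[of _ B]) (use R B in auto)
qed

lemma bdd_prob_pair_measurable:
  fixes f :: "complex \<times> complex \<Rightarrow> 'b::topological_space"
  assumes "bdd_prob \<mu>" "bdd_prob \<nu>" and f: "f \<in> borel_measurable borel"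
  shows "f \<in> borel_measurable (\<mu> \<Otimes>\<^sub>M \<nu>)"
proof -
  have "sets (\<mu> \<Otimes>\<^sub>M \<nu>) = sets (borel \<Otimes>\<^sub>M borel)"
    by (intro sets_pair_measure_cong bdd_probD assms)
  then show ?thesis using f measurable_cong_sets borel_prod by metis
qed

lemma bdd_prob_pair_integrable:
  fixes f :: "complex \<times> complex \<Rightarrow> 'b::{banach, second_countable_topology}"
  assumes \<mu>: "bdd_prob \<mu>" and \<nu>: "bdd_prob \<nu>" and f: "continuous_on UNIV f"
  shows "integrable (\<mu> \<Otimes>\<^sub>M \<nu>) f"
proof -
  interpret \<mu>: prob_space \<mu> by (rule bdd_probD[OF \<mu>])
  interpret \<nu>: prob_space \<nu> by (rule bdd_probD[OF \<nu>])
  interpret pair_prob_space \<mu> \<nu> ..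
  obtain R where R: "AE z in \<mu>. cmod z \<le> R" using \<mu> by (auto simp: bdd_prob_def)
  obtain S where S: "AE z in \<nu>. cmod z \<le> S" using \<nu> by (auto simp: bdd_prob_def)
  have "compact (f ` (cball 0 R \<times> cball 0 S))"
    by (intro compact_continuous_image compact_Times) (auto intro: continuous_on_subset[OF f])
  then obtain B where B: "\<And>z w. cmod z \<le> R \<Longrightarrow> cmod w \<le> S \<Longrightarrow> norm (f (z,w)) \<le> B"
    by (fastforce dest!: compact_imp_bounded simp: bounded_iff)
  have m: "f \<in> borel_measurable (\<mu> \<Otimes>\<^sub>M \<nu>)"
    by (intro bdd_prob_pair_measurable \<mu> \<nu> borel_measurable_continuous_onI f)
  have "AE p in \<mu> \<Otimes>\<^sub>M \<nu>. norm (f p) \<le> B"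
  proof (rule AE_pair_measure)
    show "{x \<in> space (\<mu> \<Otimes>\<^sub>M \<nu>). norm (f x) \<le> B} \<in> sets (\<mu> \<Otimes>\<^sub>M \<nu>)"
      using m by measurable
    show "AE x in \<mu>. AE y in \<nu>. norm (f (x, y)) \<le> B"
      using R by eventually_elim (use S B in auto)
  qed
  then show ?thesis using m
    by (intro integrable_const_bound) auto
qed

lemma continuous_on_diff_kernel:
  fixes k :: "complex \<Rightarrow> real"
  assumes "continuous_on UNIV k"
  shows "continuous_on UNIV (\<lambda>p. k (fst p - snd p))"
  by (rule continuous_on_compose2[OF assms]) (auto intro!: continuous_intros)

lemma mutual_energy_pair:
  assumes \<mu>: "bdd_prob \<mu>" and \<nu>: "bdd_prob \<nu>" and k: "continuous_on UNIV k"
  shows "mutual_energy k \<mu> \<nu> = (LINT p|(\<mu> \<Otimes>\<^sub>M \<nu>). k (fst p - snd p))"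
proof -
  interpret \<mu>: sigma_finite_measure \<mu> by (rule bdd_probD[OF \<mu>])
  interpret \<nu>: sigma_finite_measure \<nu> by (rule bdd_probD[OF \<nu>])
  interpret pair_sigma_finite \<mu> \<nu> ..
  show ?thesis unfolding mutual_energy_def
    using integral_fst'[OF bdd_prob_pair_integrable[OF \<mu> \<nu> continuous_on_diff_kernel[OF k]]]
    by simp
qed

lemma potential_integrable:
  assumes \<mu>: "bdd_prob \<mu>" and \<nu>: "bdd_prob \<nu>" and k: "continuous_on UNIV (k :: complex \<Rightarrow> real)"
  shows "integrable \<mu> (\<lambda>z. LINT w|\<nu>. k (z - w))"
proof -
  interpret \<mu>: sigma_finite_measure \<mu> by (rule bdd_probD[OF \<mu>])
  interpret \<nu>: sigma_finite_measure \<nu> by (rule bdd_probD[OF \<nu>])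
  interpret pair_sigma_finite \<mu> \<nu> ..
  show ?thesis
    using integrable_fst'[OF bdd_prob_pair_integrable[OF \<mu> \<nu> continuous_on_diff_kernel[OF k]]]
    by simp
qed

lemma kernel_integrable:
  assumes "bdd_prob \<mu>" and k: "continuous_on UNIV (k :: complex \<Rightarrow> real)"
  shows "integrable \<mu> (\<lambda>w. k (z - w))"
  by (rule bdd_prob_integrable[OF assms(1)])
     (rule continuous_on_compose2[OF k], auto intro!: continuous_intros)

lemma mutual_energy_add:
  assumes "bdd_prob \<mu>" "bdd_prob \<nu>" "continuous_on UNIV k" "continuous_on UNIV h"
  shows "mutual_energy (\<lambda>x. k x + h x) \<mu> \<nu> = mutual_energy k \<mu> \<nu> + mutual_energy h \<mu> \<nu>"
  unfolding mutual_energy_def using assms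
  by (simp add: kernel_integrable potential_integrable)

lemma energy_dist_add:
  assumes "bdd_prob \<mu>" "bdd_prob \<nu>" "continuous_on UNIV k" "continuous_on UNIV h"
  shows "energy_dist (\<lambda>x. k x + h x) \<mu> \<nu> = energy_dist k \<mu> \<nu> + energy_dist h \<mu> \<nu>"
  unfolding energy_dist_def using assms by (simp add: mutual_energy_add)

lemma mutual_energy_const:
  assumes "bdd_prob \<mu>" "bdd_prob \<nu>"
  shows "mutual_energy (\<lambda>x. c) \<mu> \<nu> = c"
proof -
  interpret \<mu>: prob_space \<mu> by (rule bdd_probD[OF assms(1)])
  interpret \<nu>: prob_space \<nu> by (rule bdd_probD[OF assms(2)])
  show ?thesis by (simp add: mutual_energy_def \<mu>.prob_space \<nu>.prob_space)
qed

lemma energy_dist_const: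
  "bdd_prob \<mu> \<Longrightarrow> bdd_prob \<nu> \<Longrightarrow> energy_dist (\<lambda>x. c) \<mu> \<nu> = 0"
  by (simp add: energy_dist_def mutual_energy_const)

text \<open>Logarithmic kernels compare with constants only on bounded sets. Differences of points
  of the two supports have modulus at most \<open>R + S\<close>, so the comparison is asked for
  there alone.\<close>

lemma mutual_energy_mono:
  assumes \<mu>: "bdd_prob \<mu>" and \<nu>: "bdd_prob \<nu>" and k: "continuous_on UNIV k" "continuous_on UNIV h"
    and R: "AE z in \<mu>. cmod z \<le> R" and S: "AE z in \<nu>. cmod z \<le> S"
    and le: "\<And>x. cmod x \<le> R + S \<Longrightarrow> k x \<le> h x"
  shows "mutual_energy k \<mu> \<nu> \<le> mutual_energy h \<mu> \<nu>"
  unfolding mutual_energy_def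
proof (rule integral_mono_AE)
  show "AE z in \<mu>. (LINT w|\<nu>. k (z - w)) \<le> (LINT w|\<nu>. h (z - w))"
    using R
  proof eventually_elim
    case (elim z)
    show ?case
    proof (rule integral_mono_AE)
      show "AE w in \<nu>. k (z - w) \<le> h (z - w)"
        using S
      proof eventually_elim
        case (elim w)
        show ?case
          by (rule le) (use norm_triangle_ineq4[of z w] elim \<open>cmod z \<le> R\<close> in linarith)
      qed
    qed (use kernel_integrable \<nu> k in auto)
  qed
qed (use potential_integrable \<mu> \<nu> k in auto)

lemma mutual_energy_mono_UNIV:
  assumes \<mu>: "bdd_prob \<mu>" and \<nu>: "bdd_prob \<nu>" and k: "continuous_on UNIV k" "continuous_on UNIV h"
    and le: "\<And>x. k x \<le> h x"
  shows "mutual_energy k \<mu> \<nu> \<le> mutual_energy h \<mu> \<nu>"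
  using mutual_energy_mono[OF \<mu> \<nu> k] le \<mu> \<nu> unfolding bdd_prob_def by blast

lemma mutual_energy_commute:
  assumes \<mu>: "bdd_prob \<mu>" and \<nu>: "bdd_prob \<nu>" and k: "continuous_on UNIV k" and ev: "\<And>x. k (- x) = k x"
  shows "mutual_energy k \<mu> \<nu> = mutual_energy k \<nu> \<mu>"
proof -
  interpret \<mu>: sigma_finite_measure \<mu> by (rule bdd_probD[OF \<mu>])
  interpret \<nu>: sigma_finite_measure \<nu> by (rule bdd_probD[OF \<nu>])
  interpret pair_sigma_finite \<mu> \<nu> ..
  have eq: "k (z - w) = k (w - z)" for z w using ev[of "z - w"] by simp
  have i: "integrable (\<mu> \<Otimes>\<^sub>M \<nu>) (\<lambda>(z, w). k (z - w))"
    using bdd_prob_pair_integrable[OF \<mu> \<nu> continuous_on_diff_kernel[OF k]] by (simp add: case_prod_beta')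
  have "mutual_energy k \<mu> \<nu> = (LINT w|\<nu>. LINT z|\<mu>. k (z - w))"
    unfolding mutual_energy_def using Fubini_integral[OF i] by simp
  also have "\<dots> = mutual_energy k \<nu> \<mu>" unfolding mutual_energy_def
    by (intro Bochner_Integration.integral_cong refl eq)
  finally show ?thesis .
qed

lemma finite_measure_Fubini:
  fixes f :: "'a \<Rightarrow> 'b \<Rightarrow> 'c::{banach, second_countable_topology}"
  assumes M: "finite_measure M" and N: "finite_measure N"
    and f: "(\<lambda>(x, y). f x y) \<in> borel_measurable (M \<Otimes>\<^sub>M N)" and B: "\<And>x y. norm (f x y) \<le> B"
  shows "(LINT x|M. LINT y|N. f x y) = (LINT y|N. LINT x|M. f x y)"
    and "integrable M (\<lambda>x. LINT y|N. f x y)" "integrable N (\<lambda>y. LINT x|M. f x y)"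
proof -
  interpret M: finite_measure M by fact
  interpret N: finite_measure N by fact
  interpret pair_sigma_finite M N ..
  interpret P: finite_measure "M \<Otimes>\<^sub>M N"
    by (rule finite_measure_pair_measure) fact+
  have i: "integrable (M \<Otimes>\<^sub>M N) (\<lambda>(x, y). f x y)"
    by (rule P.integrable_const_bound[of _ B]) (use f B in auto)
  show "(LINT x|M. LINT y|N. f x y) = (LINT y|N. LINT x|M. f x y)"
    using Fubini_integral[OF i] by simp
  show "integrable M (\<lambda>x. LINT y|N. f x y)" "integrable N (\<lambda>y. LINT x|M. f x y)"
    using integrable_fst[OF i] integrable_snd[OF i] by simp_all
qed

section \<open>Gaussian kernels\<close>

definition gauss :: "real \<Rightarrow> complex \<Rightarrow> real" where
  "gauss s x = exp (- s * (cmod x)\<^sup>2)"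

abbreviation normal2 :: "(real \<times> real) measure" where
  "normal2 \<equiv> std_normal_distribution \<Otimes>\<^sub>M std_normal_distribution"

text \<open>Random Fourier feature. The characteristic function of a standard normal variable is
  \<open>exp (- t^2 / 2)\<close>, so the factor \<open>sqrt (2 * s)\<close> makes the mean of
  \<open>feature s z\<close> times the conjugate of \<open>feature s w\<close> equal to
  \<open>gauss s (z - w)\<close>. The kernel becomes an inner product of unit vectors in L2 of
  \<open>normal2\<close>.\<close>

definition feature :: "real \<Rightarrow> complex \<Rightarrow> real \<times> real \<Rightarrow> complex" where
  "feature s z \<xi> = iexp (sqrt (2 * s) * (Re z * fst \<xi> + Im z * snd \<xi>))"

lemma borel_measurable_cnj [measurable (raw)]:
  "f \<in> borel_measurable M \<Longrightarrow> (\<lambda>x. cnj (f x)) \<in> borel_measurable M"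
  by (rule measurable_compose[OF _ borel_measurable_continuous_onI]) (auto intro: continuous_intros)

lemma prob_space_normal2: "prob_space normal2"
proof -
  interpret N: real_distribution std_normal_distribution by (rule real_dist_normal_dist)
  interpret pair_prob_space std_normal_distribution std_normal_distribution ..
  show ?thesis by unfold_locales
qed

lemma norm_feature [simp]: "norm (feature s z \<xi>) = 1"
  by (simp add: feature_def)

lemma gauss_eq_integral_feature:
  assumes "0 \<le> s"
  shows "complex_of_real (gauss s (z - w)) = (LINT \<xi>|normal2. feature s z \<xi> * cnj (feature s w \<xi>))"
proof -
  interpret N: real_distribution std_normal_distribution by (rule real_dist_normal_dist)
  interpret P: pair_prob_space std_normal_distribution std_normal_distribution ..
  define a b where "a = sqrt (2 * s) * Re (z - w)" and "b = sqrt (2 * s) * Im (z - w)"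
  have prod: "feature s z \<xi> * cnj (feature s w \<xi>) = iexp (a * fst \<xi>) * iexp (b * snd \<xi>)" for \<xi>
    unfolding feature_def a_def b_def exp_cnj exp_add[symmetric]
    by (rule arg_cong[of _ _ exp]) (simp add: algebra_simps)
  have m: "(\<lambda>\<xi>. iexp (a * fst \<xi>) * iexp (b * snd \<xi>)) \<in> borel_measurable normal2"
    by measurable
  have i: "integrable normal2 (\<lambda>\<xi>. iexp (a * fst \<xi>) * iexp (b * snd \<xi>))"
    by (rule P.integrable_const_bound[of _ 1]) (use m in \<open>auto simp: norm_mult\<close>)
  have "(LINT \<xi>|normal2. feature s z \<xi> * cnj (feature s w \<xi>))
      = (LINT x|std_normal_distribution. LINT y|std_normal_distribution. iexp (a * x) * iexp (b * y))"
    unfolding prod using P.integral_fst'[OF i] by simp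
  also have "\<dots> = (LINT x|std_normal_distribution. iexp (a * x)) * (LINT y|std_normal_distribution. iexp (b * y))"
    by simp
  also have "\<dots> = exp (- (a\<^sup>2) / 2) * exp (- (b\<^sup>2) / 2)"
    using char_std_normal_distribution unfolding char_def by (metis of_real_mult)
  also have "exp (- (a\<^sup>2) / 2) * exp (- (b\<^sup>2) / 2) = gauss s (z - w)"
    using assms unfolding gauss_def exp_add[symmetric] a_def b_def power_mult_distrib cmod_power2
    by (intro arg_cong[of _ _ exp]) (simp add: distrib_left)
  finally show ?thesis by simp
qed

lemma continuous_gauss: "continuous_on UNIV (gauss s)"
  unfolding gauss_def by (intro continuous_intros)

definition feature_mean :: "real \<Rightarrow> complex measure \<Rightarrow> real \<times> real \<Rightarrow> complex" where
  "feature_mean s \<mu> \<xi> = (LINT z|\<mu>. feature s z \<xi>)"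

lemma
  assumes \<mu>: "bdd_prob \<mu>"
  shows feature_mean_measurable: "feature_mean s \<mu> \<in> borel_measurable normal2"
    and norm_feature_mean: "norm (feature_mean s \<mu> \<xi>) \<le> 1"
    and feature_Fubini: "\<And>g. g \<in> borel_measurable normal2 \<Longrightarrow> (\<And>\<xi>. norm (g \<xi>) \<le> 1) \<Longrightarrow>
          (LINT z|\<mu>. LINT \<xi>|normal2. feature s z \<xi> * g \<xi>) = (LINT \<xi>|normal2. feature_mean s \<mu> \<xi> * g \<xi>)"
proof -
  interpret \<mu>: prob_space \<mu> by (rule bdd_probD[OF \<mu>])
  interpret N: prob_space normal2 by (rule prob_space_normal2)
  have [measurable_cong]: "sets \<mu> = sets borel" by (rule bdd_probD[OF \<mu>])
  have m: "(\<lambda>(z, \<xi>). feature s z \<xi>) \<in> borel_measurable (\<mu> \<Otimes>\<^sub>M normal2)"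
    unfolding feature_def by measurable
  show fm: "feature_mean s \<mu> \<in> borel_measurable normal2"
    using finite_measure_Fubini(3)[OF \<mu>.finite_measure_axioms N.finite_measure_axioms m, of 1]
    unfolding feature_mean_def[abs_def] by auto
  show "norm (feature_mean s \<mu> \<xi>) \<le> 1"
    unfolding feature_mean_def
    by (rule order_trans[OF integral_norm_bound]) (simp add: \<mu>.prob_space)
  fix g :: "real \<times> real \<Rightarrow> complex" assume g[measurable]: "g \<in> borel_measurable normal2" and g1: "\<And>\<xi>. norm (g \<xi>) \<le> 1"
  have "(\<lambda>(z, \<xi>). feature s z \<xi> * g \<xi>) \<in> borel_measurable (\<mu> \<Otimes>\<^sub>M normal2)"
    using m by measurable
  then have "(LINT z|\<mu>. LINT \<xi>|normal2. feature s z \<xi> * g \<xi>)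
    = (LINT \<xi>|normal2. LINT z|\<mu>. feature s z \<xi> * g \<xi>)"
    by (intro finite_measure_Fubini[where B=1])
       (auto simp: norm_mult g1 \<mu>.finite_measure_axioms N.finite_measure_axioms)
  then show "(LINT z|\<mu>. LINT \<xi>|normal2. feature s z \<xi> * g \<xi>) = (LINT \<xi>|normal2. feature_mean s \<mu> \<xi> * g \<xi>)"
    by (simp add: feature_mean_def)
qed

lemma integral_gauss_eq:
  assumes \<mu>: "bdd_prob \<mu>" and s: "0 \<le> s"
  shows "complex_of_real (LINT z|\<mu>. gauss s (z - w)) = (LINT \<xi>|normal2. feature_mean s \<mu> \<xi> * cnj (feature s w \<xi>))"
proof -
  have [measurable]: "(\<lambda>\<xi>. cnj (feature s w \<xi>)) \<in> borel_measurable normal2"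
    unfolding feature_def by measurable
  show ?thesis
    unfolding integral_complex_of_real[symmetric] gauss_eq_integral_feature[OF s]
    by (rule feature_Fubini[OF \<mu>]) auto
qed

lemma mutual_energy_gauss:
  assumes \<mu>: "bdd_prob \<mu>" and \<nu>: "bdd_prob \<nu>" and s: "0 \<le> s"
  shows "complex_of_real (mutual_energy (gauss s) \<mu> \<nu>)
    = (LINT \<xi>|normal2. feature_mean s \<mu> \<xi> * cnj (feature_mean s \<nu> \<xi>))"
proof -
  have [measurable]: "feature_mean s \<nu> \<in> borel_measurable normal2"
    by (rule feature_mean_measurable[OF \<nu>])
  have ev: "gauss s (z - w) = gauss s (w - z)" for z w by (simp add: gauss_def norm_minus_commute)
  have fe: "(\<lambda>\<xi>. feature s z \<xi>) \<in> borel_measurable normal2" for z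
    unfolding feature_def by measurable
  have *: "complex_of_real (LINT w|\<nu>. gauss s (z - w)) = (LINT \<xi>|normal2. feature s z \<xi> * cnj (feature_mean s \<nu> \<xi>))" for z
  proof -
    have "complex_of_real (LINT w|\<nu>. gauss s (z - w)) = cnj (complex_of_real (LINT w|\<nu>. gauss s (w - z)))"
      by (simp add: ev)
    also have "\<dots> = (LINT \<xi>|normal2. cnj (feature_mean s \<nu> \<xi> * cnj (feature s z \<xi>)))"
      unfolding integral_gauss_eq[OF \<nu> s] by (rule Bochner_Integration.integral_cnj[symmetric])
    finally show ?thesis by (simp add: mult.commute)
  qed
  have "complex_of_real (mutual_energy (gauss s) \<mu> \<nu>) = (LINT z|\<mu>. complex_of_real (LINT w|\<nu>. gauss s (z - w)))"
    unfolding mutual_energy_def by (rule integral_complex_of_real[symmetric])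
  then show ?thesis
    unfolding * by (subst (asm) feature_Fubini[OF \<mu>]) (auto simp: norm_feature_mean[OF \<nu>])
qed

text \<open>The Gaussian kernel is an inner product of features, so the quadratic form of
  \<open>\<mu> - \<nu>\<close> is the squared norm of the difference of the mean features. Positive
  definiteness is read off from this.\<close>

lemma energy_dist_gauss:
  assumes \<mu>: "bdd_prob \<mu>" and \<nu>: "bdd_prob \<nu>" and s: "0 \<le> s"
  shows "energy_dist (gauss s) \<mu> \<nu> = (LINT \<xi>|normal2. (cmod (feature_mean s \<mu> \<xi> - feature_mean s \<nu> \<xi>))\<^sup>2)"
proof -
  interpret N: prob_space normal2 by (rule prob_space_normal2)
  note [measurable] = feature_mean_measurable[OF \<mu>] feature_mean_measurable[OF \<nu>]
  have i: "integrable normal2 (\<lambda>\<xi>. feature_mean s \<alpha> \<xi> * cnj (feature_mean s \<beta> \<xi>))"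
    if \<alpha>: "bdd_prob \<alpha>" and \<beta>: "bdd_prob \<beta>" for \<alpha> \<beta>
  proof -
    note [measurable] = feature_mean_measurable[OF \<alpha>] feature_mean_measurable[OF \<beta>]
    show ?thesis
      by (rule N.integrable_const_bound[of _ 1])
         (auto simp: norm_mult intro!: AE_I2 mult_le_one norm_feature_mean \<alpha> \<beta>)
  qed
  have r: "mutual_energy (gauss s) \<alpha> \<beta> = (LINT \<xi>|normal2. Re (feature_mean s \<alpha> \<xi> * cnj (feature_mean s \<beta> \<xi>)))"
    if \<alpha>: "bdd_prob \<alpha>" and \<beta>: "bdd_prob \<beta>" for \<alpha> \<beta>
    using arg_cong[OF mutual_energy_gauss[OF \<alpha> \<beta> s], of Re] integral_Re[OF i[OF \<alpha> \<beta>]] by simp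
  have "(cmod (x - y))\<^sup>2 = Re (x * cnj x) + Re (y * cnj y) - 2 * Re (x * cnj y)" for x y
    unfolding cmod_power2 by (simp add: power2_eq_square algebra_simps)
  then show ?thesis
    unfolding energy_dist_def r[OF \<mu> \<mu>] r[OF \<nu> \<nu>] r[OF \<mu> \<nu>]
    using i[OF \<mu> \<mu>] i[OF \<nu> \<nu>] i[OF \<mu> \<nu>]
    by (simp del: times_complex.sel)
qed

lemma energy_dist_gauss_nonneg:
  "bdd_prob \<mu> \<Longrightarrow> bdd_prob \<nu> \<Longrightarrow> 0 \<le> s \<Longrightarrow> 0 \<le> energy_dist (gauss s) \<mu> \<nu>"
  by (simp add: energy_dist_gauss)

text \<open>The difference of two Gaussian integrals is the inner product of the difference of the
  mean features with the feature at \<open>a\<close>, a unit vector: Cauchy-Schwarz.\<close>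

lemma integral_gauss_diff_le:
  assumes \<mu>: "bdd_prob \<mu>" and \<nu>: "bdd_prob \<nu>" and s: "0 \<le> s"
  shows "((LINT z|\<mu>. gauss s (z - a)) - (LINT z|\<nu>. gauss s (z - a)))\<^sup>2 \<le> energy_dist (gauss s) \<mu> \<nu>"
proof -
  interpret N: prob_space normal2 by (rule prob_space_normal2)
  note [measurable] = feature_mean_measurable[OF \<mu>] feature_mean_measurable[OF \<nu>]
  have fe[measurable]: "(\<lambda>\<xi>. feature s z \<xi>) \<in> borel_measurable normal2" for z
    unfolding feature_def by measurable
  define d where "d \<xi> = cmod (feature_mean s \<mu> \<xi> - feature_mean s \<nu> \<xi>)" for \<xi>
  have d[measurable]: "d \<in> borel_measurable normal2" unfolding d_def by measurable
  have d2: "d \<xi> \<le> 2" "0 \<le> d \<xi>" for \<xi>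
    using norm_triangle_ineq4[of "feature_mean s \<mu> \<xi>" "feature_mean s \<nu> \<xi>"]
      norm_feature_mean[OF \<mu>, of s \<xi>] norm_feature_mean[OF \<nu>, of s \<xi>] unfolding d_def by auto
  have id: "integrable normal2 d"
    by (rule N.integrable_const_bound[of _ 2]) (use d2 in auto)
  have "d \<xi> ^ 2 \<le> 2 ^ 2" for \<xi> by (intro power_mono d2)
  then have id2: "integrable normal2 (\<lambda>\<xi>. (d \<xi>)\<^sup>2)"
    by (intro N.integrable_const_bound[of _ 4]) auto
  have i: "integrable normal2 (\<lambda>\<xi>. feature_mean s \<alpha> \<xi> * cnj (feature s a \<xi>))" if \<alpha>: "bdd_prob \<alpha>" for \<alpha>
  proof -
    note [measurable] = feature_mean_measurable[OF \<alpha>]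
    show ?thesis
      by (rule N.integrable_const_bound[of _ 1])
         (auto simp: norm_mult intro!: AE_I2 norm_feature_mean \<alpha>)
  qed
  let ?D = "(LINT z|\<mu>. gauss s (z - a)) - (LINT z|\<nu>. gauss s (z - a))"
  have "complex_of_real ?D = (LINT \<xi>|normal2. (feature_mean s \<mu> \<xi> - feature_mean s \<nu> \<xi>) * cnj (feature s a \<xi>))"
    using i[OF \<mu>] i[OF \<nu>] unfolding of_real_diff integral_gauss_eq[OF \<mu> s] integral_gauss_eq[OF \<nu> s]
    by (simp add: left_diff_distrib)
  then have "\<bar>?D\<bar> = norm (LINT \<xi>|normal2. (feature_mean s \<mu> \<xi> - feature_mean s \<nu> \<xi>) * cnj (feature s a \<xi>))"
    by (metis norm_of_real)
  also have "\<dots> \<le> (LINT \<xi>|normal2. d \<xi>)"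
    by (rule order_trans[OF integral_norm_bound]) (simp add: norm_mult d_def)
  finally have "?D\<^sup>2 \<le> (LINT \<xi>|normal2. d \<xi>)\<^sup>2"
    by (metis abs_ge_zero power2_abs power_mono)
  \<comment> \<open>Nonnegative variance of \<open>d\<close>: the square of the mean is at most the
    mean of the square.\<close>
  also have "\<dots> \<le> (LINT \<xi>|normal2. (d \<xi>)\<^sup>2)"
    using N.variance_eq[OF id id2] N.variance_positive[of d] by linarith
  also have "\<dots> = energy_dist (gauss s) \<mu> \<nu>"
    unfolding energy_dist_gauss[OF \<mu> \<nu> s] d_def ..
  finally show ?thesis .
qed

section \<open>Smoothed logarithmic kernels\<close>

definition log_kernel :: "real \<Rightarrow> complex \<Rightarrow> real" where
  "log_kernel \<delta> x = - ln ((cmod x)\<^sup>2 + \<delta>) / 2"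

lemma continuous_log_kernel: "0 < \<delta> \<Longrightarrow> continuous_on UNIV (log_kernel \<delta>)"
  unfolding log_kernel_def by (intro continuous_intros) (auto simp: add_nonneg_pos pos_add_strict less_imp_neq[symmetric])

lemma log_kernel_minus [simp]: "log_kernel \<delta> (- x) = log_kernel \<delta> x"
  by (simp add: log_kernel_def)

lemma log_kernel_antimono: "0 < \<delta> \<Longrightarrow> \<delta> \<le> \<delta>' \<Longrightarrow> log_kernel \<delta>' x \<le> log_kernel \<delta> x"
  unfolding log_kernel_def by (auto simp: add_nonneg_pos)

section \<open>Differences of logarithmic kernels as positive mixtures of Gaussians\<close>

lemma nn_integral_exp_mult:
  assumes "0 < a"
  shows "(\<integral>\<^sup>+ s. ennreal (exp (- s * a)) * indicator {0..} s \<partial>lborel) = ennreal (1 / a)"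
proof -
  have "(\<integral>\<^sup>+ s. ennreal (exp (- s * a)) * indicator {0..} s \<partial>lborel) = 0 - (- exp (- 0 * a) / a)"
  proof (rule nn_integral_FTC_atLeast[where F = "\<lambda>s. - exp (- s * a) / a"])
    show "((\<lambda>s. - exp (- s * a) / a) \<longlongrightarrow> 0) at_top" using assms by real_asymp
  qed (use assms in \<open>auto intro!: derivative_eq_intros\<close>)
  then show ?thesis by simp
qed

text \<open>The difference of exponentials divided by \<open>s\<close> is the integral of
  \<open>exp (- s * u)\<close> for \<open>u\<close> between \<open>\<delta>\<close> and
  \<open>T\<close>. Exchanging the integrals leaves the integral of
  \<open>1 / (r + u)\<close>.\<close>

lemma frullani:
  fixes r :: real
  assumes r: "0 \<le> r" and \<delta>: "0 < \<delta>" "\<delta> \<le> T"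
  shows "(\<integral>\<^sup>+ s. ennreal (exp (- s * r) * ((exp (- s * \<delta>) - exp (- s * T)) / s)) * indicator {0<..} s \<partial>lborel)
    = ennreal (ln ((r + T) / (r + \<delta>)))"
proof -
  let ?f = "\<lambda>s u. ennreal (exp (- s * (r + u))) * (indicator {\<delta>..T} u * indicator {0..} (s::real))"
  have "(\<integral>\<^sup>+ s. ennreal (exp (- s * r) * ((exp (- s * \<delta>) - exp (- s * T)) / s)) * indicator {0<..} s \<partial>lborel)
      = (\<integral>\<^sup>+ s. \<integral>\<^sup>+ u. ?f s u \<partial>lborel \<partial>lborel)"
  proof (rule nn_integral_cong_AE)
    \<comment> \<open>The left side carries the indicator of \<open>{0<..}\<close>, the right side
      that of \<open>{0..}\<close>; they differ at one point of measure zero.\<close>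
    have "AE s in lborel. s \<noteq> (0::real)" by (rule AE_lborel_singleton)
    then show "AE s in lborel. ennreal (exp (- s * r) * ((exp (- s * \<delta>) - exp (- s * T)) / s)) * indicator {0<..} s
        = (\<integral>\<^sup>+ u. ?f s u \<partial>lborel)"
    proof eventually_elim
      case (elim s)
      show ?case
      proof (cases "0 < s")
        case True
        have "(\<integral>\<^sup>+ u. ?f s u \<partial>lborel) = (\<integral>\<^sup>+ u. ennreal (exp (- s * (r + u))) * indicator {\<delta>..T} u \<partial>lborel)"
          using True by simp
        also have "\<dots> = (- exp (- s * (r + T)) / s) - (- exp (- s * (r + \<delta>)) / s)"
          by (rule nn_integral_FTC_Icc[where F = "\<lambda>u. - exp (- s * (r + u)) / s"])
             (use True \<delta> in \<open>auto intro!: derivative_eq_intros\<close>)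
        also have "(- exp (- s * (r + T)) / s) - (- exp (- s * (r + \<delta>)) / s)
            = exp (- s * r) * ((exp (- s * \<delta>) - exp (- s * T)) / s)"
          using True by (simp add: field_simps exp_add[symmetric] exp_diff)
        finally show ?thesis using True by simp
      qed (use elim in auto)
    qed
  qed
  also have "\<dots> = (\<integral>\<^sup>+ u. \<integral>\<^sup>+ s. ?f s u \<partial>lborel \<partial>lborel)"
    by (rule lborel_pair.Fubini') measurable
  also have "\<dots> = (\<integral>\<^sup>+ u. ennreal (1 / (r + u)) * indicator {\<delta>..T} u \<partial>lborel)"
  proof (rule nn_integral_cong)
    fix u :: real
    show "(\<integral>\<^sup>+ s. ?f s u \<partial>lborel) = ennreal (1 / (r + u)) * indicator {\<delta>..T} u"
      using nn_integral_exp_mult[of "r + u"] r \<delta> by (cases "u \<in> {\<delta>..T}") auto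
  qed
  also have "\<dots> = ln (r + T) - ln (r + \<delta>)"
    by (rule nn_integral_FTC_Icc) (use r \<delta> in \<open>auto intro!: derivative_eq_intros\<close>)
  also have "ln (r + T) - ln (r + \<delta>) = ln ((r + T) / (r + \<delta>))"
    using r \<delta> by (simp add: ln_div)
  finally show ?thesis .
qed

text \<open>Frullani's weight for the pair \<open>\<delta>\<close>, \<open>T\<close>; the factor one
  half comes from \<open>log_kernel\<close> being half a logarithm of a square. A single kernel
  would need the weight \<open>exp (- s * \<delta>) / s\<close>, which has infinite mass near 0;
  only differences of kernels are finite mixtures.\<close>

definition mixing_weight :: "real \<Rightarrow> real \<Rightarrow> real \<Rightarrow> real" where
  "mixing_weight \<delta> T s = (exp (- s * \<delta>) - exp (- s * T)) / s / 2 * indicator {0<..} s"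

definition mixing :: "real \<Rightarrow> real \<Rightarrow> real measure" where
  "mixing \<delta> T = density lborel (\<lambda>s. ennreal (mixing_weight \<delta> T s))"

lemma mixing_weight_measurable [measurable]: "mixing_weight \<delta> T \<in> borel_measurable borel"
  unfolding mixing_weight_def[abs_def] by measurable

lemma mixing_weight_nonneg: "\<delta> \<le> T \<Longrightarrow> 0 \<le> mixing_weight \<delta> T s"
  by (auto simp: mixing_weight_def indicator_def)

text \<open>The absolute value changes nothing, because the weight vanishes for
  \<open>s \<le> 0\<close>. It keeps the integrand bounded by 1 on the whole line, where a negative
  \<open>s\<close> would give an unbounded function.\<close>

lemma nn_integral_mixing_gauss:
  assumes "0 < \<delta>" "\<delta> \<le> T"
  shows "(\<integral>\<^sup>+ s. ennreal (gauss \<bar>s\<bar> x) \<partial>mixing \<delta> T) = ennreal (log_kernel \<delta> x - log_kernel T x)"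
proof -
  have "(\<integral>\<^sup>+ s. ennreal (gauss \<bar>s\<bar> x) \<partial>mixing \<delta> T)
      = (\<integral>\<^sup>+ s. ennreal (mixing_weight \<delta> T s) * ennreal (gauss \<bar>s\<bar> x) \<partial>lborel)"
    unfolding mixing_def by (rule nn_integral_density) (auto simp: gauss_def)
  also have "\<dots> = (\<integral>\<^sup>+ s. ennreal (1/2) * (ennreal (exp (- s * (cmod x)\<^sup>2) * ((exp (- s * \<delta>) - exp (- s * T)) / s)) * indicator {0<..} s) \<partial>lborel)"
  proof (rule nn_integral_cong)
    fix s :: real
    let ?X = "exp (- s * (cmod x)\<^sup>2) * ((exp (- s * \<delta>) - exp (- s * T)) / s)"
    show "ennreal (mixing_weight \<delta> T s) * ennreal (gauss \<bar>s\<bar> x)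
        = ennreal (1/2) * (ennreal ?X * indicator {0<..} s)"
    proof (cases "0 < s")
      case True
      have "0 \<le> ?X" using True assms by auto
      then have "ennreal (1/2) * ennreal ?X = ennreal (1/2 * ?X)" by (rule ennreal_mult[symmetric, rotated]) simp
      moreover have "1/2 * ?X = mixing_weight \<delta> T s * gauss \<bar>s\<bar> x"
        using True by (simp add: mixing_weight_def gauss_def mult_ac)
      ultimately show ?thesis
        using True mixing_weight_nonneg[OF assms(2), of s] by (simp add: ennreal_mult'[symmetric])
    qed (auto simp: mixing_weight_def)
  qed
  also have "\<dots> = ennreal (1/2) * ennreal (ln (((cmod x)\<^sup>2 + T) / ((cmod x)\<^sup>2 + \<delta>)))"
  proof -
    have "(\<lambda>s. ennreal (exp (- s * (cmod x)\<^sup>2) * ((exp (- s * \<delta>) - exp (- s * T)) / s)) * indicator {0<..} s)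
        \<in> borel_measurable lborel"
      by measurable
    then show ?thesis
      by (simp only: nn_integral_cmult frullani[OF zero_le_power2 assms])
  qed
  also have "\<dots> = ennreal (log_kernel \<delta> x - log_kernel T x)"
  proof -
    have p: "0 < (cmod x)\<^sup>2 + T" "0 < (cmod x)\<^sup>2 + \<delta>" using assms by (auto intro: add_nonneg_pos)
    show ?thesis using p assms
      by (subst ennreal_mult[symmetric]) (auto simp: log_kernel_def ln_div field_simps)
  qed
  finally show ?thesis .
qed

lemma sets_mixing [simp, measurable_cong]: "sets (mixing \<delta> T) = sets borel"
  by (simp add: mixing_def)

text \<open>Every Gaussian equals 1 at the origin, so the total mass is the difference of the two
  kernels at \<open>x = 0\<close>.\<close>

lemma finite_mixing:
  assumes "0 < \<delta>" "\<delta> \<le> T"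
  shows "finite_measure (mixing \<delta> T)"
proof (rule finite_measureI)
  have "emeasure (mixing \<delta> T) (space (mixing \<delta> T)) = (\<integral>\<^sup>+ s. ennreal (gauss \<bar>s\<bar> 0) \<partial>mixing \<delta> T)"
    by (simp add: gauss_def)
  then show "emeasure (mixing \<delta> T) (space (mixing \<delta> T)) \<noteq> \<infinity>"
    by (simp add: nn_integral_mixing_gauss[OF assms])
qed

lemma integral_mixing_gauss:
  assumes "0 < \<delta>" "\<delta> \<le> T"
  shows "(LINT s|mixing \<delta> T. gauss \<bar>s\<bar> x) = log_kernel \<delta> x - log_kernel T x"
  using log_kernel_antimono[OF assms]
  by (subst integral_eq_nn_integral) (auto simp: nn_integral_mixing_gauss[OF assms], auto simp: gauss_def)

lemma mutual_energy_mixing: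
  assumes \<mu>: "bdd_prob \<mu>" and \<nu>: "bdd_prob \<nu>" and \<delta>: "0 < \<delta>" "\<delta> \<le> T"
  shows "mutual_energy (\<lambda>x. log_kernel \<delta> x - log_kernel T x) \<mu> \<nu>
      = (LINT s|mixing \<delta> T. mutual_energy (gauss \<bar>s\<bar>) \<mu> \<nu>)"
    and "integrable (mixing \<delta> T) (\<lambda>s. mutual_energy (gauss \<bar>s\<bar>) \<mu> \<nu>)"
proof -
  interpret \<mu>: prob_space \<mu> by (rule bdd_probD[OF \<mu>])
  interpret \<nu>: prob_space \<nu> by (rule bdd_probD[OF \<nu>])
  interpret P: pair_prob_space \<mu> \<nu> ..
  have [measurable_cong]: "sets \<mu> = sets borel" "sets \<nu> = sets borel"
    by (rule bdd_probD[OF \<mu>] bdd_probD[OF \<nu>])+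
  have cont: "continuous_on UNIV (\<lambda>x. log_kernel \<delta> x - log_kernel T x)"
    using \<delta> by (intro continuous_intros continuous_log_kernel) auto
  have m: "(\<lambda>(p, s). gauss \<bar>s\<bar> (fst p - snd p)) \<in> borel_measurable ((\<mu> \<Otimes>\<^sub>M \<nu>) \<Otimes>\<^sub>M mixing \<delta> T)"
    unfolding gauss_def by measurable
  have b: "norm (gauss \<bar>s\<bar> (fst p - snd p)) \<le> 1" for s p
    by (simp add: gauss_def)
  note F = finite_measure_Fubini[OF P.finite_measure_axioms finite_mixing[OF \<delta>] m b]
  show "mutual_energy (\<lambda>x. log_kernel \<delta> x - log_kernel T x) \<mu> \<nu>
      = (LINT s|mixing \<delta> T. mutual_energy (gauss \<bar>s\<bar>) \<mu> \<nu>)"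
    unfolding mutual_energy_pair[OF \<mu> \<nu> cont] mutual_energy_pair[OF \<mu> \<nu> continuous_gauss]
    unfolding integral_mixing_gauss[OF \<delta>, symmetric]
    by (rule F)
  show "integrable (mixing \<delta> T) (\<lambda>s. mutual_energy (gauss \<bar>s\<bar>) \<mu> \<nu>)"
    unfolding mutual_energy_pair[OF \<mu> \<nu> continuous_gauss] by (rule F)
qed

lemma energy_dist_mixing:
  assumes \<mu>: "bdd_prob \<mu>" and \<nu>: "bdd_prob \<nu>" and \<delta>: "0 < \<delta>" "\<delta> \<le> T"
  shows "energy_dist (log_kernel \<delta>) \<mu> \<nu>
      = energy_dist (log_kernel T) \<mu> \<nu> + (LINT s|mixing \<delta> T. energy_dist (gauss \<bar>s\<bar>) \<mu> \<nu>)"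
    and "integrable (mixing \<delta> T) (\<lambda>s. energy_dist (gauss \<bar>s\<bar>) \<mu> \<nu>)"
proof -
  note m = mutual_energy_mixing[OF _ _ \<delta>]
  have cT: "continuous_on UNIV (log_kernel T)"
    and c: "continuous_on UNIV (\<lambda>x. log_kernel \<delta> x - log_kernel T x)"
    using \<delta> by (intro continuous_intros continuous_log_kernel; simp)+
  have "energy_dist (log_kernel \<delta>) \<mu> \<nu>
      = energy_dist (\<lambda>x. log_kernel T x + (log_kernel \<delta> x - log_kernel T x)) \<mu> \<nu>"
    by simp
  also have "\<dots> = energy_dist (log_kernel T) \<mu> \<nu> + energy_dist (\<lambda>x. log_kernel \<delta> x - log_kernel T x) \<mu> \<nu>"
    by (rule energy_dist_add[OF \<mu> \<nu> cT c])
  also have "energy_dist (\<lambda>x. log_kernel \<delta> x - log_kernel T x) \<mu> \<nu>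
      = (LINT s|mixing \<delta> T. energy_dist (gauss \<bar>s\<bar>) \<mu> \<nu>)"
    unfolding energy_dist_def using \<mu> \<nu> by (simp add: m)
  finally show "energy_dist (log_kernel \<delta>) \<mu> \<nu>
      = energy_dist (log_kernel T) \<mu> \<nu> + (LINT s|mixing \<delta> T. energy_dist (gauss \<bar>s\<bar>) \<mu> \<nu>)" .
  show "integrable (mixing \<delta> T) (\<lambda>s. energy_dist (gauss \<bar>s\<bar>) \<mu> \<nu>)"
    unfolding energy_dist_def using \<mu> \<nu> by (simp add: m)
qed

text \<open>Passing from \<open>T\<close> down to \<open>\<delta>\<close> adds a nonnegative mixture
  of Gaussian distances. An estimate obtained for a very small smoothing thus carries over to the
  fixed smoothing 1.\<close>

lemma energy_dist_log_kernel_antimono: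
  assumes \<mu>: "bdd_prob \<mu>" and \<nu>: "bdd_prob \<nu>" and \<delta>: "0 < \<delta>" "\<delta> \<le> T"
  shows "energy_dist (log_kernel T) \<mu> \<nu> \<le> energy_dist (log_kernel \<delta>) \<mu> \<nu>"
  unfolding energy_dist_mixing(1)[OF assms]
  by (simp add: energy_dist_gauss_nonneg \<mu> \<nu>)

text \<open>The distance decreases as the smoothing grows, and for large \<open>T\<close> the kernel
  is nearly constant on a bounded set: after adding \<open>ln T / 2\<close>, which does not affect
  the distance, it lies between 0 and minus a multiple of \<open>1 / T\<close>. Letting
  \<open>T\<close> tend to infinity gives the lower bound 0.\<close>

lemma energy_dist_log_kernel_nonneg:
  assumes \<mu>: "bdd_prob \<mu>" and \<nu>: "bdd_prob \<nu>" and \<delta>: "0 < \<delta>"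
  shows "0 \<le> energy_dist (log_kernel \<delta>) \<mu> \<nu>"
proof -
  obtain R1 where R1: "AE z in \<mu>. cmod z \<le> R1" using \<mu> by (auto simp: bdd_prob_def)
  obtain R2 where R2: "AE z in \<nu>. cmod z \<le> R2" using \<nu> by (auto simp: bdd_prob_def)
  define R where "R = max (max R1 R2) 0"
  have R: "AE z in \<mu>. cmod z \<le> R" "AE z in \<nu>. cmod z \<le> R" "0 \<le> R"
    using R1 R2 unfolding R_def by auto
  have lb: "- (2 * R)\<^sup>2 / T \<le> energy_dist (log_kernel \<delta>) \<mu> \<nu>" if T: "\<delta> \<le> T" for T
  proof -
    have T0: "0 < T" using T \<delta> by simp
    let ?k = "\<lambda>x. log_kernel T x + ln T / 2"
    have ck: "continuous_on UNIV (log_kernel T)" by (rule continuous_log_kernel[OF T0])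
    have c: "continuous_on UNIV ?k" by (intro continuous_intros ck)
    have up: "?k x \<le> 0" for x
    proof -
      have "ln T \<le> ln ((cmod x)\<^sup>2 + T)"
        using T0 by (subst ln_le_cancel_iff) (auto intro: add_nonneg_pos)
      then show ?thesis by (simp add: log_kernel_def)
    qed
    have lo: "- (2 * R)\<^sup>2 / T / 2 \<le> ?k x" if x: "cmod x \<le> R + R" for x
    proof -
      have "(cmod x)\<^sup>2 \<le> (2 * R)\<^sup>2" using x by (intro power_mono) auto
      then have "((cmod x)\<^sup>2 + T) / T \<le> 1 + (2 * R)\<^sup>2 / T" using T0 by (simp add: field_simps)
      moreover have "ln (((cmod x)\<^sup>2 + T) / T) \<le> ((cmod x)\<^sup>2 + T) / T - 1"
        using T0 by (intro ln_le_minus_one divide_pos_pos add_nonneg_pos) auto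
      moreover have "ln (((cmod x)\<^sup>2 + T) / T) = ln ((cmod x)\<^sup>2 + T) - ln T"
        using T0 add_nonneg_pos[OF zero_le_power2[of "cmod x"] T0] by (simp add: ln_div)
      ultimately show ?thesis by (simp add: log_kernel_def)
    qed
    have mlo: "- (2 * R)\<^sup>2 / T / 2 \<le> mutual_energy ?k \<alpha> \<alpha>"
      if "bdd_prob \<alpha>" "AE z in \<alpha>. cmod z \<le> R" for \<alpha>
      using mutual_energy_mono[OF that(1) that(1) _ c that(2) that(2) lo]
      by (simp add: mutual_energy_const[OF that(1) that(1)])
    have mup: "mutual_energy ?k \<mu> \<nu> \<le> 0"
      using mutual_energy_mono_UNIV[OF \<mu> \<nu> c _ up] by (simp add: mutual_energy_const[OF \<mu> \<nu>])
    have "- (2 * R)\<^sup>2 / T \<le> energy_dist ?k \<mu> \<nu>"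
      unfolding energy_dist_def using mlo[OF \<mu> R(1)] mlo[OF \<nu> R(2)] mup by simp
    also have "\<dots> = energy_dist (log_kernel T) \<mu> \<nu>"
      by (simp add: energy_dist_add[OF \<mu> \<nu> ck] energy_dist_const[OF \<mu> \<nu>])
    also have "\<dots> \<le> energy_dist (log_kernel \<delta>) \<mu> \<nu>"
      by (rule energy_dist_log_kernel_antimono[OF \<mu> \<nu> \<delta> T])
    finally show ?thesis .
  qed
  have "((\<lambda>T. - (2 * R)\<^sup>2 / T) \<longlongrightarrow> 0) at_top" by real_asymp
  then show ?thesis
  proof (rule tendsto_upperbound)
    show "\<forall>\<^sub>F T in at_top. - (2 * R)\<^sup>2 / T \<le> energy_dist (log_kernel \<delta>) \<mu> \<nu>"
      using eventually_ge_at_top[of \<delta>] by eventually_elim (rule lb)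
  qed simp
qed

text \<open>The distance for \<open>log_kernel 1\<close> dominates the integral of the Gaussian
  distances over \<open>mixing 1 2\<close>, and the Gaussian distance drops by at most
  \<open>2 * \<epsilon>\<close> while the parameter stays in
  \<open>{S..S * (1 + \<epsilon>)}\<close>. The constant is the mass of that interval; it does not
  depend on the measures, whose supports have no common bound.\<close>

lemma gauss_le_of_log_kernel_dist:
  assumes S: "0 < S" and \<epsilon>: "0 < \<epsilon>"
  shows "\<exists>c>0. \<forall>\<mu> \<nu>. bdd_prob \<mu> \<longrightarrow> bdd_prob \<nu> \<longrightarrow>
    energy_dist (gauss S) \<mu> \<nu> \<le> 2 * \<epsilon> + energy_dist (log_kernel 1) \<mu> \<nu> / c"
proof (intro exI conjI allI impI)
  let ?I = "{S..S * (1 + \<epsilon>)}"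
  let ?c = "measure (mixing 1 2) ?I"
  interpret F: finite_measure "mixing 1 2" by (rule finite_mixing) auto
  show c: "0 < ?c"
  proof (rule ccontr)
    assume "\<not> 0 < ?c"
    then have "emeasure (mixing 1 2) ?I = 0"
      using F.emeasure_eq_measure[of ?I] measure_nonneg[of "mixing 1 2" ?I] by simp
    then have "?I \<in> null_sets (mixing 1 2)" by (intro null_setsI) auto
    then have ae: "AE s in lborel. s \<in> ?I \<longrightarrow> ennreal (mixing_weight 1 2 s) = 0"
      unfolding mixing_def by (subst (asm) null_sets_density_iff) auto
    have "0 < mixing_weight 1 2 s" if "s \<in> ?I" for s
      using that S by (auto simp: mixing_weight_def)
    with ae have "AE s in lborel. s \<notin> ?I" by (auto elim!: eventually_mono) force
    then have "emeasure lborel ?I = 0" by (subst (asm) AE_iff_measurable[where N="?I"]) auto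
    moreover have "emeasure lborel ?I = ennreal (S * \<epsilon>)"
      using S \<epsilon> by (subst emeasure_lborel_Icc) (auto simp: algebra_simps)
    ultimately show False using S \<epsilon> by simp
  qed
  fix \<mu> \<nu> assume \<mu>: "bdd_prob \<mu>" and \<nu>: "bdd_prob \<nu>"
  let ?q = "\<lambda>s. energy_dist (gauss \<bar>s\<bar>) \<mu> \<nu>"
  have q: "?q S - 2 * \<epsilon> \<le> ?q s" if s: "s \<in> ?I" for s
  proof -
    have a: "gauss s x \<le> gauss S x" for x using s by (auto simp: gauss_def mult_right_mono)
    \<comment> \<open>The loss is at most the relative move \<open>(s - S) / S\<close>, uniformly in
      \<open>x\<close>, because \<open>u * exp (- u)\<close> never exceeds 1.\<close>
    have b: "gauss S x \<le> gauss s x + \<epsilon>" for x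
    proof -
      let ?r = "(cmod x)\<^sup>2"
      have 1: "1 - exp (- (s - S) * ?r) \<le> (s - S) * ?r"
        using exp_ge_add_one_self[of "- (s - S) * ?r"] unfolding mult_minus_left by linarith
      have "S * ?r \<le> exp (S * ?r)" using exp_ge_add_one_self[of "S * ?r"] by linarith
      then have 2: "exp (- S * ?r) * (S * ?r) \<le> 1" by (simp add: exp_minus field_simps)
      have "gauss S x - gauss s x = exp (- S * ?r) * (1 - exp (- (s - S) * ?r))"
      proof -
        have "exp (- S * ?r) * exp (- (s - S) * ?r) = exp (- s * ?r)"
          by (simp add: mult_exp_exp algebra_simps)
        then show ?thesis by (simp add: gauss_def right_diff_distrib)
      qed
      also have "\<dots> \<le> exp (- S * ?r) * ((s - S) * ?r)" using 1 by (intro mult_left_mono) auto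
      also have "\<dots> = (s - S) / S * (exp (- S * ?r) * (S * ?r))" using S by simp
      also have "\<dots> \<le> (s - S) / S * 1" using 2 s S by (intro mult_left_mono) auto
      also have "\<dots> \<le> \<epsilon>" using s S by (auto simp: field_simps)
      finally show ?thesis by simp
    qed
    have c': "continuous_on UNIV (\<lambda>x. gauss s x + \<epsilon>)" by (intro continuous_intros continuous_gauss)
    \<comment> \<open>Each of the two self energies loses at most \<open>\<epsilon>\<close>, while
      the cross energy moves in the favourable direction; hence
      \<open>2 * \<epsilon>\<close>.\<close>
    have m1: "mutual_energy (gauss S) \<alpha> \<alpha> \<le> mutual_energy (gauss s) \<alpha> \<alpha> + \<epsilon>" if \<alpha>: "bdd_prob \<alpha>" for \<alpha>
    proof -
      have "mutual_energy (gauss S) \<alpha> \<alpha> \<le> mutual_energy (\<lambda>x. gauss s x + \<epsilon>) \<alpha> \<alpha>"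
        by (rule mutual_energy_mono_UNIV[OF \<alpha> \<alpha> continuous_gauss c' b])
      also have "\<dots> = mutual_energy (gauss s) \<alpha> \<alpha> + \<epsilon>"
        by (simp add: mutual_energy_add[OF \<alpha> \<alpha> continuous_gauss] mutual_energy_const[OF \<alpha> \<alpha>])
      finally show ?thesis .
    qed
    have m2: "mutual_energy (gauss s) \<mu> \<nu> \<le> mutual_energy (gauss S) \<mu> \<nu>"
      by (rule mutual_energy_mono_UNIV[OF \<mu> \<nu> continuous_gauss continuous_gauss a])
    have "\<bar>s\<bar> = s" "\<bar>S\<bar> = S" using s S by auto
    then show ?thesis
      unfolding energy_dist_def using m1[OF \<mu>] m1[OF \<nu>] m2 by simp
  qed
  have "(?q S - 2 * \<epsilon>) * ?c = (LINT s|mixing 1 2. (?q S - 2 * \<epsilon>) * indicator ?I s)"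
    by simp
  also have "\<dots> \<le> (LINT s|mixing 1 2. ?q s)"
  proof (rule integral_mono)
    show "integrable (mixing 1 2) (\<lambda>s. (?q S - 2 * \<epsilon>) * indicator ?I s)"
      by (intro integrable_mult_right integrable_real_indicator) (auto simp: F.emeasure_eq_measure)
    show "integrable (mixing 1 2) ?q" by (rule energy_dist_mixing[OF \<mu> \<nu>]) auto
  qed (use q energy_dist_gauss_nonneg[OF \<mu> \<nu>] in \<open>auto simp: indicator_def\<close>)
  also have "\<dots> \<le> energy_dist (log_kernel 1) \<mu> \<nu>"
    unfolding energy_dist_mixing(1)[OF \<mu> \<nu> zero_less_one, of 2, simplified]
    using energy_dist_log_kernel_nonneg[OF \<mu> \<nu>, of 2] by simp
  finally show "energy_dist (gauss S) \<mu> \<nu> \<le> 2 * \<epsilon> + energy_dist (log_kernel 1) \<mu> \<nu> / ?c"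
    using c S by (simp add: field_simps)
qed

section \<open>Logarithmic energy\<close>

lemma prob_measures_onD:
  assumes E: "compact E" and \<mu>: "\<mu> \<in> prob_measures_on E"
  shows "AE z in \<mu>. z \<in> E" "bdd_prob \<mu>"
proof -
  have s: "sets \<mu> = sets borel" and p: "prob_space \<mu>" and e: "emeasure \<mu> (UNIV - E) = 0"
    using \<mu> by (auto simp: prob_measures_on_def)
  have "UNIV - E \<in> sets borel" using compact_imp_closed[OF E] by (simp add: borel_closed sets.Diff)
  then show ae: "AE z in \<mu>. z \<in> E"
    by (intro AE_I[OF _ e]) (auto simp: s)
  obtain R where "\<And>z. z \<in> E \<Longrightarrow> cmod z \<le> R"
    using compact_imp_bounded[OF E] by (auto simp: bounded_iff)
  then have "AE z in \<mu>. cmod z \<le> R" using ae by (auto elim!: eventually_mono)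
  then show "bdd_prob \<mu>" unfolding bdd_prob_def using s p by blast
qed

lemma nn_mutual_energy:
  assumes \<mu>: "bdd_prob \<mu>" and \<nu>: "bdd_prob \<nu>" and k: "continuous_on UNIV k"
    and R: "AE z in \<mu>. cmod z \<le> R" and S: "AE z in \<nu>. cmod z \<le> S"
    and nn: "\<And>x. cmod x \<le> R + S \<Longrightarrow> 0 \<le> k x"
  shows "(\<integral>\<^sup>+ z. \<integral>\<^sup>+ w. ennreal (k (z - w)) \<partial>\<nu> \<partial>\<mu>) = ennreal (mutual_energy k \<mu> \<nu>)"
proof -
  have ae: "AE w in \<nu>. 0 \<le> k (z - w)" if "cmod z \<le> R" for z
    using S
  proof eventually_elim
    case (elim w)
    show ?case by (rule nn) (use norm_triangle_ineq4[of z w] elim that in linarith)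
  qed
  have "(\<integral>\<^sup>+ z. \<integral>\<^sup>+ w. ennreal (k (z - w)) \<partial>\<nu> \<partial>\<mu>) = (\<integral>\<^sup>+ z. ennreal (LINT w|\<nu>. k (z - w)) \<partial>\<mu>)"
    using R by (intro nn_integral_cong_AE, eventually_elim)
       (rule nn_integral_eq_integral[OF kernel_integrable[OF \<nu> k] ae])
  also have "\<dots> = ennreal (mutual_energy k \<mu> \<nu>)"
    unfolding mutual_energy_def
    using R by (intro nn_integral_eq_integral potential_integrable \<mu> \<nu> k, eventually_elim)
       (intro integral_nonneg_AE ae)
  finally show ?thesis .
qed

lemma log_kernel_tendsto:
  "(\<lambda>n. ennreal (log_kernel (1 / Suc n) x + c)) \<longlonglongrightarrow>
     (if x = 0 then \<infinity> else ennreal (c - ln (cmod x)))"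
proof (cases "x = 0")
  case True
  have "filterlim (\<lambda>n. - ln (1 / real (Suc n)) / 2 + c) at_top sequentially"
    by real_asymp
  then have "filterlim (\<lambda>n. log_kernel (1 / Suc n) x + c) at_top sequentially"
    by (simp add: log_kernel_def True)
  then show ?thesis using True
    by (simp add: ennreal_tendsto_top_eq_at_top)
next
  case False
  have "(\<lambda>n. - ln ((cmod x)\<^sup>2 + 1 / Suc n) / 2 + c) \<longlonglongrightarrow> - ln ((cmod x)\<^sup>2 + 0) / 2 + c"
    using False
    by (intro tendsto_intros LIMSEQ_Suc[OF lim_1_over_n]) auto
  moreover have "- ln ((cmod x)\<^sup>2 + 0) / 2 + c = c - ln (cmod x)"
    using False by (simp add: ln_realpow)
  ultimately show ?thesis using False
    unfolding log_kernel_def by (auto intro!: tendsto_ennrealI)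
qed

text \<open>The definition of the energy subtracts two integrals, the first possibly infinite.
  Adding \<open>c\<close> makes all smoothed kernels nonnegative on the support, so monotone
  convergence applies in both variables, and \<open>c\<close> is removed at the end. The limit may
  be infinite.\<close>

lemma log_energy_LIMSEQ:
  assumes E: "compact E" and \<mu>: "\<mu> \<in> prob_measures_on E"
  shows "(\<lambda>n. ereal (mutual_energy (log_kernel (1 / Suc n)) \<mu> \<mu>)) \<longlonglongrightarrow> log_energy \<mu>"
proof -
  note b = prob_measures_onD(2)[OF E \<mu>] and ae = prob_measures_onD(1)[OF E \<mu>]
  interpret prob_space \<mu> by (rule bdd_probD[OF b])
  have [measurable_cong]: "sets \<mu> = sets borel" by (rule bdd_probD[OF b])
  obtain R0 where R0: "AE z in \<mu>. cmod z \<le> R0" using b by (auto simp: bdd_prob_def)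
  define R where "R = max R0 0"
  have R: "AE z in \<mu>. cmod z \<le> R" "0 \<le> R" using R0 by (auto simp: R_def)
  \<comment> \<open>Chosen so that \<open>(2 * R)^2 + 1 \<le> D^2\<close>, which bounds
    \<open>|x|^2 + 1 / Suc n\<close> for all \<open>n\<close> at once.\<close>
  define D where "D = 2 * R + 1"
  have D: "1 \<le> D" using R by (simp add: D_def)
  define c where "c = ln D"
  have c: "0 \<le> c" using D by (simp add: c_def)
  have nn: "0 \<le> log_kernel (1 / Suc n) x + c" if x: "cmod x \<le> R + R" for n x
  proof -
    have "(cmod x)\<^sup>2 \<le> (2 * R)\<^sup>2" using x by (intro power_mono) auto
    moreover have "1 / real (Suc n) \<le> 1" by simp
    ultimately have "(cmod x)\<^sup>2 + 1 / Suc n \<le> D\<^sup>2"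
      using R unfolding D_def power2_eq_square distrib_left distrib_right by linarith
    then have "ln ((cmod x)\<^sup>2 + 1 / Suc n) \<le> ln (D\<^sup>2)"
      using D by (subst ln_le_cancel_iff) (auto intro!: add_nonneg_pos)
    then show ?thesis using D by (simp add: log_kernel_def c_def ln_realpow)
  qed
  define F where "F n x = ennreal (log_kernel (1 / Suc n) x + c)" for n x
  have ck: "continuous_on UNIV (log_kernel (1 / Suc n))" for n by (rule continuous_log_kernel) simp
  have cF: "continuous_on UNIV (\<lambda>x. log_kernel (1 / Suc n) x + c)" for n
    by (intro continuous_intros ck)
  have mF: "F n \<in> borel_measurable borel" for n
    unfolding F_def using borel_measurable_continuous_onI[OF cF] by measurable
  have mF'[measurable]: "(\<lambda>p. F n (fst p - snd p)) \<in> borel_measurable (borel \<Otimes>\<^sub>M borel)" for n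
    by (rule measurable_compose[OF _ mF]) measurable
  have mF1[measurable]: "(\<lambda>w. F n (z - w)) \<in> borel_measurable borel" for n z
    by (rule measurable_compose[OF _ mF]) measurable
  have inc: "incseq (\<lambda>n. F n x)" for x
    unfolding F_def by (intro incseq_SucI ennreal_leI add_right_mono log_kernel_antimono) (auto simp: field_simps)
  define G where "G x = (SUP n. F n x)" for x
  have [measurable]: "G \<in> borel_measurable borel"
    unfolding G_def by (rule borel_measurable_SUP) (use mF in auto)
  let ?I = "\<lambda>n. mutual_energy (log_kernel (1 / Suc n)) \<mu> \<mu>"
  \<comment> \<open>Written with sums instead of differences, so that it also holds at
    \<open>x = 0\<close>, where both sides are infinite.\<close>
  have pw: "log_minus (cmod x) + ennreal c = ennreal (max (ln (cmod x)) 0) + G x"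
    if x: "cmod x \<le> R + R" for x
  proof -
    have S: "G x = (if x = 0 then \<infinity> else ennreal (c - ln (cmod x)))"
      unfolding G_def using LIMSEQ_unique[OF LIMSEQ_SUP[OF inc] log_kernel_tendsto[of x c, folded F_def]] .
    show ?thesis
    proof (cases "x = 0")
      case False
      have "ln (cmod x) \<le> c"
        using x False R unfolding c_def D_def by (subst ln_le_cancel_iff) auto
      then show ?thesis unfolding S using False c
        by (auto simp: log_minus_def max_def ennreal_plus[symmetric] simp del: ennreal_plus)
    qed (subst S, simp add: log_minus_def)
  qed
  define L where "L = (\<integral>\<^sup>+ z. \<integral>\<^sup>+ w. log_minus (cmod (z - w)) \<partial>\<mu> \<partial>\<mu>)"
  define P where "P = (\<integral>\<^sup>+ z. \<integral>\<^sup>+ w. ennreal (max (ln (cmod (z - w))) 0) \<partial>\<mu> \<partial>\<mu>)"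
  have [measurable]: "log_minus \<in> borel_measurable borel" unfolding log_minus_def[abs_def] by measurable
  have dist: "cmod (z - w) \<le> R + R" if "cmod z \<le> R" "cmod w \<le> R" for z w
    using norm_triangle_ineq4[of z w] that by linarith
  \<comment> \<open>The positive part of the logarithm has a finite integral, so \<open>P\<close>
    can be subtracted in \<open>ereal\<close> at the end.\<close>
  have "P \<le> (\<integral>\<^sup>+ z. \<integral>\<^sup>+ w. ennreal c \<partial>\<mu> \<partial>\<mu>)"
    unfolding P_def
  proof (intro nn_integral_mono_AE)
    show "AE z in \<mu>. (\<integral>\<^sup>+ w. ennreal (max (ln (cmod (z - w))) 0) \<partial>\<mu>) \<le> (\<integral>\<^sup>+ w. ennreal c \<partial>\<mu>)"
      using R(1)
    proof eventually_elim
      case z: (elim z)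
      show ?case
      proof (intro nn_integral_mono_AE)
        show "AE w in \<mu>. ennreal (max (ln (cmod (z - w))) 0) \<le> ennreal c"
          using R(1)
        proof eventually_elim
          case w: (elim w)
          have "ln (cmod (z - w)) \<le> c" if "z \<noteq> w"
            using dist[OF z w] that R unfolding c_def D_def by (subst ln_le_cancel_iff) auto
          then show ?case using c by (cases "z = w") (auto intro!: ennreal_leI)
        qed
      qed
    qed
  qed
  also have "\<dots> = ennreal c" by (simp add: emeasure_space_1)
  finally obtain p where p: "0 \<le> p" "P = ennreal p"
    by (metis ennreal_cases ennreal_less_top linorder_not_le top.not_eq_extremum order_less_le_trans)
  have "L + ennreal c = (\<integral>\<^sup>+ z. \<integral>\<^sup>+ w. log_minus (cmod (z - w)) + ennreal c \<partial>\<mu> \<partial>\<mu>)"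
    unfolding L_def by (simp add: nn_integral_add emeasure_space_1)
  also have "\<dots> = (\<integral>\<^sup>+ z. \<integral>\<^sup>+ w. ennreal (max (ln (cmod (z - w))) 0) + G (z - w) \<partial>\<mu> \<partial>\<mu>)"
    using R(1) by (intro nn_integral_cong_AE, eventually_elim)
      (use R(1) in \<open>intro nn_integral_cong_AE, eventually_elim, intro pw dist\<close>)
  also have "\<dots> = P + (\<integral>\<^sup>+ z. \<integral>\<^sup>+ w. G (z - w) \<partial>\<mu> \<partial>\<mu>)"
    unfolding P_def by (simp add: nn_integral_add)
  also have "(\<integral>\<^sup>+ z. \<integral>\<^sup>+ w. G (z - w) \<partial>\<mu> \<partial>\<mu>) = (\<integral>\<^sup>+ z. (SUP n. \<integral>\<^sup>+ w. F n (z - w) \<partial>\<mu>) \<partial>\<mu>)"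
    unfolding G_def using inc by (intro nn_integral_cong nn_integral_monotone_convergence_SUP) (auto simp: incseq_def le_fun_def)
  also have "\<dots> = (SUP n. \<integral>\<^sup>+ z. \<integral>\<^sup>+ w. F n (z - w) \<partial>\<mu> \<partial>\<mu>)"
    using inc by (intro nn_integral_monotone_convergence_SUP)
      (auto simp: incseq_def le_fun_def intro!: nn_integral_mono)
  also have "\<dots> = (SUP n. ennreal (?I n + c))"
    unfolding F_def by (subst nn_mutual_energy[OF b b cF R(1) R(1) nn])
       (auto simp: mutual_energy_add[OF b b ck] mutual_energy_const[OF b b] simp del: of_nat_Suc)
  finally have eq: "L + ennreal c = P + (SUP n. ennreal (?I n + c))" .
  define S where "S = (SUP n. ennreal (?I n + c))"
  have incI: "incseq (\<lambda>n. ?I n + c)"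
    by (intro incseq_SucI add_right_mono mutual_energy_mono_UNIV b ck log_kernel_antimono) (auto simp: field_simps)
  have "(\<lambda>n. ennreal (?I n + c)) \<longlonglongrightarrow> S"
    unfolding S_def using incI by (intro LIMSEQ_SUP) (auto simp: incseq_def intro!: ennreal_leI)
  then have "(\<lambda>n. enn2ereal (ennreal (?I n + c))) \<longlonglongrightarrow> enn2ereal S"
    by (rule tendsto_enn2erealI)
  moreover have I0: "0 \<le> ?I n + c" for n
  proof -
    have "mutual_energy (\<lambda>_. 0) \<mu> \<mu> \<le> mutual_energy (\<lambda>x. log_kernel (1 / Suc n) x + c) \<mu> \<mu>"
      by (rule mutual_energy_mono[OF b b _ cF R(1) R(1)]) (auto intro: nn simp del: of_nat_Suc)
    then show ?thesis
      by (simp add: mutual_energy_const[OF b b] mutual_energy_add[OF b b ck] del: of_nat_Suc)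
  qed
  ultimately have "(\<lambda>n. ereal (?I n + c)) \<longlonglongrightarrow> enn2ereal S"
    by (simp only: enn2ereal_ennreal)
  then have "(\<lambda>n. ereal (?I n + c) + ereal (- c)) \<longlonglongrightarrow> enn2ereal S + ereal (- c)"
    by (intro tendsto_add_ereal_general) auto
  then have lim: "(\<lambda>n. ereal (?I n)) \<longlonglongrightarrow> enn2ereal S + ereal (- c)" by simp
  have "enn2ereal L + ereal c = ereal p + enn2ereal S"
    using arg_cong[OF eq, of enn2ereal] p c unfolding S_def
    by (simp add: plus_ennreal.rep_eq enn2ereal_ennreal)
  then have "enn2ereal S + ereal (- c) = enn2ereal L - ereal p"
    using enn2ereal_nonneg[of L] enn2ereal_nonneg[of S]
    by (cases "enn2ereal L"; cases "enn2ereal S") auto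
  moreover have "log_energy \<mu> = enn2ereal L - ereal p"
    unfolding log_energy_def L_def[symmetric] P_def[symmetric] using p by (simp add: enn2ereal_ennreal)
  ultimately show ?thesis using lim by simp
qed

text \<open>Smoothed energies increase as the smoothing decreases, so the sequence
  \<open>1 / Suc n\<close> may be replaced by all \<open>\<delta>\<close>. A real bound on the
  energy becomes a family of bounds for continuous kernels.\<close>

lemma log_energy_le_iff:
  assumes E: "compact E" and \<mu>: "\<mu> \<in> prob_measures_on E"
  shows "log_energy \<mu> \<le> ereal c \<longleftrightarrow> (\<forall>\<delta>>0. mutual_energy (log_kernel \<delta>) \<mu> \<mu> \<le> c)"
proof
  note b = prob_measures_onD(2)[OF E \<mu>]
  let ?I = "\<lambda>n. mutual_energy (log_kernel (1 / Suc n)) \<mu> \<mu>"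
  have mono: "mutual_energy (log_kernel \<delta>') \<mu> \<mu> \<le> mutual_energy (log_kernel \<delta>) \<mu> \<mu>" if "0 < \<delta>" "\<delta> \<le> \<delta>'" for \<delta> \<delta>'
    using that by (intro mutual_energy_mono_UNIV b continuous_log_kernel log_kernel_antimono) auto
  have inc: "incseq (\<lambda>n. ereal (?I n))"
    by (intro incseq_SucI) (auto intro!: mono simp: field_simps)
  assume le: "log_energy \<mu> \<le> ereal c"
  show "\<forall>\<delta>>0. mutual_energy (log_kernel \<delta>) \<mu> \<mu> \<le> c"
  proof (intro allI impI)
    fix \<delta> :: real assume \<delta>: "0 < \<delta>"
    obtain n where n: "1 / Suc n \<le> \<delta>"
      using reals_Archimedean[OF \<delta>] by (auto simp: inverse_eq_divide intro: less_imp_le)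
    have "mutual_energy (log_kernel \<delta>) \<mu> \<mu> \<le> ?I n" by (rule mono) (use n in auto)
    also have "ereal (?I n) \<le> log_energy \<mu>"
      using LIMSEQ_unique[OF LIMSEQ_SUP[OF inc] log_energy_LIMSEQ[OF E \<mu>]] by (metis SUP_upper UNIV_I)
    finally show "mutual_energy (log_kernel \<delta>) \<mu> \<mu> \<le> c" using le by (meson ereal_less_eq(3) order_trans)
  qed
next
  assume le: "\<forall>\<delta>>0. mutual_energy (log_kernel \<delta>) \<mu> \<mu> \<le> c"
  have "ereal (mutual_energy (log_kernel (1 / Suc n)) \<mu> \<mu>) \<le> ereal c" for n
    using le[rule_format, of "1 / Suc n"] by (simp del: of_nat_Suc)
  then show "log_energy \<mu> \<le> ereal c"
    by (intro LIMSEQ_le_const2[OF log_energy_LIMSEQ[OF E \<mu>]] exI[of _ 0] allI impI)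
qed

section \<open>Compactness of probability measures on a compact set\<close>

text \<open>Cantor coding with digits 0 and 2. At the first differing position \<open>m\<close> the
  two sums differ by \<open>2 * (1/3)^m\<close>, and all later digits together can undo at most
  \<open>(1/3)^m\<close>; a difference below \<open>(1/3)^K\<close> therefore forces
  \<open>m > K\<close>.\<close>

lemma base3_digits_eq:
  fixes a b :: "nat \<Rightarrow> real"
  assumes a: "\<And>j. a j \<in> {0, 1}" and b: "\<And>j. b j \<in> {0, 1}"
    and less: "\<bar>(\<Sum>j. a j * 2 * (1/3) ^ j) - (\<Sum>j. b j * 2 * (1/3) ^ j)\<bar> < (1/3) ^ K" and k: "k \<le> K"
  shows "a k = b k"
proof (rule ccontr)
  assume "a k \<noteq> b k"
  define m where "m = (LEAST j. a j \<noteq> b j)"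
  have m: "a m \<noteq> b m"
    unfolding m_def by (rule LeastI[of "\<lambda>j. a j \<noteq> b j", OF \<open>a k \<noteq> b k\<close>])
  have mk: "m \<le> k"
    unfolding m_def by (rule Least_le[of "\<lambda>j. a j \<noteq> b j", OF \<open>a k \<noteq> b k\<close>])
  have lt: "a j = b j" if "j < m" for j
    using not_less_Least[of j "\<lambda>j. a j \<noteq> b j"] that unfolding m_def by simp
  have g: "summable (\<lambda>j. 2 * (1/3::real) ^ j)" by (intro summable_mult summable_geometric) simp
  have sa: "summable (\<lambda>j. a j * 2 * (1/3) ^ j)"
  proof (rule summable_comparison_test'[OF g, of 0])
    show "norm (a n * 2 * (1/3) ^ n) \<le> 2 * (1/3) ^ n" for n using a[of n] by auto
  qed
  have sb: "summable (\<lambda>j. b j * 2 * (1/3) ^ j)"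
  proof (rule summable_comparison_test'[OF g, of 0])
    show "norm (b n * 2 * (1/3) ^ n) \<le> 2 * (1/3) ^ n" for n using b[of n] by auto
  qed
  define d where "d j = (a j - b j) * 2 * (1/3) ^ j" for j
  have sd: "summable d" and eq: "(\<Sum>j. a j * 2 * (1/3) ^ j) - (\<Sum>j. b j * 2 * (1/3) ^ j) = suminf d"
    using summable_diff[OF sa sb] suminf_diff[OF sa sb] by (simp_all add: d_def[abs_def] left_diff_distrib)
  have ab: "\<bar>a j - b j\<bar> \<le> 1" for j using a[of j] b[of j] by auto
  have dm: "\<bar>d m\<bar> = 2 * (1/3) ^ m"
  proof -
    have "\<bar>a m - b m\<bar> = 1" using a[of m] b[of m] m by auto
    then show ?thesis by (simp add: d_def abs_mult)
  qed
  have tail: "\<bar>\<Sum>j. d (j + Suc m)\<bar> \<le> (1/3) ^ m"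
  proof -
    have gs: "(\<lambda>j. 2 * (1/3) ^ Suc m * (1/3::real) ^ j) sums (2 * (1/3) ^ Suc m * (1 / (1 - 1/3)))"
      by (intro sums_mult geometric_sums) simp
    have le: "norm (d (j + Suc m)) \<le> 2 * (1/3) ^ Suc m * (1/3) ^ j" for j
      using mult_right_mono[OF ab[of "j + Suc m"], of "2 * (1/3) ^ (j + Suc m)"]
      by (simp add: d_def abs_mult power_add mult_ac)
    have "norm (\<Sum>j. d (j + Suc m)) \<le> (\<Sum>j. 2 * (1/3) ^ Suc m * (1/3) ^ j)"
      by (rule norm_suminf_le) (use gs le in \<open>auto dest: sums_summable\<close>)
    also have "\<dots> = (1/3) ^ m" using sums_unique[OF gs] by simp
    finally show ?thesis by simp
  qed
  have "suminf d = (\<Sum>j. d (j + Suc m)) + (\<Sum>j<Suc m. d j)"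
    by (rule suminf_split_initial_segment[OF sd])
  also have "(\<Sum>j<Suc m. d j) = d m" by (simp add: d_def lt)
  finally have "(1/3) ^ m \<le> \<bar>suminf d\<bar>" using dm tail by linarith
  moreover have "(1/3::real) ^ K \<le> (1/3) ^ m" using mk k by (intro power_decreasing) auto
  ultimately show False using less unfolding eq by linarith
qed

text \<open>Coding points of \<open>E\<close> by ternary digits turns measures on \<open>E\<close> into measures on the line, where
  Helly's selection theorem is available; decoding is continuous on the closure of the codes.\<close>

lemma compact_real_coding:
  fixes E :: "complex set"
  assumes E: "compact E"
  obtains s :: "complex \<Rightarrow> real" and \<phi> :: "real \<Rightarrow> complex" and B
  where "s \<in> borel_measurable borel" "\<And>z. 0 \<le> s z \<and> s z \<le> 3"
    "continuous_on UNIV \<phi>" "\<And>x. cmod (\<phi> x) \<le> B" "\<And>z. z \<in> E \<Longrightarrow> \<phi> (s z) = z"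
proof -
  obtain \<B> :: "complex set set" where \<B>: "countable \<B>" "topological_basis \<B>"
    using ex_countable_basis by blast
  have ne: "\<B> \<noteq> {}" using topological_basisE[OF \<B>(2) open_UNIV UNIV_I] by blast
  define V where "V = from_nat_into \<B>"
  have V: "range V = \<B>" using range_from_nat_into[OF ne \<B>(1)] by (simp add: V_def)
  have oV: "open (V k)" for k using V topological_basis_open[OF \<B>(2)] by blast
  define s where "s z = (\<Sum>j. indicator (V j) z * 2 * (1/3::real) ^ j)" for z
  have g: "summable (\<lambda>j. 2 * (1/3::real) ^ j)" by (intro summable_mult summable_geometric) simp
  have sum: "summable (\<lambda>j. indicator (V j) z * 2 * (1/3::real) ^ j)" for z
    by (rule summable_comparison_test'[OF g, of 0]) (auto simp: indicator_def)
  have ms: "s \<in> borel_measurable borel"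
    unfolding s_def[abs_def] using oV by (intro borel_measurable_suminf) (auto intro!: borel_measurable_times borel_measurable_indicator)
  have s0: "0 \<le> s z" for z unfolding s_def by (rule suminf_nonneg[OF sum]) auto
  have "s z \<le> (\<Sum>j. 2 * (1/3::real) ^ j)" for z
    unfolding s_def by (rule suminf_le[OF _ sum g]) (auto simp: indicator_def)
  also have "(\<Sum>j. 2 * (1/3::real) ^ j) = 3"
    using suminf_mult[of "\<lambda>j. (1/3::real)^j" 2] suminf_geometric[of "1/3::real"]
    by (simp add: summable_geometric)
  finally have s3: "s z \<le> 3" for z .
  have same: "z \<in> V k \<longleftrightarrow> z' \<in> V k" if "\<bar>s z - s z'\<bar> < (1/3) ^ K" "k \<le> K" for z z' k K
  proof -
    have "indicator (V k) z = (indicator (V k) z' :: real)"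
      by (rule base3_digits_eq[of "\<lambda>j. indicator (V j) z" "\<lambda>j. indicator (V j) z'", OF _ _ that[unfolded s_def]])
         (auto simp: indicator_def)
    then show ?thesis by (auto simp: indicator_def of_bool_def split: if_splits)
  qed
  \<comment> \<open>Finitely many basis sets inside balls of radius \<open>e/2\<close> cover
    \<open>E\<close>. If two codes are closer than \<open>(1/3)^K\<close>, with \<open>K\<close> the
    largest index used, both points lie in a common one of these sets.\<close>
  have uc: "\<exists>d>0. \<forall>z\<in>E. \<forall>z'\<in>E. \<bar>s z - s z'\<bar> < d \<longrightarrow> dist z z' < e" if e: "0 < e" for e
  proof -
    define C where "C = {k. \<exists>z. V k \<subseteq> ball z (e/2)}"
    have cov: "E \<subseteq> (\<Union>k\<in>C. V k)"
    proof
      fix z assume "z \<in> E"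
      obtain W where "W \<in> \<B>" "z \<in> W" "W \<subseteq> ball z (e/2)"
        using topological_basisE[OF \<B>(2) open_ball, of z z "e/2"] e by auto
      then show "z \<in> (\<Union>k\<in>C. V k)" using V unfolding C_def by blast
    qed
    obtain C' where C': "C' \<subseteq> C" "finite C'" "E \<subseteq> (\<Union>k\<in>C'. V k)"
      using compactE_image[OF E _ cov] oV by blast
    define K where "K = Max (insert 0 C')"
    have K: "k \<le> K" if "k \<in> C'" for k using that C'(2) by (simp add: K_def)
    show ?thesis
    proof (intro exI[of _ "(1/3) ^ K"] conjI ballI impI)
      fix z z' assume z: "z \<in> E" "z' \<in> E" "\<bar>s z - s z'\<bar> < (1/3) ^ K"
      then obtain k where k: "k \<in> C'" "z \<in> V k" using C'(3) by blast
      with same[OF z(3) K[OF k(1)]] have "z' \<in> V k" by simp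
      moreover obtain w where "V k \<subseteq> ball w (e/2)" using k(1) C'(1) C_def by blast
      ultimately have "dist w z < e/2" "dist w z' < e/2" using k(2) by auto
      then show "dist z z' < e" by (rule dist_triangle_half_r)
    qed simp
  qed
  have inj: "inj_on s E"
  proof (rule inj_onI, rule ccontr)
    fix z z' assume z: "z \<in> E" "z' \<in> E" "s z = s z'" "z \<noteq> z'"
    from uc[of "dist z z'"] z(4) obtain d where "d > 0" "\<forall>x\<in>E. \<forall>y\<in>E. \<bar>s x - s y\<bar> < d \<longrightarrow> dist x y < dist z z'"
      by auto
    then have "dist z z' < dist z z'" using z(1,2,3) by (metis abs_zero diff_self)
    then show False by simp
  qed
  define \<psi> where "\<psi> = inv_into E s"
  have \<psi>: "\<psi> (s z) = z" if "z \<in> E" for z using that inj by (simp add: \<psi>_def)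
  have "uniformly_continuous_on (s ` E) \<psi>"
    unfolding uniformly_continuous_on_def dist_real_def
  proof (intro allI impI)
    fix e :: real assume "0 < e"
    from uc[OF this] obtain d where "d > 0" "\<forall>z\<in>E. \<forall>z'\<in>E. \<bar>s z - s z'\<bar> < d \<longrightarrow> dist z z' < e" by blast
    then show "\<exists>d>0. \<forall>x\<in>s ` E. \<forall>x'\<in>s ` E. \<bar>x' - x\<bar> < d \<longrightarrow> dist (\<psi> x') (\<psi> x) < e"
      by (intro exI[of _ d]) (auto simp: \<psi>)
  qed
  \<comment> \<open>The coding is not continuous, so the codes need not form a closed set. The
    decoder is extended to the closure by uniform continuity and then, keeping a bound, to the line
    by Tietze.\<close>
  then obtain h where h: "uniformly_continuous_on (closure (s ` E)) h" "\<And>x. x \<in> s ` E \<Longrightarrow> \<psi> x = h x"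
    using uniformly_continuous_on_extension_on_closure by metis
  have hc: "continuous_on (closure (s ` E)) h" by (rule uniformly_continuous_imp_continuous[OF h(1)])
  have "bounded (s ` E)" using s0 s3 by (intro boundedI[of _ 3]) (auto simp: abs_of_nonneg)
  then have "compact (closure (s ` E))" by (simp add: compact_closure)
  then have "bounded (h ` closure (s ` E))" by (intro compact_imp_bounded compact_continuous_image hc)
  then obtain B where B: "0 < B" "\<And>x. x \<in> closure (s ` E) \<Longrightarrow> norm (h x) \<le> B"
    by (auto simp: bounded_pos)
  obtain \<phi> where \<phi>: "continuous_on UNIV \<phi>" "\<And>x. x \<in> closure (s ` E) \<Longrightarrow> \<phi> x = h x" "\<And>x. x \<in> UNIV \<Longrightarrow> norm (\<phi> x) \<le> B"
    using Tietze[OF hc, of UNIV B] B by auto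
  show ?thesis
  proof (rule that[OF ms _ \<phi>(1)])
    show "0 \<le> s z \<and> s z \<le> 3" for z using s0 s3 by simp
    show "cmod (\<phi> x) \<le> B" for x by (rule \<phi>(3)) simp
    show "\<phi> (s z) = z" if "z \<in> E" for z
    proof -
      have "s z \<in> s ` E" using that by simp
      then show ?thesis using \<phi>(2)[of "s z"] h(2)[of "s z"] \<psi>[OF that] closure_subset[of "s ` E"] by auto
    qed
  qed
qed

text \<open>All codes lie between 0 and 3, so the image laws are tight and a subsequence converges.
  The limit law may charge limits of codes that are not codes; \<open>\<nu>\<close> is therefore its
  image under the extended decoder, and that it lives on \<open>E\<close> is proved
  separately.\<close>

lemma prob_measures_on_sequentially_compact:
  assumes E: "compact E" and \<mu>: "\<And>j. \<mu> j \<in> prob_measures_on E"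
  shows "\<exists>r \<nu>. strict_mono (r :: nat \<Rightarrow> nat) \<and> \<nu> \<in> prob_measures_on E \<and>
    (\<forall>f :: complex \<Rightarrow> real. continuous_on UNIV f \<longrightarrow> (\<lambda>j. integral\<^sup>L (\<mu> (r j)) f) \<longlonglongrightarrow> integral\<^sup>L \<nu> f)"
proof -
  obtain s :: "complex \<Rightarrow> real" and \<phi> B where ms[measurable]: "s \<in> borel_measurable borel" and s: "\<And>z. 0 \<le> s z \<and> s z \<le> 3"
    and c\<phi>: "continuous_on UNIV \<phi>" and B: "\<And>x. cmod (\<phi> x) \<le> B" and \<phi>: "\<And>z. z \<in> E \<Longrightarrow> \<phi> (s z) = z"
    using compact_real_coding[OF E] by blast
  have [measurable]: "\<phi> \<in> borel_measurable borel" by (rule borel_measurable_continuous_onI[OF c\<phi>])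
  have sb[measurable_cong]: "sets (\<mu> j) = sets borel" and p: "prob_space (\<mu> j)"
    and null: "emeasure (\<mu> j) (UNIV - E) = 0" for j
    using \<mu>[of j] by (auto simp: prob_measures_on_def)
  have spc: "space (\<mu> j) = UNIV" for j using sets_eq_imp_space_eq[OF sb[of j]] by simp
  have cE: "closed E" by (rule compact_imp_closed[OF E])
  have ae: "AE z in \<mu> j. z \<in> E" for j
    by (intro AE_I[OF _ null]) (use cE in \<open>auto simp: sb\<close>)
  define N where "N j = distr (\<mu> j) borel s" for j
  have rd: "real_distribution (N j)" for j
    unfolding N_def real_distribution_def real_distribution_axioms_def
    by (auto intro!: prob_space.prob_space_distr p)
  have "tight N"
    unfolding tight_def
  proof (intro conjI allI impI rd)
    fix e :: real assume e: "0 < e"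
    have "measure (N j) {-1<..4} = 1" for j
    proof -
      interpret prob_space "\<mu> j" by (rule p)
      have "s z \<in> {-1<..4}" for z using s[of z] by auto
      then have "s -` {-1<..4} = UNIV" by auto
      then show ?thesis unfolding N_def using prob_space
        by (subst measure_distr) (auto simp: spc)
    qed
    then show "\<exists>a b. a < b \<and> (\<forall>n. 1 - e < measure (N n) {a<..b})"
      using e by (intro exI[of _ "-1"] exI[of _ 4]) auto
  qed
  then obtain r M where r: "strict_mono r" and M: "real_distribution M" and conv: "weak_conv_m (N \<circ> r) M"
    using tight_imp_convergent_subsubsequence[of N id] by (auto simp: strict_mono_id)
  interpret M: real_distribution M by fact
  define \<nu> where "\<nu> = distr M borel \<phi>"
  have lim: "(\<lambda>j. integral\<^sup>L (\<mu> (r j)) f) \<longlonglongrightarrow> integral\<^sup>L \<nu> f" if f: "continuous_on UNIV f" for f :: "complex \<Rightarrow> real"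
  proof -
    have [measurable]: "f \<in> borel_measurable borel" by (rule borel_measurable_continuous_onI[OF f])
    have "bounded (f ` cball 0 B)"
      by (intro compact_imp_bounded compact_continuous_image continuous_on_subset[OF f]) auto
    then obtain C where "\<forall>y\<in>f ` cball 0 B. norm y \<le> C" unfolding bounded_iff by blast
    then have C: "\<And>z. cmod z \<le> B \<Longrightarrow> norm (f z) \<le> C" by auto
    have "continuous_on UNIV (\<lambda>x. f (\<phi> x))" by (rule continuous_on_compose2[OF f c\<phi>]) auto
    then have cont: "isCont (\<lambda>x. f (\<phi> x)) x" for x by (simp add: continuous_on_eq_continuous_at)
    have "(\<lambda>j. integral\<^sup>L ((N \<circ> r) j) (\<lambda>x. f (\<phi> x))) \<longlonglongrightarrow> integral\<^sup>L M (\<lambda>x. f (\<phi> x))"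
      by (rule weak_conv_imp_integral_bdd_continuous_conv[OF _ M conv cont, of C]) (use rd C B in auto)
    moreover have "integral\<^sup>L ((N \<circ> r) j) (\<lambda>x. f (\<phi> x)) = integral\<^sup>L (\<mu> (r j)) f" for j
    proof -
      have "integral\<^sup>L ((N \<circ> r) j) (\<lambda>x. f (\<phi> x)) = integral\<^sup>L (\<mu> (r j)) (\<lambda>z. f (\<phi> (s z)))"
        unfolding N_def comp_def by (rule integral_distr) auto
      also have "\<dots> = integral\<^sup>L (\<mu> (r j)) f"
        by (rule integral_cong_AE) (use ae[of "r j"] \<phi> in \<open>auto elim!: eventually_mono\<close>)
      finally show ?thesis .
    qed
    moreover have "integral\<^sup>L M (\<lambda>x. f (\<phi> x)) = integral\<^sup>L \<nu> f"
      unfolding \<nu>_def by (rule integral_distr[symmetric]) auto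
    ultimately show ?thesis by simp
  qed
  have ps: "prob_space \<nu>" unfolding \<nu>_def by (rule M.prob_space_distr) simp
  interpret \<nu>: prob_space \<nu> by (rule ps)
  have s\<nu>[measurable_cong]: "sets \<nu> = sets borel" by (simp add: \<nu>_def)
  have "E \<noteq> {}"
  proof
    assume "E = {}"
    then have "emeasure (\<mu> 0) (space (\<mu> 0)) = 0" using null[of 0] by (simp add: spc)
    then show False using prob_space.emeasure_space_1[OF p[of 0]] by simp
  qed
  \<comment> \<open>A bounded continuous function vanishing exactly on \<open>E\<close>: its
    integrals are 0 along the sequence, hence also for the limit.\<close>
  let ?d = "\<lambda>z. min 1 (infdist z E)"
  have cd: "continuous_on UNIV ?d" by (intro continuous_intros)
  have "integral\<^sup>L (\<mu> (r j)) ?d = 0" for j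
    by (intro integral_eq_zero_AE) (use ae[of "r j"] in \<open>auto elim!: eventually_mono\<close>)
  then have "integral\<^sup>L \<nu> ?d = 0" using LIMSEQ_unique[OF lim[OF cd]] by simp
  moreover have "integrable \<nu> ?d"
    using borel_measurable_continuous_onI[OF cd]
    by (intro \<nu>.integrable_const_bound[of _ 1]) (auto simp: infdist_nonneg measurable_cong_sets[OF s\<nu> refl])
  ultimately have "AE z in \<nu>. ?d z = 0"
    by (subst (asm) integral_nonneg_eq_0_iff_AE) (auto simp: infdist_nonneg)
  then have "AE z in \<nu>. z \<in> E"
  proof eventually_elim
    case (elim z)
    then have "infdist z E = 0" by (auto simp: min_def split: if_splits)
    then show ?case using in_closed_iff_infdist_zero[OF cE \<open>E \<noteq> {}\<close>] by simp
  qed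
  then have "emeasure \<nu> (UNIV - E) = 0"
    by (subst (asm) AE_iff_measurable[where N="UNIV - E"]) (use cE sets_eq_imp_space_eq[OF s\<nu>] in \<open>auto simp: s\<nu>\<close>)
  then have "\<nu> \<in> prob_measures_on E" using s\<nu> ps by (simp add: prob_measures_on_def)
  with r lim show ?thesis by blast
qed

section \<open>Gaussian integrals determine weak convergence\<close>

abbreviation monomial_exponent :: "nat \<Rightarrow> nat \<Rightarrow> nat \<Rightarrow> complex \<Rightarrow> real" where
  "monomial_exponent i j k z \<equiv> i * (cmod z)\<^sup>2 + j * (cmod (z - 1))\<^sup>2 + k * (cmod (z - \<i>))\<^sup>2"

text \<open>Distances to 0, 1 and \<open>\<i>\<close> determine a point of the plane, and products
  of powers of the three Gaussians are constants or multiples of Gaussians. Polynomials in this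
  triple are thus rich enough for Stone-Weierstrass and still covered by Gaussian integrals.\<close>

definition gauss_triple :: "complex \<Rightarrow> real \<times> real \<times> real" where
  "gauss_triple z = (gauss 1 z, gauss 1 (z - 1), gauss 1 (z - \<i>))"

lemma continuous_gauss_triple: "continuous_on S gauss_triple"
  unfolding gauss_triple_def gauss_def by (intro continuous_intros)

lemma inj_gauss_triple: "inj gauss_triple"
proof (rule injI)
  fix z w assume "gauss_triple z = gauss_triple w"
  then have "(cmod z)\<^sup>2 = (cmod w)\<^sup>2" "(cmod (z - 1))\<^sup>2 = (cmod (w - 1))\<^sup>2" "(cmod (z - \<i>))\<^sup>2 = (cmod (w - \<i>))\<^sup>2"
    by (simp_all add: gauss_triple_def gauss_def)
  then show "z = w"
    unfolding cmod_power2 by (simp add: power2_eq_square algebra_simps complex_eq_iff)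
qed

text \<open>Completing the square: a weighted sum of squared distances to three points is, up to a
  constant, the total weight times the squared distance to their weighted mean.\<close>

lemma exp_monomial_exponent:
  assumes "0 < i + j + k"
  shows "\<exists>C a. \<forall>z. exp (- monomial_exponent i j k z) = C * gauss (real (i + j + k)) (z - a)"
proof (intro exI allI)
  fix z
  let ?S = "real (i + j + k)" and ?a = "Complex (j / (i + j + k)) (k / (i + j + k))"
  have S: "?S \<noteq> 0" using assms by linarith
  have eq: "S * (x\<^sup>2 + y\<^sup>2) - 2 * J * x - 2 * K * y + J + K
      = (J + K - (J\<^sup>2 + K\<^sup>2) / S) + S * ((x - J / S)\<^sup>2 + (y - K / S)\<^sup>2)"
    if "S \<noteq> 0" for S x y J K :: real
    using that by (simp add: field_simps power2_eq_square)
  have "monomial_exponent i j k z = ?S * ((Re z)\<^sup>2 + (Im z)\<^sup>2) - 2 * j * Re z - 2 * k * Im z + j + k"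
    unfolding cmod_power2 by (simp add: power2_eq_square algebra_simps)
  also have "\<dots> = (j + k - (real j ^ 2 + real k ^ 2) / ?S) + ?S * (cmod (z - ?a))\<^sup>2"
    unfolding cmod_power2 using eq[OF S, of "Re z" "Im z" j k] by simp
  finally have "- monomial_exponent i j k z = - (j + k - (real j ^ 2 + real k ^ 2) / ?S) + (- ?S * (cmod (z - ?a))\<^sup>2)"
    by (simp only: minus_add_distrib mult_minus_left)
  then show "exp (- monomial_exponent i j k z) = exp (- (j + k - (real j ^ 2 + real k ^ 2) / ?S)) * gauss ?S (z - ?a)"
    unfolding gauss_def exp_add[symmetric] by (rule arg_cong)
qed

text \<open>The image of the plane under \<open>gauss_triple\<close> is not closed; it runs into the
  origin as \<open>z\<close> goes to infinity. The half-space \<open>H\<close> contains exactly the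
  images of the points of modulus at least \<open>max R 0\<close>, where \<open>f\<close> vanishes.
  Extension by 0 to \<open>H\<close> gives a continuous function on a compact set containing the
  whole image, so the approximation is uniform on the plane.\<close>

lemma compact_support_approx:
  fixes f :: "complex \<Rightarrow> real"
  assumes f: "continuous_on UNIV f" and R: "\<And>z. R \<le> cmod z \<Longrightarrow> f z = 0" and e: "0 < e"
  obtains g where "real_polynomial_function g" "\<And>z. \<bar>f z - g (gauss_triple z)\<bar> < e"
proof -
  define H where "H = {p :: real \<times> real \<times> real. fst p \<le> exp (- (max R 0)\<^sup>2)}"
  define C where "C = gauss_triple ` cball 0 (max R 0)"
  define inv where "inv = inv_into UNIV gauss_triple"
  have inv: "inv (gauss_triple z) = z" for z using inj_gauss_triple by (simp add: inv_def)
  have cC: "compact C" unfolding C_def by (intro compact_continuous_image continuous_gauss_triple) simp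
  have cH: "closed H" unfolding H_def by (intro closed_Collect_le continuous_intros)
  have "continuous_on C inv"
    unfolding C_def by (rule continuous_on_inv[OF continuous_gauss_triple]) (auto simp: inv)
  then have ci: "continuous_on C (\<lambda>p. f (inv p))"
    by (rule continuous_on_compose2[OF f]) auto
  have inH: "gauss_triple z \<in> H \<longleftrightarrow> max R 0 \<le> cmod z" for z
    using abs_le_square_iff[of "max R 0" "cmod z"] by (simp add: H_def gauss_triple_def gauss_def)
  define F where "F p = (if p \<in> H then 0 else f (inv p))" for p
  have "continuous_on (H \<union> C) F"
    unfolding F_def
  proof (rule continuous_on_cases[OF cH compact_imp_closed[OF cC] _ ci])
    show "\<forall>p. p \<in> H \<and> p \<notin> H \<or> p \<in> C \<and> p \<in> H \<longrightarrow> 0 = f (inv p)"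
      unfolding C_def by (auto simp: inH inv R)
  qed simp
  define K where "K = (H \<union> C) \<inter> cbox (0, 0, 0) (1, 1, 1)"
  have "compact K" unfolding K_def
    by (intro closed_Int_compact compact_cbox closed_Un cH compact_imp_closed[OF cC])
  moreover have "continuous_on K F" using \<open>continuous_on (H \<union> C) F\<close> by (rule continuous_on_subset) (auto simp: K_def)
  ultimately obtain g where g: "real_polynomial_function g" "\<And>p. p \<in> K \<Longrightarrow> \<bar>F p - g p\<bar> < e"
    using Stone_Weierstrass_real_polynomial_function[OF _ _ e] by metis
  show ?thesis
  proof (rule that[OF g(1)])
    fix z
    have "gauss_triple z \<in> H \<union> C" using inH[of z] by (auto simp: C_def)
    moreover have "gauss_triple z \<in> cbox (0, 0, 0) (1, 1, 1)"
      by (auto simp: gauss_triple_def gauss_def cbox_Pair_eq)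
    ultimately have "gauss_triple z \<in> K" by (simp add: K_def)
    moreover have "F (gauss_triple z) = f z" by (auto simp: F_def inH inv R)
    ultimately show "\<bar>f z - g (gauss_triple z)\<bar> < e" using g(2)[of "gauss_triple z"] by simp
  qed
qed

text \<open>The \<open>\<tau> n\<close> have no common bounded support, so Stone-Weierstrass settles
  compactly supported functions first. For a cut-off \<open>\<theta>\<close> that is 1 almost
  everywhere for \<open>\<mu>\<close>, convergence of its integrals to 1 shows that no mass escapes;
  this is the tightness that a bounded \<open>f\<close> requires.\<close>

lemma weak_convergence_of_gauss:
  fixes \<tau> :: "nat \<Rightarrow> complex measure" and f :: "complex \<Rightarrow> real"
  assumes \<tau>: "\<And>n. bdd_prob (\<tau> n)" and \<mu>: "bdd_prob \<mu>"
    and G: "\<And>s a. 0 < s \<Longrightarrow> (\<lambda>n. LINT z|\<tau> n. gauss s (z - a)) \<longlonglongrightarrow> (LINT z|\<mu>. gauss s (z - a))"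
    and f: "continuous_on UNIV f" and fb: "bounded (range f)"
  shows "(\<lambda>n. integral\<^sup>L (\<tau> n) f) \<longlonglongrightarrow> integral\<^sup>L \<mu> f"
proof -
  define A where "A g \<longleftrightarrow> continuous_on UNIV g \<and> (\<lambda>n. integral\<^sup>L (\<tau> n) g) \<longlonglongrightarrow> integral\<^sup>L \<mu> g" for g :: "complex \<Rightarrow> real"
  note int\<tau> = bdd_prob_integrable[OF \<tau>] and int\<mu> = bdd_prob_integrable[OF \<mu>]
  interpret \<tau>: prob_space "\<tau> n" for n by (rule bdd_probD[OF \<tau>])
  interpret \<mu>: prob_space \<mu> by (rule bdd_probD[OF \<mu>])
  have A_add: "A (\<lambda>z. g z + h z)" if "A g" "A h" for g h
    using that by (auto simp: A_def int\<tau> int\<mu> intro!: continuous_intros tendsto_intros)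
  have A_scale: "A (\<lambda>z. c * g z)" if "A g" for g c
    using that by (auto simp: A_def intro!: continuous_intros tendsto_intros)
  have A_one: "A (\<lambda>z. 1)" by (simp add: A_def \<tau>.prob_space \<mu>.prob_space)
  let ?m = monomial_exponent
  have A_mon: "A (\<lambda>z. exp (- ?m i j k z))" for i j k
  proof (cases "i + j + k = 0")
    case False
    then obtain C a where Ca: "\<And>z. exp (- ?m i j k z) = C * gauss (real (i + j + k)) (z - a)"
      using exp_monomial_exponent[of i j k] by blast
    have "A (\<lambda>z. gauss (real (i + j + k)) (z - a))"
      using G[of "real (i + j + k)" a] False unfolding A_def gauss_def
      by (auto intro!: continuous_intros)
    from A_scale[OF this, of C] show ?thesis unfolding Ca .
  qed (use A_one in simp)
  have A_close: "A g" if g: "continuous_on UNIV g" and appr: "\<And>e. 0 < e \<Longrightarrow> \<exists>h. A h \<and> (\<forall>z. \<bar>g z - h z\<bar> < e)" for g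
    unfolding A_def
  proof (intro conjI g LIMSEQ_I)
    fix r :: real assume "0 < r"
    then obtain h where h: "A h" "\<And>z. \<bar>g z - h z\<bar> < r/4" using appr[of "r/4"] by auto
    have ch: "continuous_on UNIV h" using h(1) by (simp add: A_def)
    have near: "\<bar>integral\<^sup>L \<alpha> g - integral\<^sup>L \<alpha> h\<bar> \<le> r/4" if \<alpha>: "bdd_prob \<alpha>" for \<alpha>
    proof -
      interpret \<alpha>: prob_space \<alpha> by (rule bdd_probD[OF \<alpha>])
      note i = bdd_prob_integrable[OF \<alpha> g] bdd_prob_integrable[OF \<alpha> ch]
      have "\<bar>integral\<^sup>L \<alpha> g - integral\<^sup>L \<alpha> h\<bar> = \<bar>LINT z|\<alpha>. g z - h z\<bar>" using i by simp
      also have "\<dots> \<le> (LINT z|\<alpha>. \<bar>g z - h z\<bar>)" by (rule integral_abs_bound)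
      also have "\<dots> \<le> (LINT z|\<alpha>. r/4)"
        using i h(2) by (intro integral_mono) (auto intro: less_imp_le)
      finally show ?thesis by (simp add: \<alpha>.prob_space)
    qed
    obtain n0 where n0: "\<And>n. n0 \<le> n \<Longrightarrow> \<bar>integral\<^sup>L (\<tau> n) h - integral\<^sup>L \<mu> h\<bar> < r/4"
      using h(1) LIMSEQ_D[of "\<lambda>n. integral\<^sup>L (\<tau> n) h" "integral\<^sup>L \<mu> h" "r/4"] \<open>0 < r\<close> by (auto simp: A_def)
    show "\<exists>no. \<forall>n\<ge>no. norm (integral\<^sup>L (\<tau> n) g - integral\<^sup>L \<mu> g) < r"
    proof (intro exI allI impI)
      fix n assume "n0 \<le> n"
      show "norm (integral\<^sup>L (\<tau> n) g - integral\<^sup>L \<mu> g) < r"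
        using n0[OF \<open>n0 \<le> n\<close>] near[OF \<tau>[of n]] near[OF \<mu>] \<open>0 < r\<close> by (simp add: abs_if split: if_splits)
    qed
  qed
  \<comment> \<open>Convergence of the integrals of two functions says nothing about their product.
    Requiring it after multiplication by every monomial, with \<open>g\<close> arbitrary, lets the
    induction over polynomials treat a product as two successive factors.\<close>
  define T where "T g \<longleftrightarrow> (\<forall>i j k. A (\<lambda>z. g z * exp (- ?m i j k z)))" for g
  have T_add: "T (\<lambda>z. g z + h z)" if "T g" "T h" for g h
    using that A_add unfolding T_def by (simp add: distrib_right)
  have T_scale: "T (\<lambda>z. c * g z)" if "T g" for g c
    using that A_scale unfolding T_def by (simp add: mult.assoc)
  have T_mon: "T (\<lambda>z. exp (- ?m i j k z) * g z)" if "T g" for g i j k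
    unfolding T_def
  proof (intro allI)
    fix i' j' k'
    have "A (\<lambda>z. g z * exp (- ?m (i + i') (j + j') (k + k') z))" using that unfolding T_def by blast
    also have "(\<lambda>z. g z * exp (- ?m (i + i') (j + j') (k + k') z)) = (\<lambda>z. exp (- ?m i j k z) * g z * exp (- ?m i' j' k' z))"
      by (intro ext) (simp add: distrib_right exp_add exp_diff exp_minus field_simps)
    finally show "A (\<lambda>z. exp (- ?m i j k z) * g z * exp (- ?m i' j' k' z))" .
  qed
  have T_poly: "T g \<Longrightarrow> T (\<lambda>z. p (gauss_triple z) * g z)" if "real_polynomial_function p" for p g
    using that
  proof (induction arbitrary: g)
    case (linear p)
    note Tg = linear.prems
    interpret bounded_linear p by fact
    have "p (gauss_triple z) = p (1,0,0) * exp (- ?m 1 0 0 z) + p (0,1,0) * exp (- ?m 0 1 0 z) + p (0,0,1) * exp (- ?m 0 0 1 z)" for z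
    proof -
      have "gauss_triple z = gauss 1 z *\<^sub>R (1,0,0) + gauss 1 (z - 1) *\<^sub>R (0,1,0) + gauss 1 (z - \<i>) *\<^sub>R (0,0,1)"
        by (simp add: gauss_triple_def)
      then have "p (gauss_triple z) = gauss 1 z * p (1,0,0) + gauss 1 (z - 1) * p (0,1,0) + gauss 1 (z - \<i>) * p (0,0,1)"
        by (simp only: add scaleR real_scaleR_def)
      then show ?thesis by (simp add: gauss_def mult.commute)
    qed
    then have "(\<lambda>z. p (gauss_triple z) * g z)
      = (\<lambda>z. p (1,0,0) * (exp (- ?m 1 0 0 z) * g z) + p (0,1,0) * (exp (- ?m 0 1 0 z) * g z) + p (0,0,1) * (exp (- ?m 0 0 1 z) * g z))"
      by (simp add: algebra_simps)
    moreover have "T \<dots>" by (intro T_add T_scale T_mon Tg)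
    ultimately show ?case by simp
  next
    case (const c) then show ?case using T_scale by simp
  next
    case (add p q)
    then show ?case using T_add by (simp add: distrib_right)
  next
    case (mult p q)
    then show ?case using mult.IH(1)[OF mult.IH(2)[OF mult.prems]] by (simp add: mult.assoc)
  qed
  have T1: "T (\<lambda>z. 1)" using A_mon by (simp add: T_def)
  have A_poly: "A (\<lambda>z. p (gauss_triple z))" if "real_polynomial_function p" for p
    using T_poly[OF that T1] unfolding T_def by (elim allE[of _ 0]) simp
  have A_cs: "A g" if g: "continuous_on UNIV g" and R: "\<And>z. R \<le> cmod z \<Longrightarrow> g z = 0" for g R
  proof (rule A_close[OF g])
    fix e :: real assume "0 < e"
    then obtain p where "real_polynomial_function p" "\<And>z. \<bar>g z - p (gauss_triple z)\<bar> < e"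
      using compact_support_approx[OF g R] by metis
    then show "\<exists>h. A h \<and> (\<forall>z. \<bar>g z - h z\<bar> < e)" using A_poly by blast
  qed
  obtain R where R: "AE z in \<mu>. cmod z \<le> R" using \<mu> by (auto simp: bdd_prob_def)
  define \<theta> where "\<theta> z = max 0 (min 1 (R + 1 - cmod z))" for z
  have \<theta>01: "0 \<le> \<theta> z" "\<theta> z \<le> 1" for z by (auto simp: \<theta>_def)
  have \<theta>c: "continuous_on UNIV \<theta>" unfolding \<theta>_def by (intro continuous_intros)
  have \<theta>0: "\<theta> z = 0" if "R + 1 \<le> cmod z" for z using that by (simp add: \<theta>_def)
  have f\<theta>c: "continuous_on UNIV (\<lambda>z. f z * \<theta> z)" by (intro continuous_intros f \<theta>c)
  have \<theta>\<mu>: "AE z in \<mu>. \<theta> z = 1" using R by eventually_elim (simp add: \<theta>_def)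
  have "A \<theta>" by (rule A_cs[OF \<theta>c \<theta>0])
  moreover have "A (\<lambda>z. f z * \<theta> z)" by (rule A_cs[OF f\<theta>c, of "R + 1"]) (simp add: \<theta>0)
  moreover have "integral\<^sup>L \<mu> \<theta> = integral\<^sup>L \<mu> (\<lambda>z. 1)"
    using \<theta>\<mu> int\<mu>[OF \<theta>c] by (intro integral_cong_AE) auto
  moreover have "integral\<^sup>L \<mu> (\<lambda>z. f z * \<theta> z) = integral\<^sup>L \<mu> f"
    using \<theta>\<mu> int\<mu>[OF f\<theta>c] int\<mu>[OF f] by (intro integral_cong_AE) auto
  ultimately have L1: "(\<lambda>n. integral\<^sup>L (\<tau> n) \<theta>) \<longlonglongrightarrow> 1"
    and L2: "(\<lambda>n. integral\<^sup>L (\<tau> n) (\<lambda>z. f z * \<theta> z)) \<longlonglongrightarrow> integral\<^sup>L \<mu> f"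
    by (simp_all add: A_def \<mu>.prob_space)
  obtain B where B: "\<And>z. \<bar>f z\<bar> \<le> B" using fb by (auto simp: bounded_iff)
  have near: "\<bar>integral\<^sup>L (\<tau> n) f - integral\<^sup>L (\<tau> n) (\<lambda>z. f z * \<theta> z)\<bar> \<le> B * (1 - integral\<^sup>L (\<tau> n) \<theta>)" for n
  proof -
    have "\<bar>integral\<^sup>L (\<tau> n) f - integral\<^sup>L (\<tau> n) (\<lambda>z. f z * \<theta> z)\<bar> = \<bar>LINT z|\<tau> n. f z - f z * \<theta> z\<bar>"
      using int\<tau>[OF f] int\<tau>[OF f\<theta>c] by simp
    also have "\<dots> \<le> (LINT z|\<tau> n. \<bar>f z - f z * \<theta> z\<bar>)" by (rule integral_abs_bound)
    also have "\<dots> \<le> (LINT z|\<tau> n. B * (1 - \<theta> z))"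
    proof (rule integral_mono)
      fix z
      have "\<bar>f z - f z * \<theta> z\<bar> = \<bar>f z\<bar> * (1 - \<theta> z)"
        using \<theta>01[of z] by (simp add: right_diff_distrib[of "f z" 1 "\<theta> z", simplified, symmetric] abs_mult)
      also have "\<dots> \<le> B * (1 - \<theta> z)" using \<theta>01[of z] B by (intro mult_right_mono) auto
      finally show "\<bar>f z - f z * \<theta> z\<bar> \<le> B * (1 - \<theta> z)" .
    qed (use int\<tau>[OF f] int\<tau>[OF f\<theta>c] int\<tau>[OF \<theta>c] in auto)
    also have "\<dots> = B * (1 - integral\<^sup>L (\<tau> n) \<theta>)" using int\<tau>[OF \<theta>c] by (simp add: \<tau>.prob_space)
    finally show ?thesis .
  qed
  have "(\<lambda>n. B * (1 - integral\<^sup>L (\<tau> n) \<theta>)) \<longlonglongrightarrow> B * (1 - 1)" by (intro tendsto_intros L1)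
  then have lim0: "(\<lambda>n. B * (1 - integral\<^sup>L (\<tau> n) \<theta>)) \<longlonglongrightarrow> 0" by simp
  have "(\<lambda>n. integral\<^sup>L (\<tau> n) f - integral\<^sup>L (\<tau> n) (\<lambda>z. f z * \<theta> z)) \<longlonglongrightarrow> 0"
    by (rule Lim_null_comparison[OF _ lim0], unfold real_norm_def, intro always_eventually allI near)
  from tendsto_add[OF this L2] show ?thesis by simp
qed

text \<open>The preceding convergence, applied to a constant sequence, shows that Gaussian integrals
  fix all integrals of bounded continuous functions. These fix the masses of closed sets through the
  functions \<open>max 0 (1 - m * infdist z C)\<close>, which decrease to the indicator of
  \<open>C\<close>.\<close>

lemma bdd_prob_eqI_gauss:
  assumes \<mu>: "bdd_prob \<mu>" and \<nu>: "bdd_prob \<nu>"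
    and G: "\<And>s a. 0 < s \<Longrightarrow> (LINT z|\<mu>. gauss s (z - a)) = (LINT z|\<nu>. gauss s (z - a))"
  shows "\<mu> = \<nu>"
proof -
  interpret \<mu>: prob_space \<mu> by (rule bdd_probD[OF \<mu>])
  interpret \<nu>: prob_space \<nu> by (rule bdd_probD[OF \<nu>])
  have eq: "integral\<^sup>L \<mu> f = integral\<^sup>L \<nu> f" if "continuous_on UNIV f" "bounded (range f)" for f :: "complex \<Rightarrow> real"
  proof -
    have "(\<lambda>n::nat. integral\<^sup>L \<mu> f) \<longlonglongrightarrow> integral\<^sup>L \<nu> f"
      by (rule weak_convergence_of_gauss[OF \<mu> \<nu> _ that]) (simp add: G)
    then show ?thesis by (simp add: LIMSEQ_const_iff)
  qed
  have closed: "measure \<mu> C = measure \<nu> C" if C: "closed C" for C :: "complex set"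
  proof (cases "C = {}")
    case False
    let ?f = "\<lambda>m z. max 0 (1 - real m * infdist z C)"
    have fc: "continuous_on UNIV (?f m)" for m by (intro continuous_intros)
    have fb: "bounded (range (?f m))" for m
      by (intro boundedI[of _ 1]) (auto simp: infdist_nonneg)
    have lim: "(\<lambda>m. ?f m z) \<longlonglongrightarrow> indicator C z" for z
    proof (cases "z \<in> C")
      case True
      then show ?thesis by simp
    next
      case z: False
      then have d: "0 < infdist z C"
        using in_closed_iff_infdist_zero[OF C False, of z] infdist_nonneg[of z C] by linarith
      obtain m0 where m0: "1 < real m0 * infdist z C" using reals_Archimedean3[OF d] by blast
      have "?f m z = 0" if "m0 \<le> m" for m
      proof -
        have "real m0 * infdist z C \<le> real m * infdist z C" using that d by (intro mult_right_mono) auto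
        then show ?thesis using m0 by simp
      qed
      then have "\<forall>\<^sub>F m in sequentially. ?f m z = indicator C z"
        using z unfolding eventually_sequentially by (intro exI[of _ m0]) auto
      then show ?thesis by (rule tendsto_eventually)
    qed
    have conv: "(\<lambda>m. integral\<^sup>L \<alpha> (?f m)) \<longlonglongrightarrow> measure \<alpha> C" if \<alpha>: "bdd_prob \<alpha>" for \<alpha>
    proof -
      interpret \<alpha>: prob_space \<alpha> by (rule bdd_probD[OF \<alpha>])
      have CA: "C \<in> sets \<alpha>" using C bdd_probD(1)[OF \<alpha>] by simp
      have "(\<lambda>m. integral\<^sup>L \<alpha> (?f m)) \<longlonglongrightarrow> integral\<^sup>L \<alpha> (indicator C)"
        by (rule integral_dominated_convergence[where w="\<lambda>_. 1"])
           (use CA lim bdd_prob_integrable[OF \<alpha> fc] in \<open>auto simp: infdist_nonneg\<close>)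
      then show ?thesis using CA by simp
    qed
    show ?thesis
      using LIMSEQ_unique[OF conv[OF \<mu>]] conv[OF \<nu>] unfolding eq[OF fc fb] by blast
  qed simp
  show ?thesis
  proof (rule measure_eqI_generator_eq[where \<Omega>=UNIV and E="Collect closed" and A="\<lambda>_. UNIV"])
    show "sets \<mu> = sigma_sets UNIV (Collect closed)" "sets \<nu> = sigma_sets UNIV (Collect closed)"
      using bdd_probD(1)[OF \<mu>] bdd_probD(1)[OF \<nu>] by (simp_all add: borel_eq_closed)
    show "emeasure \<mu> X = emeasure \<nu> X" if "X \<in> Collect closed" for X
      using that closed by (simp add: \<mu>.emeasure_eq_measure \<nu>.emeasure_eq_measure)
  qed (auto simp: Int_stable_def)
qed

section \<open>The equilibrium measure\<close>

text \<open>The kernel is minus the logarithm of the norm of the pair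
  \<open>(x, sqrt \<delta>)\<close>. That norm is 1-Lipschitz in \<open>x\<close> and at least
  \<open>sqrt \<delta>\<close>, where the logarithm has slope at most
  \<open>1 / sqrt \<delta>\<close>.\<close>

lemma log_kernel_lipschitz:
  assumes \<delta>: "0 < \<delta>"
  shows "\<bar>log_kernel \<delta> x - log_kernel \<delta> y\<bar> \<le> cmod (x - y) / sqrt \<delta>"
proof -
  define N where "N u = norm (u, sqrt \<delta>)" for u :: complex
  have N: "N u = sqrt ((cmod u)\<^sup>2 + \<delta>)" for u using \<delta> by (simp add: N_def norm_Pair)
  have Npos: "sqrt \<delta> \<le> N u" for u unfolding N by (rule real_sqrt_le_mono) simp
  have sd: "0 < sqrt \<delta>" using \<delta> by simp
  have k: "log_kernel \<delta> u = - ln (N u)" for u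
    unfolding N log_kernel_def using \<delta> by (subst ln_sqrt) (auto intro: add_nonneg_pos)
  have half: "ln (N u) - ln (N v) \<le> cmod (u - v) / sqrt \<delta>" for u v
  proof -
    have p: "0 < N u" "0 < N v" using Npos[of u] Npos[of v] sd by linarith+
    have "ln (N u) - ln (N v) = ln (N u / N v)" using p by (simp add: ln_div)
    also have "\<dots> \<le> N u / N v - 1" using p by (intro ln_le_minus_one) simp
    also have "\<dots> = (N u - N v) / N v" using p by (simp add: diff_divide_distrib)
    also have "\<dots> \<le> cmod (u - v) / N v"
    proof (intro divide_right_mono)
      have "N u - N v \<le> norm ((u, sqrt \<delta>) - (v, sqrt \<delta>))" unfolding N_def by (rule norm_triangle_ineq2)
      then show "N u - N v \<le> cmod (u - v)" by (simp add: norm_Pair)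
    qed (use p in simp)
    also have "\<dots> \<le> cmod (u - v) / sqrt \<delta>" using Npos[of v] sd p by (intro divide_left_mono) auto
    finally show ?thesis .
  qed
  show ?thesis using half[of x y] half[of y x] unfolding k by (simp add: norm_minus_commute abs_le_iff)
qed

lemma potential_lipschitz:
  assumes \<mu>: "bdd_prob \<mu>" and \<delta>: "0 < \<delta>"
  shows "\<bar>(LINT w|\<mu>. log_kernel \<delta> (z - w)) - (LINT w|\<mu>. log_kernel \<delta> (z' - w))\<bar> \<le> cmod (z - z') / sqrt \<delta>"
proof -
  interpret prob_space \<mu> by (rule bdd_probD[OF \<mu>])
  note i = kernel_integrable[OF \<mu> continuous_log_kernel[OF \<delta>]]
  have "\<bar>(LINT w|\<mu>. log_kernel \<delta> (z - w)) - (LINT w|\<mu>. log_kernel \<delta> (z' - w))\<bar>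
      = \<bar>LINT w|\<mu>. log_kernel \<delta> (z - w) - log_kernel \<delta> (z' - w)\<bar>" using i by simp
  also have "\<dots> \<le> (LINT w|\<mu>. \<bar>log_kernel \<delta> (z - w) - log_kernel \<delta> (z' - w)\<bar>)" by (rule integral_abs_bound)
  also have "\<dots> \<le> (LINT w|\<mu>. cmod (z - z') / sqrt \<delta>)"
  proof (rule integral_mono)
    fix w show "\<bar>log_kernel \<delta> (z - w) - log_kernel \<delta> (z' - w)\<bar> \<le> cmod (z - z') / sqrt \<delta>"
      using log_kernel_lipschitz[OF \<delta>, of "z - w" "z' - w"] by simp
  qed (use i in auto)
  finally show ?thesis by (simp add: prob_space)
qed

lemma potential_continuous:
  assumes \<mu>: "bdd_prob \<mu>" and \<delta>: "0 < \<delta>"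
  shows "continuous_on UNIV (\<lambda>z. LINT w|\<mu>. log_kernel \<delta> (z - w))"
proof (rule lipschitz_on_continuous_on[of "1 / sqrt \<delta>"], rule lipschitz_onI)
  fix z z'
  show "dist (LINT w|\<mu>. log_kernel \<delta> (z - w)) (LINT w|\<mu>. log_kernel \<delta> (z' - w)) \<le> 1 / sqrt \<delta> * dist z z'"
    using potential_lipschitz[OF assms, of z z'] by (simp add: dist_norm)
qed (use \<delta> in simp)

text \<open>The average of the two measures, as the law of a point that a fair coin picks from
  independent samples of \<open>\<mu>\<close> and \<open>\<nu>\<close>.\<close>

definition midpoint_measure :: "complex measure \<Rightarrow> complex measure \<Rightarrow> complex measure" where
  "midpoint_measure \<mu> \<nu> = distr (measure_pmf (bernoulli_pmf (1/2)) \<Otimes>\<^sub>M (\<mu> \<Otimes>\<^sub>M \<nu>)) borel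
     (\<lambda>p. if fst p then fst (snd p) else snd (snd p))"

lemma
  assumes E: "compact E" and \<mu>: "\<mu> \<in> prob_measures_on E" and \<nu>: "\<nu> \<in> prob_measures_on E"
  shows midpoint_measure_on: "midpoint_measure \<mu> \<nu> \<in> prob_measures_on E"
    and integral_midpoint_measure: "\<And>f :: complex \<Rightarrow> real. continuous_on UNIV f \<Longrightarrow>
      integral\<^sup>L (midpoint_measure \<mu> \<nu>) f = (integral\<^sup>L \<mu> f + integral\<^sup>L \<nu> f) / 2"
proof -
  note b\<mu> = prob_measures_onD(2)[OF E \<mu>] and b\<nu> = prob_measures_onD(2)[OF E \<nu>]
  interpret \<mu>: prob_space \<mu> by (rule bdd_probD[OF b\<mu>])
  interpret \<nu>: prob_space \<nu> by (rule bdd_probD[OF b\<nu>])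
  have [measurable_cong]: "sets \<mu> = sets borel" "sets \<nu> = sets borel"
    by (rule bdd_probD[OF b\<mu>] bdd_probD[OF b\<nu>])+
  let ?B = "measure_pmf (bernoulli_pmf (1/2))"
  interpret B: prob_space ?B by (rule prob_space_measure_pmf)
  interpret P: pair_prob_space \<mu> \<nu> ..
  interpret Q: pair_prob_space ?B "\<mu> \<Otimes>\<^sub>M \<nu>" ..
  let ?g = "\<lambda>p. if fst p then fst (snd p) else snd (snd p)"
  have g: "?g \<in> ?B \<Otimes>\<^sub>M (\<mu> \<Otimes>\<^sub>M \<nu>) \<rightarrow>\<^sub>M borel" by measurable
  have ps: "prob_space (midpoint_measure \<mu> \<nu>)"
    unfolding midpoint_measure_def by (rule Q.prob_space_distr[OF g])
  have cE: "closed E" by (rule compact_imp_closed[OF E])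
  have "AE p in ?B \<Otimes>\<^sub>M (\<mu> \<Otimes>\<^sub>M \<nu>). ?g p \<in> E"
  proof (rule Q.AE_pair_measure)
    show "{p \<in> space (?B \<Otimes>\<^sub>M (\<mu> \<Otimes>\<^sub>M \<nu>)). ?g p \<in> E} \<in> sets (?B \<Otimes>\<^sub>M (\<mu> \<Otimes>\<^sub>M \<nu>))"
      using measurable_sets[OF g borel_closed[OF cE]] by (simp add: vimage_def Int_def conj_commute)
    have "AE q in \<mu> \<Otimes>\<^sub>M \<nu>. fst q \<in> E \<and> snd q \<in> E"
    proof (rule P.AE_pair_measure)
      show "{q \<in> space (\<mu> \<Otimes>\<^sub>M \<nu>). fst q \<in> E \<and> snd q \<in> E} \<in> sets (\<mu> \<Otimes>\<^sub>M \<nu>)"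
      proof -
        have "E \<times> E \<in> sets (\<mu> \<Otimes>\<^sub>M \<nu>)"
          by (intro pair_measureI) (use cE bdd_probD(1)[OF b\<mu>] bdd_probD(1)[OF b\<nu>] in auto)
        also have "E \<times> E = {q \<in> space (\<mu> \<Otimes>\<^sub>M \<nu>). fst q \<in> E \<and> snd q \<in> E}"
          by (auto simp: space_pair_measure bdd_probD(2)[OF b\<mu>] bdd_probD(2)[OF b\<nu>])
        finally show ?thesis .
      qed
      show "AE x in \<mu>. AE y in \<nu>. fst (x, y) \<in> E \<and> snd (x, y) \<in> E"
        using prob_measures_onD(1)[OF E \<mu>] by eventually_elim (use prob_measures_onD(1)[OF E \<nu>] in auto)
    qed
    then have "AE y in \<mu> \<Otimes>\<^sub>M \<nu>. ?g (x, y) \<in> E" for x by eventually_elim simp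
    then show "AE x in ?B. AE y in \<mu> \<Otimes>\<^sub>M \<nu>. ?g (x, y) \<in> E" by (rule AE_I2)
  qed
  then have "AE z in midpoint_measure \<mu> \<nu>. z \<in> E"
    unfolding midpoint_measure_def using cE by (subst AE_distr_iff[OF g]) auto
  then have "emeasure (midpoint_measure \<mu> \<nu>) (UNIV - E) = 0"
    by (subst (asm) AE_iff_measurable[where N="UNIV - E"]) (use cE in \<open>auto simp: midpoint_measure_def\<close>)
  with ps show "midpoint_measure \<mu> \<nu> \<in> prob_measures_on E"
    by (simp add: prob_measures_on_def midpoint_measure_def)
  then have bm: "bdd_prob (midpoint_measure \<mu> \<nu>)" by (rule prob_measures_onD[OF E])
  fix f :: "complex \<Rightarrow> real" assume f: "continuous_on UNIV f"
  have fm[measurable]: "f \<in> borel_measurable borel" by (rule borel_measurable_continuous_onI[OF f])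
  have cfst: "continuous_on UNIV (\<lambda>q :: complex \<times> complex. f (fst q))"
    by (rule continuous_on_compose2[OF f continuous_on_fst[OF continuous_on_id]]) auto
  have csnd: "continuous_on UNIV (\<lambda>q :: complex \<times> complex. f (snd q))"
    by (rule continuous_on_compose2[OF f continuous_on_snd[OF continuous_on_id]]) auto
  have i: "integrable (?B \<Otimes>\<^sub>M (\<mu> \<Otimes>\<^sub>M \<nu>)) (\<lambda>p. f (?g p))"
    using bdd_prob_integrable[OF bm f] unfolding midpoint_measure_def by (rule integrable_distr[OF g])
  have "integral\<^sup>L (midpoint_measure \<mu> \<nu>) f = (LINT p|(?B \<Otimes>\<^sub>M (\<mu> \<Otimes>\<^sub>M \<nu>)). f (?g p))"
    unfolding midpoint_measure_def by (rule integral_distr[OF g fm])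
  also have "\<dots> = (LINT b|?B. LINT q|(\<mu> \<Otimes>\<^sub>M \<nu>). f (if b then fst q else snd q))"
    using Q.integral_fst'[OF i] by simp
  also have "\<dots> = ((LINT q|(\<mu> \<Otimes>\<^sub>M \<nu>). f (fst q)) + (LINT q|(\<mu> \<Otimes>\<^sub>M \<nu>). f (snd q))) / 2"
    by (subst integral_bernoulli_pmf) (auto simp: field_simps)
  also have "(LINT q|(\<mu> \<Otimes>\<^sub>M \<nu>). f (fst q)) = integral\<^sup>L \<mu> f"
    using P.integral_fst'[OF bdd_prob_pair_integrable[OF b\<mu> b\<nu> cfst]]
    by (simp add: \<nu>.prob_space)
  also have "(LINT q|(\<mu> \<Otimes>\<^sub>M \<nu>). f (snd q)) = integral\<^sup>L \<nu> f"
    using P.integral_fst'[OF bdd_prob_pair_integrable[OF b\<mu> b\<nu> csnd]]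
    by (simp add: \<mu>.prob_space)
  finally show "integral\<^sup>L (midpoint_measure \<mu> \<nu>) f = (integral\<^sup>L \<mu> f + integral\<^sup>L \<nu> f) / 2" .
qed

text \<open>Parallelogram law for the energy form; it is the convexity behind the uniqueness of the
  minimiser.\<close>

lemma mutual_energy_midpoint:
  assumes E: "compact E" and \<mu>: "\<mu> \<in> prob_measures_on E" and \<nu>: "\<nu> \<in> prob_measures_on E" and \<delta>: "0 < \<delta>"
  defines "\<rho> \<equiv> midpoint_measure \<mu> \<nu>" and "k \<equiv> log_kernel \<delta>"
  shows "mutual_energy k \<rho> \<rho> = (mutual_energy k \<mu> \<mu> + mutual_energy k \<nu> \<nu>) / 2 - energy_dist k \<mu> \<nu> / 4"
proof -
  note b\<mu> = prob_measures_onD(2)[OF E \<mu>] and b\<nu> = prob_measures_onD(2)[OF E \<nu>]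
  have b\<rho>: "bdd_prob \<rho>" unfolding \<rho>_def by (rule prob_measures_onD(2)[OF E midpoint_measure_on[OF E \<mu> \<nu>]])
  have ck: "continuous_on UNIV (\<lambda>w. k (z - w))" for z
    unfolding k_def by (rule continuous_on_compose2[OF continuous_log_kernel[OF \<delta>]]) (auto intro!: continuous_intros)
  note I = integral_midpoint_measure[OF E \<mu> \<nu>, folded \<rho>_def]
  have pc: "continuous_on UNIV (\<lambda>z. LINT w|\<alpha>. k (z - w))" if "bdd_prob \<alpha>" for \<alpha>
    unfolding k_def by (rule potential_continuous[OF that \<delta>])
  have "mutual_energy k \<rho> \<rho> = (LINT z|\<rho>. ((LINT w|\<mu>. k (z - w)) + (LINT w|\<nu>. k (z - w))) / 2)"
    unfolding mutual_energy_def I[OF ck] ..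
  also have "\<dots> = (mutual_energy k \<rho> \<mu> + mutual_energy k \<rho> \<nu>) / 2"
    unfolding mutual_energy_def using bdd_prob_integrable[OF b\<rho> pc[OF b\<mu>]] bdd_prob_integrable[OF b\<rho> pc[OF b\<nu>]] by simp
  also have "mutual_energy k \<rho> \<mu> = (mutual_energy k \<mu> \<mu> + mutual_energy k \<nu> \<mu>) / 2"
    unfolding mutual_energy_def by (rule I[OF pc[OF b\<mu>]])
  also have "mutual_energy k \<rho> \<nu> = (mutual_energy k \<mu> \<nu> + mutual_energy k \<nu> \<nu>) / 2"
    unfolding mutual_energy_def by (rule I[OF pc[OF b\<nu>]])
  also have "mutual_energy k \<nu> \<mu> = mutual_energy k \<mu> \<nu>"
    unfolding k_def by (rule mutual_energy_commute[OF b\<nu> b\<mu> continuous_log_kernel[OF \<delta>]]) simp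
  finally show ?thesis by (simp add: energy_dist_def field_simps)
qed

text \<open>Applying \<open>gauss_le_of_log_kernel_dist\<close> with arbitrarily small
  \<open>\<epsilon>\<close> makes the Gaussian distances of all parameters vanish, although only one
  logarithmic kernel is known.\<close>

lemma eq_of_energy_dist_zero:
  assumes \<mu>: "bdd_prob \<mu>" and \<nu>: "bdd_prob \<nu>" and le: "energy_dist (log_kernel 1) \<mu> \<nu> \<le> 0"
  shows "\<mu> = \<nu>"
proof (rule bdd_prob_eqI_gauss[OF \<mu> \<nu>])
  fix s :: real and a assume s: "0 < s"
  have z: "energy_dist (log_kernel 1) \<mu> \<nu> = 0"
    using le energy_dist_log_kernel_nonneg[OF \<mu> \<nu>, of 1] by simp
  have "energy_dist (gauss s) \<mu> \<nu> \<le> 0"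
  proof (rule field_le_epsilon)
    fix e :: real assume "0 < e"
    then obtain c where "energy_dist (gauss s) \<mu> \<nu> \<le> 2 * (e / 2) + energy_dist (log_kernel 1) \<mu> \<nu> / c"
      using gauss_le_of_log_kernel_dist[OF s, of "e / 2"] \<mu> \<nu> by auto
    then show "energy_dist (gauss s) \<mu> \<nu> \<le> 0 + e" unfolding z by simp
  qed
  then have "((LINT z|\<mu>. gauss s (z - a)) - (LINT z|\<nu>. gauss s (z - a)))\<^sup>2 \<le> 0"
    using integral_gauss_diff_le[OF \<mu> \<nu>, of s a] s by linarith
  then show "(LINT z|\<mu>. gauss s (z - a)) = (LINT z|\<nu>. gauss s (z - a))" by simp
qed

text \<open>\<open>equilibrium_measure\<close> is a definite description, so the minimiser must be
  shown to exist and to be unique. It exists as a weak limit of a minimising sequence; it is unique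
  because the midpoint of two minimisers would have energy smaller by a quarter of their
  distance.\<close>

lemma equilibrium_measure_exists:
  assumes E: "compact E" and cap: "0 < log_capacity E"
  obtains \<gamma> where "log_capacity E = exp (- \<gamma>)" "equilibrium_measure E \<in> prob_measures_on E"
    "\<And>\<delta>. 0 < \<delta> \<Longrightarrow> mutual_energy (log_kernel \<delta>) (equilibrium_measure E) (equilibrium_measure E) \<le> \<gamma>"
    "(\<lambda>n. mutual_energy (log_kernel (1 / Suc n)) (equilibrium_measure E) (equilibrium_measure E)) \<longlonglongrightarrow> \<gamma>"
proof -
  have fin: "robin_const E \<noteq> \<infinity>" using cap by (auto simp: log_capacity_def split: if_splits)
  obtain R0 where R0: "\<And>z. z \<in> E \<Longrightarrow> cmod z \<le> R0"
    using compact_imp_bounded[OF E] by (auto simp: bounded_iff)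
  define C where "C = - ln ((2 * R0)\<^sup>2 + 1) / 2"
  have lb: "C \<le> mutual_energy (log_kernel 1) \<mu> \<mu>" if \<mu>: "\<mu> \<in> prob_measures_on E" for \<mu>
  proof -
    note b = prob_measures_onD(2)[OF E \<mu>]
    have R: "AE z in \<mu>. cmod z \<le> R0" using prob_measures_onD(1)[OF E \<mu>] by eventually_elim (rule R0)
    have "mutual_energy (\<lambda>_. C) \<mu> \<mu> \<le> mutual_energy (log_kernel 1) \<mu> \<mu>"
    proof (rule mutual_energy_mono[OF b b _ continuous_log_kernel R R])
      fix x assume "cmod x \<le> R0 + R0"
      then have "(cmod x)\<^sup>2 \<le> (2 * R0)\<^sup>2" by (intro power_mono) auto
      then show "C \<le> log_kernel 1 x" unfolding C_def log_kernel_def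
        by (simp add: add_nonneg_pos)
    qed auto
    then show ?thesis by (simp add: mutual_energy_const[OF b b])
  qed
  \<comment> \<open>Points of \<open>E\<close> have bounded differences, so all energies are bounded
    below; this excludes minus infinity and makes the Robin constant real.\<close>
  have "ereal C \<le> robin_const E"
    unfolding robin_const_def
  proof (rule INF_greatest, rule ccontr)
    fix \<mu> assume \<mu>: "\<mu> \<in> prob_measures_on E" and "\<not> ereal C \<le> log_energy \<mu>"
    then obtain c where c: "log_energy \<mu> < ereal c" "ereal c < ereal C"
      using ereal_dense2[of "log_energy \<mu>" "ereal C"] by (auto simp: not_le)
    then have "log_energy \<mu> \<le> ereal c" by simp
    then have "mutual_energy (log_kernel 1) \<mu> \<mu> \<le> c" unfolding log_energy_le_iff[OF E \<mu>] by simp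
    then show False using lb[OF \<mu>] c by simp
  qed
  with fin obtain \<gamma> where \<gamma>: "robin_const E = ereal \<gamma>" by (cases "robin_const E") auto
  have "\<exists>\<mu>\<in>prob_measures_on E. log_energy \<mu> \<le> ereal (\<gamma> + 1 / Suc j)" for j
  proof -
    have "robin_const E < ereal (\<gamma> + 1 / Suc j)" by (simp add: \<gamma>)
    then show ?thesis unfolding robin_const_def INF_less_iff by (auto intro: less_imp_le)
  qed
  then obtain m where m: "\<And>j. m j \<in> prob_measures_on E" "\<And>j. log_energy (m j) \<le> ereal (\<gamma> + 1 / Suc j)"
    by metis
  obtain r \<nu> where r: "strict_mono r" and \<nu>: "\<nu> \<in> prob_measures_on E"
    and "\<forall>f :: complex \<Rightarrow> real. continuous_on UNIV f \<longrightarrow> (\<lambda>j. integral\<^sup>L (m (r j)) f) \<longlonglongrightarrow> integral\<^sup>L \<nu> f"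
    using prob_measures_on_sequentially_compact[of E m, OF E m(1)] by blast
  note conv = this(3)[rule_format]
  note b\<nu> = prob_measures_onD(2)[OF E \<nu>]
  have I\<nu>: "mutual_energy (log_kernel \<delta>) \<nu> \<nu> \<le> \<gamma>" if \<delta>: "0 < \<delta>" for \<delta>
  proof -
    let ?k = "log_kernel \<delta>"
    have "(\<lambda>j. mutual_energy ?k (m (r j)) \<nu>) \<longlonglongrightarrow> mutual_energy ?k \<nu> \<nu>"
      unfolding mutual_energy_def by (rule conv[OF potential_continuous[OF b\<nu> \<delta>]])
    then have 1: "(\<lambda>j. 2 * mutual_energy ?k (m (r j)) \<nu> - mutual_energy ?k \<nu> \<nu>) \<longlonglongrightarrow> 2 * mutual_energy ?k \<nu> \<nu> - mutual_energy ?k \<nu> \<nu>"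
      by (intro tendsto_intros)
    have "(\<lambda>j. \<gamma> + 1 / Suc j) \<longlonglongrightarrow> \<gamma> + 0" by (intro tendsto_intros LIMSEQ_Suc[OF lim_1_over_n])
    from LIMSEQ_subseq_LIMSEQ[OF this r] have 2: "(\<lambda>j. \<gamma> + 1 / Suc (r j)) \<longlonglongrightarrow> \<gamma> + 0" by (simp add: comp_def)
    \<comment> \<open>Lower semicontinuity without product measures: positivity of the distance
      bounds the energy of \<open>m (r j)\<close> below by an affine function of that measure, so
      weak convergence is enough.\<close>
    have "2 * mutual_energy ?k (m (r j)) \<nu> - mutual_energy ?k \<nu> \<nu> \<le> \<gamma> + 1 / Suc (r j)" for j
    proof -
      have "mutual_energy ?k (m (r j)) (m (r j)) \<le> \<gamma> + 1 / Suc (r j)"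
        using m(2)[of "r j"] \<delta> unfolding log_energy_le_iff[OF E m(1)] by simp
      then show ?thesis
        using energy_dist_log_kernel_nonneg[OF prob_measures_onD(2)[OF E m(1)[of "r j"]] b\<nu> \<delta>]
        unfolding energy_dist_def by linarith
    qed
    then have "2 * mutual_energy ?k \<nu> \<nu> - mutual_energy ?k \<nu> \<nu> \<le> \<gamma> + 0"
      by (intro LIMSEQ_le[OF 1 2]) auto
    then show ?thesis by simp
  qed
  have min: "ereal \<gamma> \<le> log_energy \<mu>" if "\<mu> \<in> prob_measures_on E" for \<mu>
    unfolding \<gamma>[symmetric] robin_const_def using that by (rule INF_lower)
  have e\<nu>: "log_energy \<nu> = ereal \<gamma>"
    using I\<nu> min[OF \<nu>] log_energy_le_iff[OF E \<nu>, of \<gamma>] by (intro antisym) auto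
  have uniq: "\<mu> = \<nu>" if \<mu>: "\<mu> \<in> prob_measures_on E" and e: "log_energy \<mu> = ereal \<gamma>" for \<mu>
  proof (rule eq_of_energy_dist_zero[OF prob_measures_onD(2)[OF E \<mu>] b\<nu>])
    note b\<mu> = prob_measures_onD(2)[OF E \<mu>]
    note \<rho> = midpoint_measure_on[OF E \<mu> \<nu>] and b\<rho> = prob_measures_onD(2)[OF E midpoint_measure_on[OF E \<mu> \<nu>]]
    let ?\<rho> = "midpoint_measure \<mu> \<nu>" and ?d = "energy_dist (log_kernel 1) \<mu> \<nu>"
    have I\<mu>: "mutual_energy (log_kernel \<delta>) \<mu> \<mu> \<le> \<gamma>" if "0 < \<delta>" for \<delta>
      using log_energy_le_iff[OF E \<mu>, of \<gamma>] e that by simp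
    \<comment> \<open>The gain is measured at smoothing 1, where the distance is smallest among all
      \<open>\<delta> \<le> 1\<close>, so it does not depend on \<open>\<delta>\<close>.\<close>
    have small: "mutual_energy (log_kernel \<delta>) ?\<rho> ?\<rho> \<le> \<gamma> - ?d / 4" if "0 < \<delta>" "\<delta> \<le> 1" for \<delta>
    proof -
      have "(x + y) / 2 - d / 4 \<le> g - d' / 4" if "x \<le> g" "y \<le> g" "d' \<le> d" for x y g d d' :: real
        using that by (simp add: field_simps)
      from this[OF I\<mu>[OF that(1)] I\<nu>[OF that(1)] energy_dist_log_kernel_antimono[OF b\<mu> b\<nu> that]]
      show ?thesis unfolding mutual_energy_midpoint[OF E \<mu> \<nu> that(1)] .
    qed
    have "mutual_energy (log_kernel \<delta>) ?\<rho> ?\<rho> \<le> \<gamma> - ?d / 4" if "0 < \<delta>" for \<delta>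
    proof -
      have "mutual_energy (log_kernel \<delta>) ?\<rho> ?\<rho> \<le> mutual_energy (log_kernel (min \<delta> 1)) ?\<rho> ?\<rho>"
        using that by (intro mutual_energy_mono_UNIV b\<rho> continuous_log_kernel log_kernel_antimono) auto
      also have "\<dots> \<le> \<gamma> - ?d / 4" using that by (intro small) auto
      finally show ?thesis .
    qed
    then have "log_energy ?\<rho> \<le> ereal (\<gamma> - ?d / 4)" unfolding log_energy_le_iff[OF E \<rho>] by blast
    with min[OF \<rho>] have "ereal \<gamma> \<le> ereal (\<gamma> - ?d / 4)" by (rule order_trans)
    then show "?d \<le> 0" by simp
  qed
  have eq: "equilibrium_measure E = \<nu>"
    unfolding equilibrium_measure_def
  proof (rule the_equality)
    show "\<nu> \<in> prob_measures_on E \<and> log_energy \<nu> = robin_const E" using \<nu> e\<nu> \<gamma> by simp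
    show "\<mu> = \<nu>" if "\<mu> \<in> prob_measures_on E \<and> log_energy \<mu> = robin_const E" for \<mu>
      by (rule uniq) (use that \<gamma> in simp_all)
  qed
  show ?thesis
  proof (rule that[of \<gamma>])
    show "log_capacity E = exp (- \<gamma>)" by (simp add: log_capacity_def \<gamma>)
    show "(\<lambda>n. mutual_energy (log_kernel (1 / Suc n)) (equilibrium_measure E) (equilibrium_measure E)) \<longlonglongrightarrow> \<gamma>"
      using log_energy_LIMSEQ[OF E \<nu>] unfolding e\<nu> eq by (simp del: of_nat_Suc)
    show "equilibrium_measure E \<in> prob_measures_on E" unfolding eq by (rule \<nu>)
    show "mutual_energy (log_kernel \<delta>) (equilibrium_measure E) (equilibrium_measure E) \<le> \<gamma>" if "0 < \<delta>" for \<delta>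
      unfolding eq by (rule I\<nu>[OF that])
  qed
qed

section \<open>Zero counting measures\<close>

text \<open>The second coordinate only supplies \<open>order z p\<close> copies of each zero, so the
  uniform law on the pairs counts zeros with multiplicity.\<close>

definition root_measure :: "complex poly \<Rightarrow> complex measure" where
  "root_measure p = distr (measure_pmf (pmf_of_set (SIGMA z:{z. poly p z = 0}. {..<order z p}))) borel fst"

lemma sum_order_eq_degree:
  fixes p :: "complex poly"
  assumes "p \<noteq> 0"
  shows "(\<Sum>z | poly p z = 0. order z p) = degree p"
proof -
  have lc: "lead_coeff p \<noteq> 0" using assms by simp
  have "degree p = degree (smult (lead_coeff p) (\<Prod>z | poly p z = 0. [:- z, 1:] ^ order z p))"
    by (simp only: complex_poly_decompose)
  also have "\<dots> = degree (\<Prod>z | poly p z = 0. [:- z, 1:] ^ order z p)" using lc by simp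
  also have "\<dots> = (\<Sum>z | poly p z = 0. degree ([:- z, 1:] ^ order z p))"
    by (rule degree_prod_eq_sum_degree) auto
  also have "\<dots> = (\<Sum>z | poly p z = 0. order z p)"
    by (intro sum.cong refl) (simp add: degree_power_eq)
  finally show ?thesis by simp
qed

lemma
  fixes p :: "complex poly"
  assumes deg: "0 < degree p"
  shows integral_root_measure: "\<And>f :: complex \<Rightarrow> real. f \<in> borel_measurable borel \<Longrightarrow>
      integral\<^sup>L (root_measure p) f = (1 / degree p) * (\<Sum>z | poly p z = 0. order z p * f z)"
    and bdd_prob_root_measure: "bdd_prob (root_measure p)"
proof -
  have p0: "p \<noteq> 0" using deg by auto
  let ?Z = "{z. poly p z = 0}"
  let ?S = "SIGMA z:?Z. {..<order z p}"
  have fz: "finite ?Z" by (rule poly_roots_finite[OF p0])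
  have fs: "finite ?S" using fz by simp
  have card: "card ?S = degree p" using fz by (simp add: sum_order_eq_degree[OF p0])
  have ne: "?S \<noteq> {}" using card deg by auto
  show "integral\<^sup>L (root_measure p) f = (1 / degree p) * (\<Sum>z\<in>?Z. order z p * f z)"
    if f: "f \<in> borel_measurable borel" for f :: "complex \<Rightarrow> real"
  proof -
    have "integral\<^sup>L (root_measure p) f = measure_pmf.expectation (pmf_of_set ?S) (\<lambda>q. f (fst q))"
      unfolding root_measure_def using f by (intro integral_distr) auto
    also have "\<dots> = (\<Sum>q\<in>?S. f (fst q)) / degree p"
      using integral_pmf_of_set[OF ne fs, of "\<lambda>q. f (fst q)"] card by simp
    also have "(\<Sum>q\<in>?S. f (fst q)) = (\<Sum>z\<in>?Z. \<Sum>i<order z p. f z)"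
      using fz by (subst sum.Sigma) (auto simp: case_prod_beta')
    finally show ?thesis by simp
  qed
  obtain R where R: "\<And>z. z \<in> ?Z \<Longrightarrow> cmod z \<le> R"
    using finite_imp_bounded[OF fz] by (auto simp: bounded_iff)
  have "AE q in measure_pmf (pmf_of_set ?S). cmod (fst q) \<le> R"
    using R by (subst AE_measure_pmf_iff) (auto simp: set_pmf_of_set[OF ne fs])
  then have "AE z in root_measure p. cmod z \<le> R"
    unfolding root_measure_def by (subst AE_distr_iff) auto
  moreover have "prob_space (root_measure p)"
    unfolding root_measure_def by (rule prob_space.prob_space_distr[OF prob_space_measure_pmf]) auto
  ultimately show "bdd_prob (root_measure p)"
    unfolding bdd_prob_def by (auto simp: root_measure_def)
qed

lemma zero_count_integral_root_measure:
  assumes "degree p = n" "0 < n" "continuous_on UNIV f"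
  shows "zero_count_integral n p f = integral\<^sup>L (root_measure p) f"
  using assms integral_root_measure[of p f] borel_measurable_continuous_onI[of f]
  by (simp add: zero_count_integral_def)

lemma integral_root_measure_ln:
  fixes p :: "complex poly"
  assumes deg: "0 < degree p" and z: "poly p z \<noteq> 0"
  shows "(LINT w|root_measure p. ln (cmod (z - w))) = (ln (cmod (poly p z)) - ln (cmod (lead_coeff p))) / degree p"
proof -
  have p0: "p \<noteq> 0" using deg by auto
  let ?Z = "{z. poly p z = 0}"
  have fz: "finite ?Z" by (rule poly_roots_finite[OF p0])
  have ne: "z - w \<noteq> 0" if "w \<in> ?Z" for w using that z by auto
  have "poly p z = lead_coeff p * (\<Prod>w\<in>?Z. (z - w) ^ order w p)"
    by (subst complex_poly_decompose[symmetric]) (simp add: poly_prod)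
  then have "cmod (poly p z) = cmod (lead_coeff p) * (\<Prod>w\<in>?Z. cmod (z - w) ^ order w p)"
    by (simp add: norm_mult norm_power prod_norm[symmetric])
  also have "ln \<dots> = ln (cmod (lead_coeff p)) + (\<Sum>w\<in>?Z. order w p * ln (cmod (z - w)))"
  proof -
    have "ln (\<Prod>w\<in>?Z. cmod (z - w) ^ order w p) = (\<Sum>w\<in>?Z. ln (cmod (z - w) ^ order w p))"
      by (rule ln_prod[OF fz]) (use ne in auto)
    also have "\<dots> = (\<Sum>w\<in>?Z. order w p * ln (cmod (z - w)))"
      by (intro sum.cong refl ln_realpow)
    finally show ?thesis using p0 fz ne
      by (subst ln_mult) (auto)
  qed
  finally have "(\<Sum>w\<in>?Z. order w p * ln (cmod (z - w))) = ln (cmod (poly p z)) - ln (cmod (lead_coeff p))"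
    by simp
  then show ?thesis by (subst integral_root_measure[OF deg]) auto
qed

lemma log_kernel_le_ln: "0 < \<delta> \<Longrightarrow> x \<noteq> 0 \<Longrightarrow> log_kernel \<delta> x \<le> - ln (cmod x)"
proof -
  assume \<delta>: "0 < \<delta>" and x: "x \<noteq> 0"
  have "ln (cmod x ^ 2) \<le> ln ((cmod x)\<^sup>2 + \<delta>)"
    using \<delta> x by (subst ln_le_cancel_iff) (auto intro: add_nonneg_pos)
  then show ?thesis using x by (simp add: log_kernel_def ln_realpow)
qed

text \<open>Smoothing lowers the kernel, so this estimate has no error term: a lower bound for
  \<open>|p|\<close> at one point controls the smoothed potential there.\<close>

lemma root_potential_le:
  assumes deg: "0 < degree p" and z: "poly p z \<noteq> 0" and \<delta>: "0 < \<delta>"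
  shows "(LINT w|root_measure p. log_kernel \<delta> (z - w))
    \<le> (ln (cmod (lead_coeff p)) - ln (cmod (poly p z))) / degree p"
proof -
  have ne: "z - w \<noteq> 0" if "poly p w = 0" for w using that z by auto
  have m: "(\<lambda>w. log_kernel \<delta> (z - w)) \<in> borel_measurable borel"
    unfolding log_kernel_def by measurable
  have m2: "(\<lambda>w. ln (cmod (z - w))) \<in> borel_measurable borel" by measurable
  have "(LINT w|root_measure p. log_kernel \<delta> (z - w)) \<le> - (LINT w|root_measure p. ln (cmod (z - w)))"
    unfolding integral_root_measure[OF deg m] integral_root_measure[OF deg m2]
      mult_minus_right[symmetric] sum_negf[symmetric]
    by (intro mult_left_mono sum_mono) (auto intro!: mult_left_mono log_kernel_le_ln[OF \<delta>] dest!: ne)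
  also have "\<dots> = (ln (cmod (lead_coeff p)) - ln (cmod (poly p z))) / degree p"
    unfolding integral_root_measure_ln[OF deg z] by (simp add: diff_divide_distrib)
  finally show ?thesis .
qed

text \<open>Exchange the sum over the zeros with the integral over \<open>\<sigma>\<close>: the true
  logarithms add up to \<open>ln |p|\<close>, up to the leading coefficient, and this is bounded
  above \<open>\<sigma>\<close>-almost everywhere. Smoothing acts against the inequality here;
  \<open>\<eta>\<close> is its price, required at every \<open>w\<close> because the zeros may lie
  anywhere.\<close>

lemma mutual_energy_root_ge:
  assumes deg: "0 < degree p" and \<sigma>: "bdd_prob \<sigma>" and \<delta>: "0 < \<delta>"
    and i: "\<And>w. integrable \<sigma> (\<lambda>z. ln (cmod (z - w)))"
    and tail: "\<And>w. - (LINT z|\<sigma>. log_kernel \<delta> (z - w)) \<le> (LINT z|\<sigma>. ln (cmod (z - w))) + \<eta>"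
    and atom: "\<And>w. AE z in \<sigma>. z \<noteq> w"
    and up: "AE z in \<sigma>. poly p z \<noteq> 0 \<longrightarrow> (ln (cmod (poly p z)) - ln (cmod (lead_coeff p))) / degree p \<le> c"
  shows "- c - \<eta> \<le> mutual_energy (log_kernel \<delta>) (root_measure p) \<sigma>"
proof -
  interpret prob_space \<sigma> by (rule bdd_probD[OF \<sigma>])
  have p0: "p \<noteq> 0" using deg by auto
  let ?Z = "{z. poly p z = 0}"
  have fz: "finite ?Z" by (rule poly_roots_finite[OF p0])
  have ck: "continuous_on UNIV (\<lambda>w. LINT z|\<sigma>. log_kernel \<delta> (w - z))"
    by (rule potential_continuous[OF \<sigma> \<delta>])
  have ev: "log_kernel \<delta> (w - z) = log_kernel \<delta> (z - w)" for w z
    using log_kernel_minus[of \<delta> "z - w"] by simp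
  have one: "(1 / degree p) * (\<Sum>w\<in>?Z. real (order w p) * \<eta>) = \<eta>"
    using sum_order_eq_degree[OF p0] deg by (simp add: sum_distrib_right[symmetric] flip: of_nat_sum)
  have "- mutual_energy (log_kernel \<delta>) (root_measure p) \<sigma>
      = (1 / degree p) * (\<Sum>w\<in>?Z. order w p * (- (LINT z|\<sigma>. log_kernel \<delta> (z - w))))"
    unfolding mutual_energy_def
    by (subst integral_root_measure[OF deg borel_measurable_continuous_onI[OF ck]])
       (simp add: ev sum_negf)
  also have "\<dots> \<le> (1 / degree p) * (\<Sum>w\<in>?Z. order w p * ((LINT z|\<sigma>. ln (cmod (z - w))) + \<eta>))"
    by (intro mult_left_mono sum_mono tail) auto
  also have "\<dots> = (1 / degree p) * (\<Sum>w\<in>?Z. order w p * (LINT z|\<sigma>. ln (cmod (z - w)))) + \<eta>"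
    using one by (simp add: distrib_left sum.distrib)
  also have "(1 / degree p) * (\<Sum>w\<in>?Z. order w p * (LINT z|\<sigma>. ln (cmod (z - w))))
      = (LINT z|\<sigma>. (1 / degree p) * (\<Sum>w\<in>?Z. order w p * ln (cmod (z - w))))"
    using i by simp
  also have "\<dots> \<le> (LINT z|\<sigma>. c)"
  proof (rule integral_mono_AE)
    \<comment> \<open>The finite set of zeros is null because \<open>\<sigma>\<close> has no atoms;
      outside it no factor meets the default value \<open>ln 0 = 0\<close>.\<close>
    have "AE z in \<sigma>. \<forall>w\<in>?Z. z \<noteq> w"
      using atom fz by (intro AE_finite_allI) auto
    then show "AE z in \<sigma>. (1 / degree p) * (\<Sum>w\<in>?Z. order w p * ln (cmod (z - w))) \<le> c"
      using up
    proof eventually_elim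
      case (elim z)
      then have z: "poly p z \<noteq> 0" by auto
      have "(1 / degree p) * (\<Sum>w\<in>?Z. order w p * ln (cmod (z - w))) = (LINT w|root_measure p. ln (cmod (z - w)))"
        by (rule integral_root_measure[OF deg, symmetric]) measurable
      then show ?case unfolding integral_root_measure_ln[OF deg z] using elim(2) z by metis
    qed
  qed (use i in auto)
  also have "\<dots> = c" by (simp add: prob_space)
  finally show ?thesis by simp
qed

section \<open>Restricting a measure of finite energy\<close>

text \<open>The smoothing error, that is the gap between \<open>- ln |x|\<close> and
  \<open>log_kernel \<delta> x\<close>. It is infinite at 0, so that a finite integral rules out an
  atom.\<close>

definition log_tail :: "real \<Rightarrow> complex \<Rightarrow> ennreal" where
  "log_tail \<delta> x = (if x = 0 then \<infinity> else ennreal (- log_kernel \<delta> x - ln (cmod x)))"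

lemma log_tail_measurable [measurable]: "log_tail \<delta> \<in> borel_measurable borel"
  unfolding log_tail_def log_kernel_def by measurable

lemma log_tail_eq:
  assumes "0 < \<delta>" "x \<noteq> 0"
  shows "- log_kernel \<delta> x - ln (cmod x) = ln (1 + \<delta> / (cmod x)\<^sup>2) / 2"
proof -
  have p: "0 < (cmod x)\<^sup>2" "0 < (cmod x)\<^sup>2 + \<delta>" using assms by (auto intro: add_nonneg_pos)
  have "ln (1 + \<delta> / (cmod x)\<^sup>2) = ln (((cmod x)\<^sup>2 + \<delta>) / (cmod x)\<^sup>2)"
    using p by (simp add: field_simps)
  also have "\<dots> = ln ((cmod x)\<^sup>2 + \<delta>) - ln ((cmod x)\<^sup>2)" using p by (simp add: ln_div)
  also have "ln ((cmod x)\<^sup>2) = 2 * ln (cmod x)" using assms by (simp add: ln_realpow)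
  finally show ?thesis by (simp add: log_kernel_def)
qed

text \<open>The error is an increasing function of \<open>\<delta> / |x|^2\<close>, so a factor 2 in
  the distance is compensated by a factor 4 in \<open>\<delta>\<close>.\<close>

lemma log_tail_double:
  assumes \<delta>: "0 < \<delta>" and le: "cmod y \<le> 2 * cmod x"
  shows "log_tail (\<delta> / 4) x \<le> log_tail \<delta> y"
proof (cases "y = 0")
  case False
  then have x: "x \<noteq> 0" using le by auto
  have "(cmod y)\<^sup>2 \<le> (2 * cmod x)\<^sup>2" by (intro power_mono le) simp
  then have "\<delta> / 4 / (cmod x)\<^sup>2 \<le> \<delta> / (cmod y)\<^sup>2"
    using \<delta> x False by (simp add: field_simps)
  then have "ln (1 + \<delta> / 4 / (cmod x)\<^sup>2) \<le> ln (1 + \<delta> / (cmod y)\<^sup>2)"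
    using \<delta> x by (subst ln_le_cancel_iff) (auto intro!: add_pos_nonneg)
  then show ?thesis
    using \<delta> x False log_tail_eq[of "\<delta>/4" x] log_tail_eq[of \<delta> y]
    unfolding log_tail_def by (auto intro!: ennreal_leI)
qed (simp add: log_tail_def)

text \<open>Fatou's lemma for the differences of the kernels with parameters
  \<open>1 / Suc (n + m)\<close> and \<open>1 / Suc m\<close>: their energies are bounded by the
  part of \<open>\<gamma>\<close> that the coarser kernel misses.\<close>

lemma nn_integral_log_tail_le:
  assumes E: "compact E" and \<mu>: "\<mu> \<in> prob_measures_on E"
    and le: "\<And>\<delta>. 0 < \<delta> \<Longrightarrow> mutual_energy (log_kernel \<delta>) \<mu> \<mu> \<le> \<gamma>"
  shows "(\<integral>\<^sup>+ z. \<integral>\<^sup>+ w. log_tail (1 / Suc m) (z - w) \<partial>\<mu> \<partial>\<mu>)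
    \<le> ennreal (\<gamma> - mutual_energy (log_kernel (1 / Suc m)) \<mu> \<mu>)"
proof -
  note b = prob_measures_onD(2)[OF E \<mu>]
  interpret prob_space \<mu> by (rule bdd_probD[OF b])
  have [measurable_cong]: "sets \<mu> = sets borel" by (rule bdd_probD[OF b])
  obtain R where R: "AE z in \<mu>. cmod z \<le> R" using b by (auto simp: bdd_prob_def)
  define k where "k n x = log_kernel (1 / Suc (n + m)) x - log_kernel (1 / Suc m) x" for n x
  have cl: "continuous_on UNIV (log_kernel (1 / Suc n))" for n by (rule continuous_log_kernel) simp
  have ck: "continuous_on UNIV (k n)" for n
    unfolding k_def by (intro continuous_intros cl)
  have [measurable]: "k n \<in> borel_measurable borel" for n by (rule borel_measurable_continuous_onI[OF ck])
  have k0: "0 \<le> k n x" for n x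
    unfolding k_def by (simp del: of_nat_Suc) (intro log_kernel_antimono, auto simp: frac_le)
  have lim: "(\<lambda>n. ennreal (k n x)) \<longlonglongrightarrow> log_tail (1 / Suc m) x" for x
    using LIMSEQ_ignore_initial_segment[OF log_kernel_tendsto[of x "- log_kernel (1 / Suc m) x"], of m]
    unfolding k_def log_tail_def by (simp add: add.commute)
  have "(\<integral>\<^sup>+ z. \<integral>\<^sup>+ w. log_tail (1 / Suc m) (z - w) \<partial>\<mu> \<partial>\<mu>)
      = (\<integral>\<^sup>+ z. \<integral>\<^sup>+ w. liminf (\<lambda>n. ennreal (k n (z - w))) \<partial>\<mu> \<partial>\<mu>)"
    by (intro nn_integral_cong lim_imp_Liminf[symmetric] lim) simp
  also have "\<dots> \<le> (\<integral>\<^sup>+ z. liminf (\<lambda>n. \<integral>\<^sup>+ w. ennreal (k n (z - w)) \<partial>\<mu>) \<partial>\<mu>)"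
    by (intro nn_integral_mono nn_integral_liminf) measurable
  also have "\<dots> \<le> liminf (\<lambda>n. \<integral>\<^sup>+ z. \<integral>\<^sup>+ w. ennreal (k n (z - w)) \<partial>\<mu> \<partial>\<mu>)"
    by (intro nn_integral_liminf) measurable
  also have "\<dots> \<le> ennreal (\<gamma> - mutual_energy (log_kernel (1 / Suc m)) \<mu> \<mu>)"
  proof (rule Liminf_le)
    show "\<forall>\<^sub>F n in sequentially. (\<integral>\<^sup>+ z. \<integral>\<^sup>+ w. ennreal (k n (z - w)) \<partial>\<mu> \<partial>\<mu>)
        \<le> ennreal (\<gamma> - mutual_energy (log_kernel (1 / Suc m)) \<mu> \<mu>)"
    proof (intro always_eventually allI)
      fix n
      have "(\<integral>\<^sup>+ z. \<integral>\<^sup>+ w. ennreal (k n (z - w)) \<partial>\<mu> \<partial>\<mu>) = ennreal (mutual_energy (k n) \<mu> \<mu>)"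
        by (rule nn_mutual_energy[OF b b ck R R k0])
      also have "mutual_energy (log_kernel (1 / Suc (n + m))) \<mu> \<mu>
          = mutual_energy (\<lambda>x. k n x + log_kernel (1 / Suc m) x) \<mu> \<mu>"
        by (simp add: k_def)
      then have "mutual_energy (k n) \<mu> \<mu> \<le> \<gamma> - mutual_energy (log_kernel (1 / Suc m)) \<mu> \<mu>"
        using le[of "1 / Suc (n + m)"] mutual_energy_add[OF b b ck cl, of n m] by (simp del: of_nat_Suc)
      then have "ennreal (mutual_energy (k n) \<mu> \<mu>) \<le> ennreal (\<gamma> - mutual_energy (log_kernel (1 / Suc m)) \<mu> \<mu>)"
        by (rule ennreal_leI)
      finally show "(\<integral>\<^sup>+ z. \<integral>\<^sup>+ w. ennreal (k n (z - w)) \<partial>\<mu> \<partial>\<mu>)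
        \<le> ennreal (\<gamma> - mutual_energy (log_kernel (1 / Suc m)) \<mu> \<mu>)" .
    qed
  qed simp
  finally show ?thesis .
qed

text \<open>The error potential \<open>T\<close> has a small integral, hence is small off a set of
  small mass, and inner regularity gives a compact \<open>K\<close> inside the good set. The bound
  is carried from \<open>K\<close> to an arbitrary \<open>w\<close> by comparing \<open>w\<close>
  with its nearest point in \<open>K\<close>; this takes the place of a maximum principle.\<close>

lemma regular_restriction:
  assumes E: "compact E" and \<mu>: "\<mu> \<in> prob_measures_on E"
    and le: "\<And>\<delta>. 0 < \<delta> \<Longrightarrow> mutual_energy (log_kernel \<delta>) \<mu> \<mu> \<le> \<gamma>"
    and lim: "(\<lambda>n. mutual_energy (log_kernel (1 / Suc n)) \<mu> \<mu>) \<longlonglongrightarrow> \<gamma>"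
    and \<eta>: "0 < \<eta>" "\<eta> \<le> 1/4"
  shows "\<exists>K \<delta>. compact K \<and> K \<subseteq> E \<and> 1 - 2 * \<eta> \<le> measure \<mu> K \<and> 0 < \<delta> \<and> \<delta> \<le> 1 \<and>
    (\<forall>w. (\<integral>\<^sup>+ z. log_tail \<delta> (z - w) * indicator K z \<partial>\<mu>) \<le> ennreal \<eta>)"
proof -
  note b = prob_measures_onD(2)[OF E \<mu>] and ae = prob_measures_onD(1)[OF E \<mu>]
  interpret prob_space \<mu> by (rule bdd_probD[OF b])
  have sb[measurable_cong]: "sets \<mu> = sets borel" by (rule bdd_probD[OF b])
  have spc: "space \<mu> = UNIV" by (rule bdd_probD[OF b])
  have Es: "E \<in> sets \<mu>" using compact_imp_closed[OF E] by (simp add: sb)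
  \<comment> \<open>Aiming at the square lets Markov's inequality at level \<open>\<eta>\<close>
    lose mass at most \<open>\<eta>\<close>. Inner regularity loses another \<open>\<eta>\<close>,
    hence \<open>1 - 2 * \<eta>\<close>.\<close>
  have "0 < \<eta>\<^sup>2" using \<eta> by simp
  from LIMSEQ_D[OF lim this] obtain m where "\<bar>mutual_energy (log_kernel (1 / Suc m)) \<mu> \<mu> - \<gamma>\<bar> < \<eta>\<^sup>2" by auto
  then have m: "\<gamma> - mutual_energy (log_kernel (1 / Suc m)) \<mu> \<mu> \<le> \<eta> * \<eta>" by (simp add: power2_eq_square)
  define d where "d = 1 / real (Suc m)"
  have d: "0 < d" "d \<le> 1" by (auto simp: d_def)
  define T where "T z = (\<integral>\<^sup>+ w. log_tail d (z - w) \<partial>\<mu>)" for z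
  have Tm[measurable]: "T \<in> borel_measurable \<mu>" unfolding T_def[abs_def] by measurable
  have intT: "(\<integral>\<^sup>+ z. T z \<partial>\<mu>) \<le> ennreal (\<eta> * \<eta>)"
    using order_trans[OF nn_integral_log_tail_le[OF E \<mu> le, of m] ennreal_leI[OF m]] unfolding T_def d_def .
  define K0 where "K0 = {z \<in> E. T z < ennreal \<eta>}"
  have K0s: "K0 \<in> sets \<mu>" unfolding K0_def using Es Tm by (simp add: spc flip: Collect_conj_eq) measurable
  have "emeasure \<mu> (space \<mu> - K0) \<le> ennreal \<eta>"
  proof -
    have "emeasure \<mu> (space \<mu> - K0) = emeasure \<mu> {z \<in> space \<mu>. ennreal \<eta> \<le> T z}"
    proof (rule emeasure_eq_AE)
      show "AE z in \<mu>. z \<in> space \<mu> - K0 \<longleftrightarrow> z \<in> {z \<in> space \<mu>. ennreal \<eta> \<le> T z}"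
        using ae by eventually_elim (auto simp: K0_def not_less)
    qed (use K0s in auto)
    also have "\<dots> \<le> ennreal \<eta>"
    proof -
      have "ennreal \<eta> * emeasure \<mu> {z \<in> space \<mu>. ennreal \<eta> \<le> T z}
          = (\<integral>\<^sup>+ z. ennreal \<eta> * indicator {z \<in> space \<mu>. ennreal \<eta> \<le> T z} z \<partial>\<mu>)"
        by (rule nn_integral_cmult_indicator[symmetric]) measurable
      also have "\<dots> \<le> (\<integral>\<^sup>+ z. T z \<partial>\<mu>)" by (intro nn_integral_mono) (auto simp: indicator_def)
      also have "\<dots> \<le> ennreal \<eta> * ennreal \<eta>" using intT \<eta> by (simp add: ennreal_mult)
      finally show ?thesis using \<eta> by (simp add: ennreal_mult_le_mult_iff)
    qed
    finally show ?thesis .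
  qed
  then have mK0: "1 - \<eta> \<le> measure \<mu> K0"
    using prob_compl[OF K0s] \<eta> by (simp add: emeasure_eq_measure)
  have "emeasure \<mu> K0 = (SUP K \<in> {K. K \<subseteq> K0 \<and> compact K}. emeasure \<mu> K)"
    by (rule inner_regular[OF sb]) (use K0s sb in auto)
  moreover have "ennreal (1 - 2 * \<eta>) < emeasure \<mu> K0"
    unfolding emeasure_eq_measure using mK0 \<eta> by (intro ennreal_lessI) auto
  ultimately obtain K where K: "K \<subseteq> K0" "compact K" "ennreal (1 - 2 * \<eta>) < emeasure \<mu> K"
    by (auto simp: less_SUP_iff)
  have mK: "1 - 2 * \<eta> \<le> measure \<mu> K"
    using K(3) by (simp add: emeasure_eq_measure) (metis ennreal_less_iff less_imp_le measure_nonneg not_le ennreal_leI)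
  have ne: "K \<noteq> {}" using mK \<eta> by auto
  have "(\<integral>\<^sup>+ z. log_tail (d / 4) (z - w) * indicator K z \<partial>\<mu>) \<le> ennreal \<eta>" for w
  proof -
    \<comment> \<open>For \<open>z\<close> in \<open>K\<close> the nearest point satisfies
      \<open>|w' - z| \<le> 2 * |w - z|\<close>, so \<open>log_tail_double\<close> applies; hence
      the parameter \<open>d / 4\<close>.\<close>
    obtain w' where w': "w' \<in> K" "\<And>z. z \<in> K \<Longrightarrow> dist w w' \<le> dist w z"
      using distance_attains_inf[OF compact_imp_closed[OF K(2)] ne] by blast
    have "(\<integral>\<^sup>+ z. log_tail (d / 4) (z - w) * indicator K z \<partial>\<mu>) \<le> (\<integral>\<^sup>+ z. log_tail d (w' - z) \<partial>\<mu>)"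
    proof (intro nn_integral_mono)
      fix z
      show "log_tail (d / 4) (z - w) * indicator K z \<le> log_tail d (w' - z)"
      proof (cases "z \<in> K")
        case True
        have "cmod (w' - z) \<le> dist w' w + dist w z" by (metis dist_norm dist_triangle)
        also have "\<dots> \<le> 2 * cmod (z - w)" using w'(2)[OF True] by (simp add: dist_norm norm_minus_commute)
        finally show ?thesis using log_tail_double[OF d(1), of "w' - z" "z - w"] True by simp
      qed simp
    qed
    also have "\<dots> = T w'" by (simp add: T_def)
    also have "\<dots> \<le> ennreal \<eta>" using w'(1) K(1) by (auto simp: K0_def)
    finally show ?thesis .
  qed
  moreover have "K \<subseteq> E" using K(1) by (auto simp: K0_def)
  ultimately show ?thesis using K(2) mK d by (intro exI[of _ K] exI[of _ "d / 4"]) auto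
qed

definition normalized_restriction :: "complex measure \<Rightarrow> complex set \<Rightarrow> complex measure" where
  "normalized_restriction \<mu> K = density \<mu> (\<lambda>z. ennreal (indicator K z / measure \<mu> K))"

text \<open>With \<open>\<eta> \<le> 1/4\<close> the set \<open>K\<close> carries at least half of
  the mass, so normalising multiplies integrals of nonnegative functions over \<open>K\<close> by at
  most 2.\<close>

locale restriction =
  fixes E :: "complex set" and \<mu> :: "complex measure" and K :: "complex set" and \<eta> :: real
  assumes E: "compact E" and \<mu>: "\<mu> \<in> prob_measures_on E" and K: "compact K" "K \<subseteq> E"
    and mK: "1 - 2 * \<eta> \<le> measure \<mu> K" and \<eta>: "0 < \<eta>" "\<eta> \<le> 1/4"
begin

abbreviation "\<sigma> \<equiv> normalized_restriction \<mu> K"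
abbreviation "m \<equiv> measure \<mu> K"

lemma bdd_prob_base: "bdd_prob \<mu>" and AE_base: "AE z in \<mu>. z \<in> E"
  using prob_measures_onD[OF E \<mu>] by auto

sublocale prob_space \<mu> by (rule bdd_probD[OF bdd_prob_base])

lemma sets_\<mu> [measurable_cong]: "sets \<mu> = sets borel" by (rule bdd_probD[OF bdd_prob_base])

lemma K_sets [measurable]: "K \<in> sets borel" using compact_imp_closed[OF K(1)] by simp

lemma K_sets' [measurable]: "K \<in> sets \<mu>" by (simp add: sets_\<mu> K_sets)

lemma mass_bounds: "1/2 \<le> m" "0 < m" "m \<le> 1" using mK \<eta> by auto

lemma nn_integral_restriction:
  assumes [measurable]: "f \<in> borel_measurable borel"
  shows "(\<integral>\<^sup>+ z. f z \<partial>\<sigma>) = ennreal (1 / m) * (\<integral>\<^sup>+ z. f z * indicator K z \<partial>\<mu>)"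
proof -
  have "(\<integral>\<^sup>+ z. f z \<partial>\<sigma>) = (\<integral>\<^sup>+ z. ennreal (indicator K z / m) * f z \<partial>\<mu>)"
    unfolding normalized_restriction_def by (rule nn_integral_density) measurable
  also have "\<dots> = (\<integral>\<^sup>+ z. ennreal (1 / m) * (f z * indicator K z) \<partial>\<mu>)"
    by (intro nn_integral_cong) (auto simp: indicator_def mult_ac)
  also have "\<dots> = ennreal (1 / m) * (\<integral>\<^sup>+ z. f z * indicator K z \<partial>\<mu>)"
    by (rule nn_integral_cmult) measurable
  finally show ?thesis .
qed

lemma nn_integral_restriction_le:
  assumes "f \<in> borel_measurable borel"
  shows "(\<integral>\<^sup>+ z. f z \<partial>\<sigma>) \<le> ennreal (1 / m) * (\<integral>\<^sup>+ z. f z \<partial>\<mu>)"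
  unfolding nn_integral_restriction[OF assms]
  by (intro mult_left_mono nn_integral_mono) (auto simp: indicator_def)

lemma restriction_on: "\<sigma> \<in> prob_measures_on E"
proof -
  have s: "sets \<sigma> = sets borel" by (simp add: normalized_restriction_def sets_\<mu>)
  have sp: "space \<sigma> = UNIV" using sets_eq_imp_space_eq[OF s] by simp
  have "(\<integral>\<^sup>+ z. 1 \<partial>\<sigma>) = ennreal (1 / m) * ennreal m"
    by (subst nn_integral_restriction) (auto simp: emeasure_eq_measure)
  also have "\<dots> = 1" using mass_bounds by (simp add: ennreal_mult[symmetric])
  finally have "prob_space \<sigma>" by (intro prob_spaceI) simp
  moreover have "emeasure \<sigma> (UNIV - E) = 0"
  proof -
    have Es: "E \<in> sets borel" using compact_imp_closed[OF E] by simp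
    have "emeasure \<sigma> (UNIV - E) = (\<integral>\<^sup>+ z. indicator (UNIV - E) z \<partial>\<sigma>)"
      using Es by (subst nn_integral_indicator) (auto simp: s)
    also have "\<dots> = ennreal (1 / m) * (\<integral>\<^sup>+ z. indicator (UNIV - E) z * indicator K z \<partial>\<mu>)"
      using Es by (intro nn_integral_restriction) auto
    also have "(\<integral>\<^sup>+ z. indicator (UNIV - E) z * indicator K z \<partial>\<mu>) = (\<integral>\<^sup>+ z. 0 \<partial>\<mu>)"
      using K(2) by (intro nn_integral_cong) (auto simp: indicator_def)
    finally show ?thesis by simp
  qed
  ultimately show ?thesis using s by (simp add: prob_measures_on_def)
qed

lemma bdd_prob_restriction: "bdd_prob \<sigma>" by (rule prob_measures_onD(2)[OF E restriction_on])

text \<open>Removing mass at most \<open>2 * \<eta>\<close> and renormalising each move the integral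
  of a function with values between 0 and 1 by at most \<open>2 * \<eta>\<close>.\<close>

lemma integral_restriction_near:
  assumes f: "continuous_on UNIV f" and f01: "\<And>z. 0 \<le> f z" "\<And>z. f z \<le> 1"
  shows "\<bar>integral\<^sup>L \<sigma> f - integral\<^sup>L \<mu> f\<bar> \<le> 4 * \<eta>"
proof -
  have [measurable]: "f \<in> borel_measurable borel" by (rule borel_measurable_continuous_onI[OF f])
  have i: "integrable \<mu> f" by (rule bdd_prob_integrable[OF bdd_prob_base f])
  have iK: "integrable \<mu> (\<lambda>z. indicator K z * f z)"
    using f01 by (intro integrable_const_bound[of _ 1]) (auto simp: indicator_def)
  have "integral\<^sup>L \<sigma> f = (LINT z|\<mu>. (indicator K z / m) *\<^sub>R f z)"
    unfolding normalized_restriction_def using mass_bounds by (intro integral_density) auto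
  also have "\<dots> = (LINT z|\<mu>. indicator K z * f z) / m" by simp
  finally have eq: "integral\<^sup>L \<sigma> f * m = (LINT z|\<mu>. indicator K z * f z)" using mass_bounds by (simp add: field_simps)
  have up: "(LINT z|\<mu>. indicator K z * f z) \<le> integral\<^sup>L \<mu> f"
    using f01 by (intro integral_mono iK i) (auto simp: indicator_def)
  have "integral\<^sup>L \<mu> f - (LINT z|\<mu>. indicator K z * f z) = (LINT z|\<mu>. f z - indicator K z * f z)"
    using i iK by simp
  also have "\<dots> \<le> (LINT z|\<mu>. 1 - indicator K z)"
  proof (rule integral_mono)
    show "integrable \<mu> (\<lambda>z. f z - indicator K z * f z)" using i iK by simp
    show "integrable \<mu> (\<lambda>z. 1 - indicator K z :: real)"
      by (intro Bochner_Integration.integrable_diff integrable_real_indicator) (auto simp: emeasure_eq_measure)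
  qed (use f01 in \<open>auto simp: indicator_def\<close>)
  also have "\<dots> = 1 - m"
  proof -
    have "integrable \<mu> (indicator K :: complex \<Rightarrow> real)"
      by (intro integrable_real_indicator) (auto simp: emeasure_eq_measure)
    then show ?thesis using prob_space by simp
  qed
  finally have lo: "integral\<^sup>L \<mu> f - (1 - m) \<le> integral\<^sup>L \<sigma> f * m" using eq by simp
  have "integral\<^sup>L \<sigma> f \<le> (LINT z|\<sigma>. 1)"
    using f01 bdd_prob_integrable[OF bdd_prob_restriction f]
      by (intro integral_mono) (auto intro!: finite_measure.integrable_const bdd_probD(4)[OF bdd_prob_restriction])
  also have "\<dots> = 1" using prob_space.prob_space[OF bdd_probD(3)[OF bdd_prob_restriction]] by simp
  finally have s1: "integral\<^sup>L \<sigma> f \<le> 1" .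
  have s0: "0 \<le> integral\<^sup>L \<sigma> f" using f01 by (intro integral_nonneg_AE) auto
  have mm: "1 - m \<le> 2 * \<eta>" using mK by simp
  have "integral\<^sup>L \<sigma> f * m \<le> integral\<^sup>L \<sigma> f" using s0 mass_bounds by (simp add: mult_left_le)
  then have 1: "integral\<^sup>L \<mu> f - integral\<^sup>L \<sigma> f \<le> 2 * \<eta>" using lo mm by linarith
  have "integral\<^sup>L \<sigma> f * (1 - m) \<le> 1 * (1 - m)" using s1 mass_bounds by (intro mult_right_mono) auto
  then have "integral\<^sup>L \<sigma> f - integral\<^sup>L \<sigma> f * m \<le> 2 * \<eta>" using mm by (simp add: algebra_simps)
  then have 2: "integral\<^sup>L \<sigma> f - integral\<^sup>L \<mu> f \<le> 2 * \<eta>" using up eq by linarith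
  show ?thesis using 1 2 \<eta> by linarith
qed

text \<open>A finite integral of the error at \<open>w\<close> excludes an atom at \<open>w\<close>
  and makes the logarithm a difference of two integrable functions. Dividing by the mass of
  \<open>K\<close> turns \<open>\<eta>\<close> into \<open>2 * \<eta>\<close>.\<close>

lemma restriction_tail:
  assumes \<delta>: "0 < \<delta>"
    and tail: "\<And>w. (\<integral>\<^sup>+ z. log_tail \<delta> (z - w) * indicator K z \<partial>\<mu>) \<le> ennreal \<eta>"
  shows "AE z in \<sigma>. z \<noteq> w"
    and "integrable \<sigma> (\<lambda>z. ln (cmod (z - w)))"
    and "- (LINT z|\<sigma>. log_kernel \<delta> (z - w)) \<le> (LINT z|\<sigma>. ln (cmod (z - w))) + 2 * \<eta>"
proof -
  have [measurable_cong]: "sets \<sigma> = sets borel" by (rule bdd_probD[OF bdd_prob_restriction])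
  have "(\<integral>\<^sup>+ z. log_tail \<delta> (z - w) \<partial>\<sigma>) \<le> ennreal (1 / m) * ennreal \<eta>"
    by (subst nn_integral_restriction) (measurable, intro mult_left_mono tail, simp)
  also have "\<dots> \<le> ennreal (2 * \<eta>)"
    using mass_bounds \<eta> by (subst ennreal_mult[symmetric]) (auto intro!: ennreal_leI simp: field_simps)
  finally have nn: "(\<integral>\<^sup>+ z. log_tail \<delta> (z - w) \<partial>\<sigma>) \<le> ennreal (2 * \<eta>)" .
  have "AE z in \<sigma>. log_tail \<delta> (z - w) \<noteq> \<infinity>"
    using nn by (intro nn_integral_PInf_AE) (measurable, auto simp: top_unique)
  then show ne: "AE z in \<sigma>. z \<noteq> w"
    by eventually_elim (auto simp: log_tail_def)
  define r where "r z = - log_kernel \<delta> (z - w) - ln (cmod (z - w))" for z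
  have [measurable]: "r \<in> borel_measurable borel" unfolding r_def log_kernel_def by measurable
  have r0: "AE z in \<sigma>. 0 \<le> r z"
    using ne
  proof eventually_elim
    case (elim z)
    then have "r z = ln (1 + \<delta> / (cmod (z - w))\<^sup>2) / 2"
      unfolding r_def by (intro log_tail_eq[OF \<delta>]) auto
    moreover have "0 \<le> ln (1 + \<delta> / (cmod (z - w))\<^sup>2)" using \<delta> by (intro ln_ge_zero) simp
    ultimately show ?case by simp
  qed
  have nnr: "(\<integral>\<^sup>+ z. ennreal (r z) \<partial>\<sigma>) \<le> ennreal (2 * \<eta>)"
  proof -
    have "(\<integral>\<^sup>+ z. ennreal (r z) \<partial>\<sigma>) = (\<integral>\<^sup>+ z. log_tail \<delta> (z - w) \<partial>\<sigma>)"
      using ne by (intro nn_integral_cong_AE, eventually_elim) (auto simp: log_tail_def r_def)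
    then show ?thesis using nn by simp
  qed
  have ir: "integrable \<sigma> r"
    by (rule integrableI_nonneg) (use r0 nnr in \<open>auto intro: le_less_trans\<close>)
  have il: "integrable \<sigma> (\<lambda>z. log_kernel \<delta> (z - w))"
    by (rule bdd_prob_integrable[OF bdd_prob_restriction], rule continuous_on_compose2[OF continuous_log_kernel[OF \<delta>]])
       (auto intro!: continuous_intros)
  have "(\<lambda>z. ln (cmod (z - w))) = (\<lambda>z. - log_kernel \<delta> (z - w) - r z)" by (simp add: r_def)
  then show "integrable \<sigma> (\<lambda>z. ln (cmod (z - w)))" using ir il by simp
  have "ennreal (integral\<^sup>L \<sigma> r) \<le> ennreal (2 * \<eta>)"
    using nnr nn_integral_eq_integral[OF ir r0] by simp
  then have "integral\<^sup>L \<sigma> r \<le> 2 * \<eta>" using \<eta> by (simp add: ennreal_le_iff)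
  moreover have "(LINT z|\<sigma>. ln (cmod (z - w))) = - (LINT z|\<sigma>. log_kernel \<delta> (z - w)) - integral\<^sup>L \<sigma> r"
    unfolding \<open>(\<lambda>z. ln (cmod (z - w))) = (\<lambda>z. - log_kernel \<delta> (z - w) - r z)\<close> using ir il by simp
  ultimately show "- (LINT z|\<sigma>. log_kernel \<delta> (z - w)) \<le> (LINT z|\<sigma>. ln (cmod (z - w))) + 2 * \<eta>"
    by simp
qed

text \<open>Energy is not monotone under restriction, because the kernel may change sign. Once
  \<open>c\<close> makes it nonnegative on the support, the double integral can only shrink, and the
  two normalisations cost \<open>1 / m^2\<close>.\<close>

lemma restriction_energy:
  assumes \<delta>: "0 < \<delta>" and R: "\<And>z. z \<in> E \<Longrightarrow> cmod z \<le> R"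
    and c: "\<And>x. cmod x \<le> R + R \<Longrightarrow> 0 \<le> log_kernel \<delta> x + c"
    and le: "mutual_energy (log_kernel \<delta>) \<mu> \<mu> \<le> \<gamma>"
  shows "mutual_energy (log_kernel \<delta>) \<sigma> \<sigma> \<le> (\<gamma> + c) / (1 - 2 * \<eta>)\<^sup>2 - c"
proof -
  have [measurable_cong]: "sets \<sigma> = sets borel" by (rule bdd_probD[OF bdd_prob_restriction])
  have R\<mu>: "AE z in \<mu>. cmod z \<le> R" using AE_base by eventually_elim (rule R)
  have R\<sigma>: "AE z in \<sigma>. cmod z \<le> R" using prob_measures_onD(1)[OF E restriction_on] by eventually_elim (rule R)
  have cl: "continuous_on UNIV (log_kernel \<delta>)" by (rule continuous_log_kernel[OF \<delta>])
  let ?k = "\<lambda>x. log_kernel \<delta> x + c"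
  have ck: "continuous_on UNIV ?k" by (intro continuous_intros cl)
  have [measurable]: "?k \<in> borel_measurable borel" by (rule borel_measurable_continuous_onI[OF ck])
  have km[measurable]: "(\<lambda>w. ennreal (?k (z - w))) \<in> borel_measurable borel" for z by measurable
  have km2[measurable]: "(\<lambda>z. \<integral>\<^sup>+ w. ennreal (?k (z - w)) \<partial>\<mu>) \<in> borel_measurable borel" by measurable
  have km3[measurable]: "(\<lambda>z. \<integral>\<^sup>+ w. ennreal (?k (z - w)) \<partial>\<sigma>) \<in> borel_measurable borel"
  proof -
    interpret \<sigma>: prob_space \<sigma> by (rule bdd_probD[OF bdd_prob_restriction])
    show ?thesis by measurable
  qed
  have "ennreal (mutual_energy ?k \<sigma> \<sigma>) = (\<integral>\<^sup>+ z. \<integral>\<^sup>+ w. ennreal (?k (z - w)) \<partial>\<sigma> \<partial>\<sigma>)"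
    by (rule nn_mutual_energy[OF bdd_prob_restriction bdd_prob_restriction ck R\<sigma> R\<sigma> c, symmetric])
  also have "\<dots> \<le> (\<integral>\<^sup>+ z. ennreal (1 / m) * (\<integral>\<^sup>+ w. ennreal (?k (z - w)) \<partial>\<mu>) \<partial>\<sigma>)"
    by (intro nn_integral_mono nn_integral_restriction_le km)
  also have "\<dots> = ennreal (1 / m) * (\<integral>\<^sup>+ z. (\<integral>\<^sup>+ w. ennreal (?k (z - w)) \<partial>\<mu>) \<partial>\<sigma>)"
    by (rule nn_integral_cmult) measurable
  also have "\<dots> \<le> ennreal (1 / m) * (ennreal (1 / m) * (\<integral>\<^sup>+ z. (\<integral>\<^sup>+ w. ennreal (?k (z - w)) \<partial>\<mu>) \<partial>\<mu>))"
    by (intro mult_left_mono nn_integral_restriction_le km2) simp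
  also have "(\<integral>\<^sup>+ z. (\<integral>\<^sup>+ w. ennreal (?k (z - w)) \<partial>\<mu>) \<partial>\<mu>) = ennreal (mutual_energy ?k \<mu> \<mu>)"
    by (rule nn_mutual_energy[OF bdd_prob_base bdd_prob_base ck R\<mu> R\<mu> c])
  also have "\<dots> \<le> ennreal (\<gamma> + c)"
    using le by (intro ennreal_leI) (simp add: mutual_energy_add[OF bdd_prob_base bdd_prob_base cl] mutual_energy_const[OF bdd_prob_base bdd_prob_base])
  finally have *: "ennreal (mutual_energy ?k \<sigma> \<sigma>) \<le> ennreal (1 / m) * (ennreal (1 / m) * ennreal (\<gamma> + c))"
    by (simp add: mult_left_mono)
  have "0 \<le> mutual_energy ?k \<mu> \<mu>"
    using mutual_energy_mono[OF bdd_prob_base bdd_prob_base continuous_on_const ck R\<mu> R\<mu> c] by (simp add: mutual_energy_const[OF bdd_prob_base bdd_prob_base])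
  then have gc: "0 \<le> \<gamma> + c" using le by (simp add: mutual_energy_add[OF bdd_prob_base bdd_prob_base cl] mutual_energy_const[OF bdd_prob_base bdd_prob_base])
  have "mutual_energy ?k \<sigma> \<sigma> \<le> 1 / m * (1 / m * (\<gamma> + c))"
    using * gc mass_bounds by (subst (asm) ennreal_mult[symmetric], simp, simp, subst (asm) ennreal_mult[symmetric], simp, simp, subst (asm) ennreal_le_iff) auto
  also have "\<dots> = (\<gamma> + c) / m\<^sup>2" by (simp add: power2_eq_square)
  also have "\<dots> \<le> (\<gamma> + c) / (1 - 2 * \<eta>)\<^sup>2"
    using gc mK \<eta> by (intro divide_left_mono power_mono) auto
  finally show ?thesis by (simp add: mutual_energy_add[OF bdd_prob_restriction bdd_prob_restriction cl] mutual_energy_const[OF bdd_prob_restriction bdd_prob_restriction])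
qed

end

section \<open>Convergence from growth conditions\<close>

lemma log_kernel_upper: "0 < \<delta> \<Longrightarrow> log_kernel \<delta> x \<le> - ln \<delta> / 2"
  by (simp add: log_kernel_def) (subst ln_le_cancel_iff, auto intro: add_nonneg_pos)

text \<open>On the disc of radius \<open>R\<close> the net and the Lipschitz bound keep the
  potential of the zeros below \<open>\<gamma> + 3 * \<epsilon>\<close>. Outside only the trivial
  bound \<open>- ln \<delta> / 2\<close> is known, but there the potential of
  \<open>\<sigma>\<close> is below \<open>- ln (R / 2)\<close>, so a correction built from it,
  nonnegative everywhere, covers the deficit. Integrated over the zeros, the correction is a cross
  energy divided by \<open>ln (R / 2)\<close>, which is bounded through
  \<open>cross\<close>.\<close>

lemma root_self_energy_le:
  assumes deg: "0 < degree p" and \<sigma>: "bdd_prob \<sigma>" and \<delta>: "0 < \<delta>" "\<delta> \<le> 1"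
    and R0: "AE z in \<sigma>. cmod z \<le> R0" and R: "2 * R0 \<le> R" "2 < R" and \<epsilon>: "0 < \<epsilon>"
    and net: "\<And>z. cmod z \<le> R \<Longrightarrow> \<exists>q. cmod (z - q) \<le> \<epsilon> * sqrt \<delta> \<and> poly p q \<noteq> 0 \<and>
        (ln (cmod (lead_coeff p)) - ln (cmod (poly p q))) / degree p \<le> \<gamma> + 2 * \<epsilon>"
    and cross: "- B \<le> mutual_energy (log_kernel \<delta>) (root_measure p) \<sigma>"
  shows "mutual_energy (log_kernel \<delta>) (root_measure p) (root_measure p)
    \<le> \<gamma> + 3 * \<epsilon> + (\<bar>\<gamma> + 3 * \<epsilon>\<bar> + \<bar>ln \<delta> / 2\<bar>) * (B - ln \<delta> / 2) / ln (R / 2)"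
proof -
  let ?\<tau> = "root_measure p"
  note \<tau> = bdd_prob_root_measure[OF deg]
  interpret \<tau>: prob_space ?\<tau> by (rule bdd_probD[OF \<tau>])
  interpret \<sigma>: prob_space \<sigma> by (rule bdd_probD[OF \<sigma>])
  \<comment> \<open>Large enough for
    \<open>- ln \<delta> / 2 \<le> \<gamma> + 3 * \<epsilon> + M\<close>, the deficit of the trivial
    bound.\<close>
  define M where "M = \<bar>\<gamma> + 3 * \<epsilon>\<bar> + \<bar>ln \<delta> / 2\<bar>"
  define pot where "pot z = (LINT w|?\<tau>. log_kernel \<delta> (z - w))" for z
  define \<phi> where "\<phi> z = (LINT w|\<sigma>. log_kernel \<delta> (z - w))" for z
  have cpot: "continuous_on UNIV pot" and c\<phi>: "continuous_on UNIV \<phi>"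
    unfolding pot_def \<phi>_def by (rule potential_continuous \<tau> \<sigma> \<delta>)+
  have il: "integrable \<alpha> (\<lambda>w. log_kernel \<delta> (z - w))" if "bdd_prob \<alpha>" for \<alpha> z
    by (rule kernel_integrable[OF that continuous_log_kernel[OF \<delta>(1)]])
  have potup: "(LINT w|\<alpha>. log_kernel \<delta> (z - w)) \<le> - ln \<delta> / 2" if \<alpha>: "bdd_prob \<alpha>" for \<alpha> z
  proof -
    interpret \<alpha>: prob_space \<alpha> by (rule bdd_probD[OF \<alpha>])
    have "(LINT w|\<alpha>. log_kernel \<delta> (z - w)) \<le> (LINT w|\<alpha>. - ln \<delta> / 2)"
      by (intro integral_mono il[OF \<alpha>] log_kernel_upper \<delta>) simp
    then show ?thesis by (simp add: \<alpha>.prob_space)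
  qed
  have lR: "0 < ln (R / 2)" using R by simp
  have l\<delta>: "ln \<delta> \<le> 0" using \<delta> by simp
  have M0: "0 \<le> M" by (simp add: M_def)
  have key: "pot z \<le> \<gamma> + 3 * \<epsilon> + M * (- \<phi> z - ln \<delta> / 2) / ln (R / 2)" for z
  proof (cases "cmod z \<le> R")
    case True
    obtain q where q: "cmod (z - q) \<le> \<epsilon> * sqrt \<delta>" "poly p q \<noteq> 0"
      "(ln (cmod (lead_coeff p)) - ln (cmod (poly p q))) / degree p \<le> \<gamma> + 2 * \<epsilon>"
      using net[OF True] by blast
    have "pot z \<le> pot q + cmod (z - q) / sqrt \<delta>"
      using potential_lipschitz[OF \<tau> \<delta>(1), of z q] unfolding pot_def by linarith
    also have "cmod (z - q) / sqrt \<delta> \<le> \<epsilon>" using q(1) \<delta> by (simp add: divide_le_eq)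
    also have "pot q \<le> \<gamma> + 2 * \<epsilon>"
      using root_potential_le[OF deg q(2) \<delta>(1)] q(3) unfolding pot_def by linarith
    finally have "pot z \<le> \<gamma> + 3 * \<epsilon>" by simp
    moreover have "0 \<le> M * (- \<phi> z - ln \<delta> / 2) / ln (R / 2)"
      using potup[OF \<sigma>, of z] M0 lR unfolding \<phi>_def by (intro divide_nonneg_pos mult_nonneg_nonneg) auto
    ultimately show ?thesis by linarith
  next
    case False
    have "\<phi> z \<le> (LINT w|\<sigma>. - ln (R / 2))"
      unfolding \<phi>_def
    proof (rule integral_mono_AE[OF il[OF \<sigma>]])
      show "AE w in \<sigma>. log_kernel \<delta> (z - w) \<le> - ln (R / 2)"
        using R0
      proof eventually_elim
        case (elim w)
        have far: "R / 2 \<le> cmod (z - w)" using norm_triangle_ineq2[of z w] elim False R by linarith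
        then have "z - w \<noteq> 0" using R by auto
        then have "log_kernel \<delta> (z - w) \<le> - ln (cmod (z - w))" by (rule log_kernel_le_ln[OF \<delta>(1)])
        also have "\<dots> \<le> - ln (R / 2)"
        proof -
          have "ln (R / 2) \<le> ln (cmod (z - w))"
            by (subst ln_le_cancel_iff) (use far R in linarith)+
          then show ?thesis by simp
        qed
        finally show ?case .
      qed
    qed simp
    then have "ln (R / 2) \<le> - \<phi> z - ln \<delta> / 2" using l\<delta> by (simp add: \<sigma>.prob_space)
    then have "1 \<le> (- \<phi> z - ln \<delta> / 2) / ln (R / 2)" using lR by simp
    then have "M * 1 \<le> M * ((- \<phi> z - ln \<delta> / 2) / ln (R / 2))" by (rule mult_left_mono[OF _ M0])
    moreover have "pot z \<le> - ln \<delta> / 2" unfolding pot_def by (rule potup[OF \<tau>])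
    moreover have "- ln \<delta> / 2 \<le> \<gamma> + 3 * \<epsilon> + M" unfolding M_def by linarith
    ultimately show ?thesis by simp
  qed
  have "mutual_energy (log_kernel \<delta>) ?\<tau> ?\<tau> = (LINT z|?\<tau>. pot z)" by (simp add: mutual_energy_def pot_def)
  also have "\<dots> \<le> (LINT z|?\<tau>. \<gamma> + 3 * \<epsilon> + M * (- \<phi> z - ln \<delta> / 2) / ln (R / 2))"
    by (intro integral_mono key bdd_prob_integrable[OF \<tau>] cpot continuous_intros c\<phi>) (use lR in auto)
  also have "\<dots> = \<gamma> + 3 * \<epsilon> + M * (- (LINT z|?\<tau>. \<phi> z) - ln \<delta> / 2) / ln (R / 2)"
    using bdd_prob_integrable[OF \<tau> c\<phi>] by (simp add: \<tau>.prob_space)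
  also have "(LINT z|?\<tau>. \<phi> z) = mutual_energy (log_kernel \<delta>) ?\<tau> \<sigma>" by (simp add: mutual_energy_def \<phi>_def)
  also have "\<gamma> + 3 * \<epsilon> + M * (- mutual_energy (log_kernel \<delta>) ?\<tau> \<sigma> - ln \<delta> / 2) / ln (R / 2)
      \<le> \<gamma> + 3 * \<epsilon> + M * (B - ln \<delta> / 2) / ln (R / 2)"
    using cross M0 lR by (intro add_left_mono divide_right_mono mult_left_mono) auto
  finally show ?thesis unfolding M_def .
qed

lemma ln_quotient_le:
  assumes "0 < n" "0 < x" "0 < y" "x \<le> exp (s * real n)" "exp (t * real n) \<le> y"
  shows "(ln x - ln y) / real n \<le> s - t"
proof -
  have "ln x \<le> s * real n" using assms by (metis ln_exp ln_le_cancel_iff exp_gt_zero)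
  moreover have "t * real n \<le> ln y" using assms by (metis ln_exp ln_le_cancel_iff exp_gt_zero)
  ultimately have "ln x - ln y \<le> (s - t) * real n" by (simp add: algebra_simps)
  then show ?thesis using assms(1) by (simp add: divide_le_eq)
qed

text \<open>The deterministic core. The choices are made in the order \<open>\<eta>\<close>, then
  \<open>K\<close> and \<open>\<delta>\<close>, then the radius \<open>R\<close> and the finite net,
  and only then \<open>n\<close>: \<open>R\<close> must beat a constant that involves
  \<open>ln \<delta>\<close>, and the mesh of the net is proportional to
  \<open>sqrt \<delta>\<close>.\<close>

theorem zeros_weak_conv_of_growth:
  fixes P :: "nat \<Rightarrow> complex poly"
  assumes E: "compact E" and cap: "0 < log_capacity E"
    and deg: "\<forall>\<^sub>F n in sequentially. degree (P n) = n"
    and up: "\<And>\<epsilon>. 0 < \<epsilon> \<Longrightarrow> \<forall>\<^sub>F n in sequentially. \<forall>z\<in>E. cmod (poly (P n) z) \<le> exp (\<epsilon> * real n)"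
    and lead: "\<And>\<epsilon>. 0 < \<epsilon> \<Longrightarrow> \<forall>\<^sub>F n in sequentially.
        exp ((- ln (log_capacity E) - \<epsilon>) * real n) \<le> cmod (lead_coeff (P n)) \<and>
        cmod (lead_coeff (P n)) \<le> exp ((- ln (log_capacity E) + \<epsilon>) * real n)"
    and dense: "closure Q = UNIV"
    and low: "\<And>q \<epsilon>. q \<in> Q \<Longrightarrow> 0 < \<epsilon> \<Longrightarrow> \<forall>\<^sub>F n in sequentially. exp (- \<epsilon> * real n) \<le> cmod (poly (P n) q)"
  shows "zeros_weak_conv P (equilibrium_measure E)"
proof -
  define \<mu> where "\<mu> = equilibrium_measure E"
  obtain \<gamma> where "log_capacity E = exp (- \<gamma>)" and \<mu>: "\<mu> \<in> prob_measures_on E"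
    and le\<gamma>: "\<And>\<delta>. 0 < \<delta> \<Longrightarrow> mutual_energy (log_kernel \<delta>) \<mu> \<mu> \<le> \<gamma>"
    and lim\<gamma>: "(\<lambda>n. mutual_energy (log_kernel (1 / Suc n)) \<mu> \<mu>) \<longlonglongrightarrow> \<gamma>"
    using equilibrium_measure_exists[OF E cap] unfolding \<mu>_def by blast
  then have \<gamma>: "- ln (log_capacity E) = \<gamma>" by simp
  note lead = lead[unfolded \<gamma>]
  note b\<mu> = prob_measures_onD(2)[OF E \<mu>]
  obtain R0' where R0': "\<And>z. z \<in> E \<Longrightarrow> cmod z \<le> R0'"
    using compact_imp_bounded[OF E] by (auto simp: bounded_iff)
  define R0 where "R0 = max R0' 0"
  have R0: "\<And>z. z \<in> E \<Longrightarrow> cmod z \<le> R0" "0 \<le> R0" using R0' by (auto simp: R0_def intro: max.coboundedI1)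
  define c where "c = ln (2 * R0 + 1)"
  have c: "0 \<le> log_kernel \<delta> x + c" if "0 < \<delta>" "\<delta> \<le> 1" and x: "cmod x \<le> R0 + R0" for \<delta> x
  proof -
    have "(cmod x)\<^sup>2 \<le> (2 * R0)\<^sup>2" using x by (intro power_mono) auto
    then have "(cmod x)\<^sup>2 + \<delta> \<le> (2 * R0 + 1)\<^sup>2"
      using that R0(2) unfolding power2_eq_square distrib_left distrib_right by linarith
    then have "ln ((cmod x)\<^sup>2 + \<delta>) \<le> ln ((2 * R0 + 1)\<^sup>2)"
      using that R0(2) by (subst ln_le_cancel_iff) (auto intro!: add_nonneg_pos)
    also have "\<dots> = 2 * c" using R0(2) by (simp add: c_def ln_realpow)
    finally show ?thesis by (simp add: log_kernel_def)
  qed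
  \<comment> \<open>For the finitely many exceptional \<open>n\<close> the zero measure is replaced
    by the limit itself, so that every \<open>\<tau> n\<close> is a probability measure of bounded
    support.\<close>
  define \<tau> where "\<tau> n = (if degree (P n) = n \<and> 0 < n then root_measure (P n) else \<mu>)" for n
  have \<tau>: "bdd_prob (\<tau> n)" for n using b\<mu> bdd_prob_root_measure[of "P n"] by (auto simp: \<tau>_def)
  have G: "(\<lambda>n. LINT z|\<tau> n. gauss s (z - a)) \<longlonglongrightarrow> (LINT z|\<mu>. gauss s (z - a))" if s: "0 < s" for s a
  proof (rule LIMSEQ_I)
    fix e :: real assume e: "0 < e"
    \<comment> \<open>Error budget: \<open>2 * (e^2 / 32)\<close> from the averaging and
      \<open>\<kappa> / c1 = e^2 / 16\<close> from the distance add up to \<open>e^2 / 8\<close>,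
      which is less than \<open>(e / 2)^2\<close>.\<close>
    then obtain c1 where c1: "0 < c1" and Gc: "\<And>\<mu> \<nu>. bdd_prob \<mu> \<Longrightarrow> bdd_prob \<nu> \<Longrightarrow>
        energy_dist (gauss s) \<mu> \<nu> \<le> 2 * (e\<^sup>2 / 32) + energy_dist (log_kernel 1) \<mu> \<nu> / c1"
      using gauss_le_of_log_kernel_dist[OF s, of "e\<^sup>2 / 32"] by auto
    define \<kappa> where "\<kappa> = c1 * e\<^sup>2 / 16"
    have \<kappa>: "0 < \<kappa>" using c1 e by (simp add: \<kappa>_def)
    \<comment> \<open>The bound on the energy of the restriction tends to \<open>\<gamma>\<close> as
      \<open>\<eta>\<close> tends to 0. The shift \<open>c\<close> serves all
      \<open>\<delta> \<le> 1\<close>, which matters because \<open>\<delta>\<close> is known only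
      after \<open>\<eta>\<close>.\<close>
    have "((\<lambda>\<eta>. (\<gamma> + c) / (1 - 2 * \<eta>)\<^sup>2 - c) \<longlongrightarrow> (\<gamma> + c) / (1 - 2 * 0)\<^sup>2 - c) (at_right 0)"
      by (intro tendsto_intros) auto
    then have "\<forall>\<^sub>F \<eta> in at_right 0. (\<gamma> + c) / (1 - 2 * \<eta>)\<^sup>2 - c < \<gamma> + \<kappa> / 4"
      using \<kappa> by (intro order_tendstoD) auto
    moreover have "\<forall>\<^sub>F \<eta> in at_right (0::real). 0 < \<eta>" by (simp add: eventually_at_right_less)
    moreover have "\<forall>\<^sub>F \<eta> in at_right (0::real). \<eta> < min (1/4) (min (e/16) (\<kappa>/64))"
      using e \<kappa> by (intro eventually_at_rightI[of 0 "min (1/4) (min (e/16) (\<kappa>/64))"]) auto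
    ultimately have "\<forall>\<^sub>F \<eta> in at_right (0::real). (\<gamma> + c) / (1 - 2 * \<eta>)\<^sup>2 - c < \<gamma> + \<kappa> / 4 \<and> 0 < \<eta> \<and>
        \<eta> < min (1/4) (min (e/16) (\<kappa>/64))"
      by eventually_elim auto
    then obtain \<eta> where eta: "(\<gamma> + c) / (1 - 2 * \<eta>)\<^sup>2 - c < \<gamma> + \<kappa> / 4" "0 < \<eta>" "\<eta> < 1/4" "\<eta> < e/16" "\<eta> < \<kappa>/64"
      using eventually_happens'[OF trivial_limit_at_right_real] by force
    obtain K \<delta> where K: "compact K" "K \<subseteq> E" "1 - 2 * \<eta> \<le> measure \<mu> K" and \<delta>: "0 < \<delta>" "\<delta> \<le> 1"
      and tail: "\<And>w. (\<integral>\<^sup>+ z. log_tail \<delta> (z - w) * indicator K z \<partial>\<mu>) \<le> ennreal \<eta>"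
      using regular_restriction[OF E \<mu> le\<gamma> lim\<gamma> eta(2)] eta(3) by auto
    interpret restriction E \<mu> K \<eta> by unfold_locales (use E \<mu> K eta in auto)
    \<comment> \<open>The final distance is at most
      \<open>8 * \<epsilon> + 4 * \<eta> + \<kappa> / 4\<close>; with \<open>\<epsilon>\<close>
      equal to \<open>\<kappa> / 64\<close> and \<open>\<eta>\<close> below it, this stays under
      \<open>\<kappa>\<close>.\<close>
    define \<epsilon> where "\<epsilon> = \<kappa> / 64"
    have \<epsilon>: "0 < \<epsilon>" using \<kappa> by (simp add: \<epsilon>_def)
    \<comment> \<open>The upper bound on \<open>E\<close> and the leading coefficient contribute
      \<open>\<epsilon>\<close> each, the smoothing error of the restriction
      \<open>2 * \<eta>\<close>.\<close>
    define B where "B = - \<gamma> + 2 * \<epsilon> + 2 * \<eta>"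
    define C where "C = (\<bar>\<gamma> + 3 * \<epsilon>\<bar> + \<bar>ln \<delta> / 2\<bar>) * (B - ln \<delta> / 2)"
    have "((\<lambda>R. C / ln (R / 2)) \<longlongrightarrow> 0) at_top" by real_asymp
    then have "\<forall>\<^sub>F R in at_top. C / ln (R / 2) < \<epsilon>" using \<epsilon> by (rule order_tendstoD)
    moreover have "\<forall>\<^sub>F R in at_top. max 3 (2 * R0) \<le> R" by (rule eventually_ge_at_top)
    ultimately have "\<forall>\<^sub>F R in at_top. C / ln (R / 2) < \<epsilon> \<and> max 3 (2 * R0) \<le> R" by eventually_elim auto
    then obtain R where R: "C / ln (R / 2) < \<epsilon>" "2 * R0 \<le> R" "2 < R"
      using eventually_happens'[OF trivial_limit_at_top_linorder] by force
    have cov: "cball 0 R \<subseteq> (\<Union>q\<in>Q. ball q (\<epsilon> * sqrt \<delta>))"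
    proof
      fix z :: complex
      have "z \<in> closure Q" using dense by simp
      moreover have "0 < \<epsilon> * sqrt \<delta>" using \<epsilon> \<delta> by simp
      ultimately obtain q where "q \<in> Q" "dist q z < \<epsilon> * sqrt \<delta>"
        unfolding closure_approachable by blast
      then show "z \<in> (\<Union>q\<in>Q. ball q (\<epsilon> * sqrt \<delta>))" by auto
    qed
    obtain N where N: "N \<subseteq> Q" "finite N" "cball 0 R \<subseteq> (\<Union>q\<in>N. ball q (\<epsilon> * sqrt \<delta>))"
      using compactE_image[OF compact_cball _ cov] by auto
    have "\<forall>\<^sub>F n in sequentially. \<forall>q\<in>N. exp (- \<epsilon> * real n) \<le> cmod (poly (P n) q)"
      using N low[OF _ \<epsilon>] by (intro eventually_ball_finite) auto
    moreover note up[OF \<epsilon>] lead[OF \<epsilon>] deg eventually_gt_at_top[of 0]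
    ultimately have "\<forall>\<^sub>F n in sequentially. norm ((LINT z|\<tau> n. gauss s (z - a)) - (LINT z|\<mu>. gauss s (z - a))) < e"
    proof eventually_elim
      case (elim n)
      have dn: "degree (P n) = n" and n0: "0 < n" using elim by auto
      have dp: "0 < degree (P n)" using dn n0 by simp
      have \<tau>n: "\<tau> n = root_measure (P n)" using dn n0 by (simp add: \<tau>_def)
      have lc0: "0 < cmod (lead_coeff (P n))" using dp by auto
      have "- (- \<gamma> + 2 * \<epsilon>) - 2 * \<eta> \<le> mutual_energy (log_kernel \<delta>) (root_measure (P n)) \<sigma>"
      proof (rule mutual_energy_root_ge[OF dp bdd_prob_restriction \<delta>(1) restriction_tail(2)[OF \<delta>(1) tail]
            restriction_tail(3)[OF \<delta>(1) tail] restriction_tail(1)[OF \<delta>(1) tail]])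
        show "AE z in \<sigma>. poly (P n) z \<noteq> 0 \<longrightarrow>
            (ln (cmod (poly (P n) z)) - ln (cmod (lead_coeff (P n)))) / real (degree (P n)) \<le> - \<gamma> + 2 * \<epsilon>"
          using prob_measures_onD(1)[OF E restriction_on]
        proof eventually_elim
          case (elim z)
          show ?case
          proof
            assume "poly (P n) z \<noteq> 0"
            then have "(ln (cmod (poly (P n) z)) - ln (cmod (lead_coeff (P n)))) / real n \<le> \<epsilon> - (\<gamma> - \<epsilon>)"
              using elim \<open>\<forall>z\<in>E. cmod (poly (P n) z) \<le> exp (\<epsilon> * real n)\<close>
                \<open>exp ((\<gamma> - \<epsilon>) * real n) \<le> cmod (lead_coeff (P n)) \<and> _\<close>
              by (intro ln_quotient_le n0 lc0) auto
            then show "(ln (cmod (poly (P n) z)) - ln (cmod (lead_coeff (P n)))) / real (degree (P n)) \<le> - \<gamma> + 2 * \<epsilon>"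
              by (simp add: dn)
          qed
        qed
      qed
      then have cross: "- B \<le> mutual_energy (log_kernel \<delta>) (\<tau> n) \<sigma>" by (simp add: B_def \<tau>n)
      have "mutual_energy (log_kernel \<delta>) (root_measure (P n)) (root_measure (P n))
          \<le> \<gamma> + 3 * \<epsilon> + (\<bar>\<gamma> + 3 * \<epsilon>\<bar> + \<bar>ln \<delta> / 2\<bar>) * (B - ln \<delta> / 2) / ln (R / 2)"
      proof (rule root_self_energy_le[OF dp bdd_prob_restriction \<delta> _ R(2,3) \<epsilon>])
        show "AE z in \<sigma>. cmod z \<le> R0"
          using prob_measures_onD(1)[OF E restriction_on] by eventually_elim (rule R0)
        show "- B \<le> mutual_energy (log_kernel \<delta>) (root_measure (P n)) \<sigma>" using cross by (simp add: \<tau>n)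
        fix z assume "cmod z \<le> R"
        then have "z \<in> cball 0 R" by simp
        then obtain q where q: "q \<in> N" "dist q z < \<epsilon> * sqrt \<delta>" using N(3) by (auto simp: subset_iff)
        have qlow: "exp (- \<epsilon> * real n) \<le> cmod (poly (P n) q)" using elim q(1) by blast
        then have pq: "0 < cmod (poly (P n) q)" by (rule less_le_trans[OF exp_gt_zero])
        have "(ln (cmod (lead_coeff (P n))) - ln (cmod (poly (P n) q))) / real n \<le> (\<gamma> + \<epsilon>) - (- \<epsilon>)"
          using elim qlow by (intro ln_quotient_le n0 lc0 pq) auto
        then show "\<exists>q. cmod (z - q) \<le> \<epsilon> * sqrt \<delta> \<and> poly (P n) q \<noteq> 0 \<and>
            (ln (cmod (lead_coeff (P n))) - ln (cmod (poly (P n) q))) / real (degree (P n)) \<le> \<gamma> + 2 * \<epsilon>"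
          using q(2) pq by (intro exI[of _ q]) (auto simp: dn dist_norm norm_minus_commute)
      qed
      then have self: "mutual_energy (log_kernel \<delta>) (\<tau> n) (\<tau> n) \<le> \<gamma> + 4 * \<epsilon>"
        using R(1) by (simp add: C_def \<tau>n)
      have "mutual_energy (log_kernel \<delta>) \<sigma> \<sigma> \<le> (\<gamma> + c) / (1 - 2 * \<eta>)\<^sup>2 - c"
        by (rule restriction_energy[OF \<delta>(1) R0(1) c[OF \<delta>] le\<gamma>[OF \<delta>(1)]])
      then have "energy_dist (log_kernel \<delta>) (\<tau> n) \<sigma> \<le> \<kappa>"
        using self cross eta unfolding energy_dist_def B_def \<epsilon>_def by linarith
      then have "energy_dist (log_kernel 1) (\<tau> n) \<sigma> \<le> \<kappa>"
        using energy_dist_log_kernel_antimono[OF \<tau>[of n] bdd_prob_restriction \<delta>] by linarith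
      then have "energy_dist (log_kernel 1) (\<tau> n) \<sigma> / c1 \<le> e\<^sup>2 / 16"
        using c1 by (simp add: \<kappa>_def field_simps)
      then have "energy_dist (gauss s) (\<tau> n) \<sigma> \<le> e\<^sup>2 / 8"
        using Gc[OF \<tau>[of n] bdd_prob_restriction] by linarith
      then have "((LINT z|\<tau> n. gauss s (z - a)) - (LINT z|\<sigma>. gauss s (z - a)))\<^sup>2 \<le> e\<^sup>2 / 8"
        using integral_gauss_diff_le[OF \<tau>[of n] bdd_prob_restriction, of s a] s by linarith
      also have "\<dots> < (e / 2)\<^sup>2" using e by (simp add: power2_eq_square)
      finally have 1: "\<bar>(LINT z|\<tau> n. gauss s (z - a)) - (LINT z|\<sigma>. gauss s (z - a))\<bar> < e / 2"
        using e by (metis abs_le_square_iff abs_of_pos half_gt_zero not_le)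
      have "continuous_on UNIV (\<lambda>z. gauss s (z - a))" unfolding gauss_def by (intro continuous_intros)
      from integral_restriction_near[OF this] have 2: "\<bar>(LINT z|\<sigma>. gauss s (z - a)) - (LINT z|\<mu>. gauss s (z - a))\<bar> \<le> 4 * \<eta>"
        using s by (simp add: gauss_def)
      show ?case using 1 2 eta(4) unfolding real_norm_def by linarith
    qed
    then show "\<exists>no. \<forall>n\<ge>no. norm ((LINT z|\<tau> n. gauss s (z - a)) - (LINT z|\<mu>. gauss s (z - a))) < e"
      by (simp add: eventually_sequentially)
  qed
  show ?thesis
    unfolding zeros_weak_conv_def \<mu>_def[symmetric]
  proof (intro allI impI)
    fix f :: "complex \<Rightarrow> real" assume f: "continuous_on UNIV f" "bounded (range f)"
    have "(\<lambda>n. integral\<^sup>L (\<tau> n) f) \<longlonglongrightarrow> integral\<^sup>L \<mu> f"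
      by (rule weak_convergence_of_gauss[OF \<tau> b\<mu> G f])
    moreover have "\<forall>\<^sub>F n in sequentially. integral\<^sup>L (\<tau> n) f = zero_count_integral n (P n) f"
      using deg eventually_gt_at_top[of 0]
    proof eventually_elim
      case (elim n)
      then show ?case using zero_count_integral_root_measure[of "P n" n f] f(1) by (simp add: \<tau>_def)
    qed
    ultimately show "(\<lambda>n. zero_count_integral n (P n) f) \<longlonglongrightarrow> integral\<^sup>L \<mu> f"
      by (rule Lim_transform_eventually)
  qed
qed

section \<open>Almost sure growth of the coefficients\<close>

text \<open>The step function with value \<open>c n\<close> on \<open>I n\<close> lies below
  \<open>F\<close>, so its integral, which is the series, is at most that of
  \<open>F\<close>.\<close>

lemma summable_step_bound:
  fixes c l :: "nat \<Rightarrow> real" and I :: "nat \<Rightarrow> real set" and F :: "real \<Rightarrow> ennreal"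
  assumes c: "\<And>n. 0 \<le> c n" and l: "\<And>n. 0 \<le> l n"
    and I: "\<And>n. I n \<in> sets borel" "\<And>n. emeasure lborel (I n) = ennreal (l n)" "disjoint_family I"
    and F: "\<And>n y. y \<in> I n \<Longrightarrow> ennreal (c n) \<le> F y" and fin: "(\<integral>\<^sup>+ y. F y \<partial>lborel) < \<infinity>"
  shows "summable (\<lambda>n. c n * l n)"
proof (rule summableI_nonneg_bounded)
  show "0 \<le> c n * l n" for n using c l by simp
  fix n
  have "ennreal (\<Sum>i<n. c i * l i) = (\<Sum>i<n. ennreal (c i) * ennreal (l i))"
    using c l by (simp add: sum_ennreal[symmetric] ennreal_mult)
  also have "\<dots> = (\<Sum>i<n. \<integral>\<^sup>+ y. ennreal (c i) * indicator (I i) y \<partial>lborel)"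
    using I by (simp add: nn_integral_cmult_indicator)
  also have "\<dots> = (\<integral>\<^sup>+ y. (\<Sum>i<n. ennreal (c i) * indicator (I i) y) \<partial>lborel)"
    using I by (intro nn_integral_sum[symmetric]) auto
  also have "\<dots> \<le> (\<integral>\<^sup>+ y. F y \<partial>lborel)"
  proof (intro nn_integral_mono)
    fix y
    show "(\<Sum>i<n. ennreal (c i) * indicator (I i) y) \<le> F y"
    proof (cases "\<exists>j<n. y \<in> I j")
      case True
      then obtain j where j: "j < n" "y \<in> I j" by blast
      have "(\<Sum>i<n. ennreal (c i) * indicator (I i) y) = ennreal (c j)"
        using I(3) j by (intro sum_indicator_disjoint_family) (auto simp: disjoint_family_on_def)
      then show ?thesis using F[OF j(2)] by simp
    next
      case False
      then have "(\<Sum>i<n. ennreal (c i) * indicator (I i) y) = 0" by (intro sum.neutral) auto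
      then show ?thesis by simp
    qed
  qed
  finally have "ennreal (\<Sum>i<n. c i * l i) \<le> (\<integral>\<^sup>+ y. F y \<partial>lborel)" .
  then have "ennreal (\<Sum>i<n. c i * l i) \<le> ennreal (enn2real (\<integral>\<^sup>+ y. F y \<partial>lborel))" using fin by simp
  then show "(\<Sum>i<n. c i * l i) \<le> enn2real (\<integral>\<^sup>+ y. F y \<partial>lborel)" by (simp add: ennreal_le_iff)
qed

text \<open>The measure \<open>dx / x\<close> is uniform in logarithmic scale. Between consecutive
  points \<open>x n\<close>, whose ratio is \<open>exp \<epsilon>\<close>, the length is a fixed
  fraction of the right endpoint, so a lower sum of the integral is a constant multiple of the
  series. The shift \<open>N\<close> moves all points into the domain of \<open>f\<close>.\<close>

lemma summable_exp_of_antimono: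
  fixes f :: "real \<Rightarrow> real"
  assumes a: "1 < a" and f: "antimono_on {a..} f" "\<forall>x\<ge>a. 0 \<le> f x \<and> f x \<le> 1"
    and fin: "(\<integral>\<^sup>+ x \<in> {a..}. ennreal (f x / x) \<partial>lborel) < \<infinity>" and \<epsilon>: "0 < \<epsilon>"
  shows "\<exists>N. (\<forall>n\<ge>N. a \<le> exp (\<epsilon> * real n)) \<and> summable (\<lambda>n. f (exp (\<epsilon> * real (n + N))))"
proof -
  obtain N :: nat where N: "ln a / \<epsilon> \<le> real N" using real_arch_simple by blast
  have aN: "a \<le> exp (\<epsilon> * real n)" if "N \<le> n" for n
  proof -
    have "ln a \<le> \<epsilon> * real N" using N \<epsilon> by (simp add: field_simps)
    also have "\<dots> \<le> \<epsilon> * real n" using that \<epsilon> by simp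
    finally show ?thesis using a by (metis exp_le_cancel_iff exp_ln less_trans zero_less_one)
  qed
  define x where "x n = exp (\<epsilon> * real (n + N))" for n
  have ax: "a \<le> x n" for n unfolding x_def by (rule aN) simp
  have xpos: "0 < x n" for n by (simp add: x_def)
  have xmono: "x i \<le> x j" if "i \<le> j" for i j using that \<epsilon> by (simp add: x_def)
  have q: "x n = x (Suc n) * exp (- \<epsilon>)" for n by (simp add: x_def mult_exp_exp algebra_simps)
  have "summable (\<lambda>n. (f (x (Suc n)) / x (Suc n)) * (x (Suc n) - x n))"
  proof (rule summable_step_bound[where I="\<lambda>n. {x n..<x (Suc n)}" and F="\<lambda>y. ennreal (f y / y) * indicator {a..} y"])
    show "0 \<le> f (x (Suc n)) / x (Suc n)" for n using f(2) ax[of "Suc n"] xpos[of "Suc n"] by simp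
    show "0 \<le> x (Suc n) - x n" for n using xmono[of n "Suc n"] by simp
    show "emeasure lborel {x n..<x (Suc n)} = ennreal (x (Suc n) - x n)" for n
      using xmono[of n "Suc n"] by (intro emeasure_lborel_Ico) simp
    show "disjoint_family (\<lambda>n. {x n..<x (Suc n)})"
      unfolding disjoint_family_on_def
    proof (intro ballI impI)
      fix i j :: nat assume "i \<noteq> j"
      then consider "Suc i \<le> j" | "Suc j \<le> i" by linarith
      then show "{x i..<x (Suc i)} \<inter> {x j..<x (Suc j)} = {}"
        by cases (use xmono in \<open>force\<close>)+
    qed
    show "ennreal (f (x (Suc n)) / x (Suc n)) \<le> ennreal (f y / y) * indicator {a..} y"
      if y: "y \<in> {x n..<x (Suc n)}" for n y
    proof -
      have ya: "a \<le> y" using y ax[of n] by simp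
      have "f (x (Suc n)) \<le> f y" using f(1) ya y ax[of "Suc n"] by (auto simp: monotone_on_def)
      then have "f (x (Suc n)) / x (Suc n) \<le> f y / y"
        using y ya a f(2) xpos[of "Suc n"] by (intro frac_le) auto
      then show ?thesis using ya by (auto intro: ennreal_leI)
    qed
  qed (use fin in auto)
  moreover have "(f (x (Suc n)) / x (Suc n)) * (x (Suc n) - x n) = f (x (Suc n)) * (1 - exp (- \<epsilon>))" for n
    using xpos[of "Suc n"] by (subst q[of n]) (simp add: field_simps)
  ultimately have "summable (\<lambda>n. f (x (Suc n)) * (1 - exp (- \<epsilon>)))" by simp
  then have "summable (\<lambda>n. f (x (Suc n)))" using \<epsilon> by (simp add: mult.commute[of _ "1 - exp (- \<epsilon>)"] summable_cmult_iff)
  then have "summable (\<lambda>n. f (x n))" using summable_Suc_iff[of "\<lambda>n. f (x n)"] by simp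
  then show ?thesis using aN unfolding x_def by blast
qed

text \<open>Counterpart of the previous comparison for points tending to 0. Since \<open>g\<close>
  increases, the lower bound on an interval takes \<open>g\<close> at the left end but
  \<open>1 / y\<close> at the right end.\<close>

lemma summable_exp_of_mono:
  fixes g :: "real \<Rightarrow> real"
  assumes b: "0 < b" "b < 1" and g: "mono_on {0..b} g" "\<forall>x\<in>{0..b}. 0 \<le> g x \<and> g x \<le> 1"
    and fin: "(\<integral>\<^sup>+ x \<in> {0..b}. ennreal (g x / x) \<partial>lborel) < \<infinity>" and \<epsilon>: "0 < \<epsilon>"
  shows "\<exists>N. (\<forall>n\<ge>N. exp (- \<epsilon> * real n) \<le> b) \<and> summable (\<lambda>n. g (exp (- \<epsilon> * real (n + N))))"
proof -
  obtain N :: nat where N: "- ln b / \<epsilon> \<le> real N" using real_arch_simple by blast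
  have bN: "exp (- \<epsilon> * real n) \<le> b" if "N \<le> n" for n
  proof -
    have "- ln b \<le> \<epsilon> * real N" using N \<epsilon> by (simp add: field_simps)
    also have "\<dots> \<le> \<epsilon> * real n" using that \<epsilon> by simp
    finally have "- \<epsilon> * real n \<le> ln b" by simp
    then show ?thesis using b by (metis exp_le_cancel_iff exp_ln)
  qed
  define x where "x n = exp (- \<epsilon> * real (n + N))" for n
  have xb: "x n \<le> b" for n unfolding x_def by (rule bN) simp
  have xpos: "0 < x n" for n by (simp add: x_def)
  have xmono: "x j \<le> x i" if "i \<le> j" for i j using that \<epsilon> by (simp add: x_def)
  have q: "x (Suc n) = x n * exp (- \<epsilon>)" for n by (simp add: x_def mult_exp_exp algebra_simps)
  have "summable (\<lambda>n. (g (x (Suc n)) / x n) * (x n - x (Suc n)))"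
  proof (rule summable_step_bound[where I="\<lambda>n. {x (Suc n)<..x n}" and F="\<lambda>y. ennreal (g y / y) * indicator {0..b} y"])
    show "0 \<le> g (x (Suc n)) / x n" for n using g(2) xb[of "Suc n"] xpos[of "Suc n"] xpos[of n] by simp
    show "0 \<le> x n - x (Suc n)" for n using xmono[of n "Suc n"] by simp
    show "emeasure lborel {x (Suc n)<..x n} = ennreal (x n - x (Suc n))" for n
      using xmono[of n "Suc n"] by (intro emeasure_lborel_Ioc) simp
    show "disjoint_family (\<lambda>n. {x (Suc n)<..x n})"
      unfolding disjoint_family_on_def
    proof (intro ballI impI)
      fix i j :: nat assume "i \<noteq> j"
      then consider "Suc i \<le> j" | "Suc j \<le> i" by linarith
      then show "{x (Suc i)<..x i} \<inter> {x (Suc j)<..x j} = {}"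
        by cases (use xmono in \<open>force\<close>)+
    qed
    show "ennreal (g (x (Suc n)) / x n) \<le> ennreal (g y / y) * indicator {0..b} y"
      if y: "y \<in> {x (Suc n)<..x n}" for n y
    proof -
      have yb: "0 < y" "y \<le> b" using y xb[of n] xpos[of "Suc n"] by auto
      have "g (x (Suc n)) \<le> g y" using g(1) yb y xb[of "Suc n"] xpos[of "Suc n"] by (auto simp: monotone_on_def)
      then have "g (x (Suc n)) / x n \<le> g y / y"
        using y yb g(2) by (intro frac_le) auto
      then show ?thesis using yb by (auto intro: ennreal_leI)
    qed
  qed (use fin in auto)
  moreover have "(g (x (Suc n)) / x n) * (x n - x (Suc n)) = g (x (Suc n)) * (1 - exp (- \<epsilon>))" for n
    using xpos[of n] q[of n] by (simp add: field_simps)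
  ultimately have "summable (\<lambda>n. g (x (Suc n)) * (1 - exp (- \<epsilon>)))" by simp
  then have "summable (\<lambda>n. g (x (Suc n)))" using \<epsilon> by (simp add: mult.commute[of _ "1 - exp (- \<epsilon>)"] summable_cmult_iff)
  then have "summable (\<lambda>n. g (x n))" using summable_Suc_iff[of "\<lambda>n. g (x n)"] by simp
  then show ?thesis using bN unfolding x_def by blast
qed

section \<open>Borel-Cantelli and small ball estimates\<close>

lemma (in prob_space) borel_cantelli_eventually:
  assumes [measurable]: "\<And>n. Measurable.pred M (Q n)"
    and le: "\<And>n. n0 \<le> n \<Longrightarrow> prob {\<omega> \<in> space M. Q n \<omega>} \<le> s n" and s: "summable (\<lambda>n. s (n + n0))"
  shows "AE \<omega> in M. \<forall>\<^sub>F n in sequentially. \<not> Q n \<omega>"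
proof -
  have "summable (\<lambda>n. prob {\<omega> \<in> space M. Q (n + n0) \<omega>})"
    by (rule summable_comparison_test'[OF s, of 0]) (use le in auto)
  then have "summable (\<lambda>n. prob {\<omega> \<in> space M. Q n \<omega>})"
    by (subst (asm) summable_iff_shift)
  then have "AE \<omega> in M. \<forall>\<^sub>F n in sequentially. \<omega> \<in> space M - {\<omega> \<in> space M. Q n \<omega>}"
    by (intro borel_cantelli_AE1) (auto simp: emeasure_eq_measure)
  then show ?thesis by eventually_elim (auto elim: eventually_mono)
qed

text \<open>Markov's inequality for the power \<open>t\<close> of the negative part of the
  logarithm. The absolute value of \<open>C\<close> appears because \<open>ennreal\<close> truncates
  a negative \<open>C\<close> to 0.\<close>

lemma (in prob_space) small_ball_bound:
  assumes X[measurable]: "X \<in> borel_measurable M"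
    and C: "(\<integral>\<^sup>+ \<omega>. log_minus_pow t (cmod (X \<omega> - z)) \<partial>M) \<le> ennreal C" and L: "0 < L" and t: "0 < t"
  shows "prob {\<omega> \<in> space M. cmod (X \<omega> - z) < exp (- L)} \<le> \<bar>C\<bar> / L powr t"
proof -
  let ?S = "{\<omega> \<in> space M. cmod (X \<omega> - z) < exp (- L)}"
  have "ennreal (L powr t * prob ?S) = ennreal (L powr t) * emeasure M ?S"
    by (simp add: emeasure_eq_measure ennreal_mult)
  also have "\<dots> = (\<integral>\<^sup>+ \<omega>. ennreal (L powr t) * indicator ?S \<omega> \<partial>M)"
    by (rule nn_integral_cmult_indicator[symmetric]) measurable
  also have "\<dots> \<le> (\<integral>\<^sup>+ \<omega>. log_minus_pow t (cmod (X \<omega> - z)) \<partial>M)"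
  proof (intro nn_integral_mono)
    fix \<omega>
    show "ennreal (L powr t) * indicator ?S \<omega> \<le> log_minus_pow t (cmod (X \<omega> - z))"
    \<comment> \<open>Where \<open>X\<close> hits \<open>z\<close>, the integrand is infinite by
      definition and the computation with \<open>ln\<close> does not apply.\<close>
    proof (cases "\<omega> \<in> ?S \<and> X \<omega> \<noteq> z")
      case True
      then have "ln (cmod (X \<omega> - z)) \<le> - L"
        by (subst ln_le_cancel_iff[of _ "exp (- L)", simplified ln_exp]) auto
      then have "L powr t \<le> (max (- ln (cmod (X \<omega> - z))) 0) powr t"
        using L t by (intro powr_mono2) auto
      then show ?thesis using True by (auto simp: log_minus_pow_def intro!: ennreal_leI)
    qed (auto simp: log_minus_pow_def)
  qed
  also have "\<dots> \<le> ennreal \<bar>C\<bar>" using C by (rule order_trans) (auto intro: ennreal_leI)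
  finally have "L powr t * prob ?S \<le> \<bar>C\<bar>" by (simp add: ennreal_le_iff)
  then show ?thesis using L by (simp add: field_simps)
qed

text \<open>Fix the value of \<open>Y\<close> under the product law: the bound for a fixed centre is
  uniform in the centre and survives integration.\<close>

lemma (in prob_space) indep_small_ball_bound:
  assumes ind: "indep_var borel X borel Y"
    and C: "\<And>z. (\<integral>\<^sup>+ \<omega>. log_minus_pow t (cmod (X \<omega> - z)) \<partial>M) \<le> ennreal C" and L: "0 < L" and t: "0 < t"
  shows "prob {\<omega> \<in> space M. cmod (X \<omega> - Y \<omega>) < exp (- L)} \<le> \<bar>C\<bar> / L powr t"
proof -
  have X[measurable]: "X \<in> borel_measurable M" and Y[measurable]: "Y \<in> borel_measurable M"
    and d: "distr M borel X \<Otimes>\<^sub>M distr M borel Y = distr M (borel \<Otimes>\<^sub>M borel) (\<lambda>\<omega>. (X \<omega>, Y \<omega>))"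
    using ind unfolding indep_var_distribution_eq by auto
  let ?D = "{p :: complex \<times> complex. cmod (fst p - snd p) < exp (- L)}"
  have "open ?D" by (intro open_Collect_less continuous_intros)
  then have Dm: "?D \<in> sets (borel \<Otimes>\<^sub>M borel)" unfolding borel_prod by simp
  interpret DX: prob_space "distr M borel X" by (rule prob_space_distr[OF X])
  interpret DY: prob_space "distr M borel Y" by (rule prob_space_distr[OF Y])
  interpret P: pair_prob_space "distr M borel X" "distr M borel Y" ..
  have "emeasure M {\<omega> \<in> space M. cmod (X \<omega> - Y \<omega>) < exp (- L)}
      = emeasure (distr M (borel \<Otimes>\<^sub>M borel) (\<lambda>\<omega>. (X \<omega>, Y \<omega>))) ?D"
    by (subst emeasure_distr[OF _ Dm]) (measurable, auto intro!: arg_cong[where f="emeasure M"])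
  also have "\<dots> = emeasure (distr M borel X \<Otimes>\<^sub>M distr M borel Y) ?D" by (simp add: d)
  also have "\<dots> = (\<integral>\<^sup>+ y. emeasure (distr M borel X) ((\<lambda>x. (x, y)) -` ?D) \<partial>distr M borel Y)"
    by (rule P.emeasure_pair_measure_alt2) (use Dm in simp)
  also have "\<dots> \<le> (\<integral>\<^sup>+ y. ennreal (\<bar>C\<bar> / L powr t) \<partial>distr M borel Y)"
  proof (intro nn_integral_mono)
    fix y
    have "emeasure (distr M borel X) ((\<lambda>x. (x, y)) -` ?D) = emeasure M {\<omega> \<in> space M. cmod (X \<omega> - y) < exp (- L)}"
    proof -
      have eq: "(\<lambda>x. (x, y)) -` ?D = {x. cmod (x - y) < exp (- L)}" by auto
      have "open {x. cmod (x - y) < exp (- L)}" by (intro open_Collect_less continuous_intros)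
      then show ?thesis
        unfolding eq by (subst emeasure_distr) (auto intro!: arg_cong[where f="emeasure M"])
    qed
    also have "\<dots> \<le> ennreal (\<bar>C\<bar> / L powr t)"
      unfolding emeasure_eq_measure by (intro ennreal_leI small_ball_bound X C L t)
    finally show "emeasure (distr M borel X) ((\<lambda>x. (x, y)) -` ?D) \<le> ennreal (\<bar>C\<bar> / L powr t)" .
  qed
  also have "\<dots> = ennreal (\<bar>C\<bar> / L powr t)" using DY.emeasure_space_1 by simp
  finally show ?thesis using L by (simp add: emeasure_eq_measure ennreal_le_iff)
qed

section \<open>From root asymptotics to exponential bounds for the polynomials\<close>

lemma exp_le_powr_root:
  fixes x :: real
  assumes n: "0 < n" and x: "0 \<le> x"
  shows "x powr (1 / real n) \<le> exp c \<Longrightarrow> x \<le> exp (c * real n)"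
    and "exp c \<le> x powr (1 / real n) \<Longrightarrow> exp (c * real n) \<le> x"
proof -
  have eq: "(x powr (1 / real n)) powr real n = x" using n x by (simp add: powr_powr)
  have e: "exp c powr real n = exp (c * real n)" by (simp add: powr_def mult.commute)
  show "x \<le> exp (c * real n)" if "x powr (1 / real n) \<le> exp c"
    using powr_mono2[OF _ _ that, of "real n"] unfolding eq e by simp
  show "exp (c * real n) \<le> x" if "exp c \<le> x powr (1 / real n)"
    using powr_mono2[OF _ _ that, of "real n"] unfolding eq e by simp
qed

lemma eventually_exp_bound_imp_all:
  fixes u :: "nat \<Rightarrow> real"
  assumes "\<forall>\<^sub>F k in sequentially. u k \<le> exp (c * real k)" and c: "0 \<le> c"
  obtains D where "0 < D" "\<And>k. u k \<le> D * exp (c * real k)"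
proof -
  obtain k0 where k0: "\<And>k. k0 \<le> k \<Longrightarrow> u k \<le> exp (c * real k)"
    using assms(1) by (auto simp: eventually_sequentially)
  define D where "D = 1 + (\<Sum>k<k0. \<bar>u k\<bar>)"
  have D1: "1 \<le> D" by (simp add: D_def sum_nonneg)
  have "u k \<le> D * exp (c * real k)" for k
  proof (cases "k < k0")
    case True
    have "u k \<le> \<bar>u k\<bar>" by simp
    also have "\<bar>u k\<bar> \<le> (\<Sum>k<k0. \<bar>u k\<bar>)" using True by (intro member_le_sum) auto
    also have "\<dots> \<le> D * 1" by (simp add: D_def)
    also have "\<dots> \<le> D * exp (c * real k)" using D1 c by (intro mult_left_mono) auto
    finally show ?thesis .
  next
    case False
    have "u k \<le> 1 * exp (c * real k)" using k0[of k] False by simp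
    also have "\<dots> \<le> D * exp (c * real k)" using D1 by (intro mult_right_mono) auto
    finally show ?thesis .
  qed
  then show ?thesis using that[of D] D1 by auto
qed

text \<open>Here \<open>a\<close> is one realisation of the random coefficients. Summing
  \<open>n + 1\<close> terms costs only a factor of linear growth, which the exponential rates
  absorb.\<close>

lemma zeros_weak_conv_of_coefficients:
  fixes E :: "complex set" and B :: "nat \<Rightarrow> complex poly" and a :: "nat \<Rightarrow> complex"
  assumes E: "compact E" and cap: "0 < log_capacity E"
    and B_deg: "\<And>k. degree (B k) \<le> k" and B_lead: "\<And>k. coeff (B k) k \<noteq> 0"
    and B_sup: "limsup (\<lambda>k. ereal (sup_norm_on E (B k) powr (1 / real k))) \<le> 1"
    and B_lead_lim: "(\<lambda>k. cmod (coeff (B k) k) powr (1 / real k)) \<longlonglongrightarrow> 1 / log_capacity E"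
    and a_up: "\<And>\<epsilon>. 0 < \<epsilon> \<Longrightarrow> \<forall>\<^sub>F n in sequentially. cmod (a n) \<le> exp (\<epsilon> * real n)"
    and a_low: "\<And>\<epsilon>. 0 < \<epsilon> \<Longrightarrow> \<forall>\<^sub>F n in sequentially. exp (- \<epsilon> * real n) \<le> cmod (a n)"
    and dense: "closure Q = UNIV"
    and low: "\<And>q \<epsilon>. q \<in> Q \<Longrightarrow> 0 < \<epsilon> \<Longrightarrow>
        \<forall>\<^sub>F n in sequentially. exp (- \<epsilon> * real n) \<le> cmod (poly (\<Sum>k\<le>n. smult (a k) (B k)) q)"
  shows "zeros_weak_conv (\<lambda>n. \<Sum>k\<le>n. smult (a k) (B k)) (equilibrium_measure E)"
proof (rule zeros_weak_conv_of_growth[OF E cap _ _ _ dense low])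
  let ?P = "\<lambda>n. \<Sum>k\<le>n. smult (a k) (B k)"
  have top: "coeff (?P n) n = a n * coeff (B n) n" for n
  proof -
    have "coeff (?P n) n = (\<Sum>k\<le>n. a k * coeff (B k) n)" by (simp add: coeff_sum)
    also have "\<dots> = (\<Sum>k\<in>{n}. a k * coeff (B k) n)"
    proof (rule sum.mono_neutral_right)
      show "\<forall>k\<in>{..n} - {n}. a k * coeff (B k) n = 0"
      proof
        fix k assume "k \<in> {..n} - {n}"
        then have "degree (B k) < n" using B_deg[of k] by auto
        then show "a k * coeff (B k) n = 0" by (simp add: coeff_eq_0)
      qed
    qed auto
    finally show ?thesis by simp
  qed
  have degle: "degree (?P n) \<le> n" for n
  proof (rule degree_sum_le)
    fix k assume "k \<in> {..n}"
    then show "degree (smult (a k) (B k)) \<le> n"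
      using degree_smult_le[of "a k" "B k"] B_deg[of k] by simp
  qed simp
  have dn: "degree (?P n) = n" if "a n \<noteq> 0" for n
    using degle[of n] top[of n] that B_lead[of n] by (intro antisym le_degree) auto
  have ne: "\<forall>\<^sub>F n in sequentially. a n \<noteq> 0"
    using a_low[OF zero_less_one]
  proof eventually_elim
    case (elim n)
    then have "0 < cmod (a n)" by (rule less_le_trans[OF exp_gt_zero])
    then show ?case by simp
  qed
  then show "\<forall>\<^sub>F n in sequentially. degree (?P n) = n" by eventually_elim (rule dn)
  define \<gamma> where "\<gamma> = - ln (log_capacity E)"
  have e\<gamma>: "1 / log_capacity E = exp \<gamma>" using cap by (simp add: \<gamma>_def exp_minus inverse_eq_divide)
  have blim: "\<forall>\<^sub>F n in sequentially. exp ((\<gamma> - \<epsilon>) * real n) \<le> cmod (coeff (B n) n) \<and>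
      cmod (coeff (B n) n) \<le> exp ((\<gamma> + \<epsilon>) * real n)" if \<epsilon>: "0 < \<epsilon>" for \<epsilon>
  proof -
    have "\<forall>\<^sub>F n in sequentially. exp (\<gamma> - \<epsilon>) < cmod (coeff (B n) n) powr (1 / real n)"
      using B_lead_lim \<epsilon> by (intro order_tendstoD(1)) (auto simp: e\<gamma>)
    moreover have "\<forall>\<^sub>F n in sequentially. cmod (coeff (B n) n) powr (1 / real n) < exp (\<gamma> + \<epsilon>)"
      using B_lead_lim \<epsilon> by (intro order_tendstoD(2)) (auto simp: e\<gamma>)
    ultimately show ?thesis using eventually_gt_at_top[of 0]
      by eventually_elim (auto intro!: exp_le_powr_root)
  qed
  show "\<forall>\<^sub>F n in sequentially. exp ((- ln (log_capacity E) - \<epsilon>) * real n) \<le> cmod (lead_coeff (?P n)) \<and>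
      cmod (lead_coeff (?P n)) \<le> exp ((- ln (log_capacity E) + \<epsilon>) * real n)" if \<epsilon>: "0 < \<epsilon>" for \<epsilon>
  proof -
    have h: "0 < \<epsilon> / 2" using \<epsilon> by simp
    show ?thesis
      using blim[OF h] a_up[OF h] a_low[OF h] ne unfolding \<gamma>_def[symmetric]
    proof eventually_elim
      case (elim n)
      have lc: "cmod (lead_coeff (?P n)) = cmod (a n) * cmod (coeff (B n) n)"
        using dn[of n] elim top[of n] by (simp add: norm_mult)
      have "exp (- (\<epsilon>/2) * real n) * exp ((\<gamma> - \<epsilon>/2) * real n) \<le> cmod (a n) * cmod (coeff (B n) n)"
        using elim by (intro mult_mono) auto
      moreover have "cmod (a n) * cmod (coeff (B n) n) \<le> exp ((\<epsilon>/2) * real n) * exp ((\<gamma> + \<epsilon>/2) * real n)"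
        using elim by (intro mult_mono) auto
      moreover have "exp (- (\<epsilon>/2) * real n) * exp ((\<gamma> - \<epsilon>/2) * real n) = exp ((\<gamma> - \<epsilon>) * real n)"
        "exp ((\<epsilon>/2) * real n) * exp ((\<gamma> + \<epsilon>/2) * real n) = exp ((\<gamma> + \<epsilon>) * real n)"
        unfolding mult_exp_exp by (simp_all add: algebra_simps)
      ultimately show ?case unfolding lc by simp
    qed
  qed
  have Bz: "cmod (poly (B k) z) \<le> sup_norm_on E (B k)" if "z \<in> E" for k z
    unfolding sup_norm_on_def
  proof (rule cSUP_upper[OF that])
    have "compact ((\<lambda>z. cmod (poly (B k) z)) ` E)"
      by (intro compact_continuous_image E continuous_intros)
    then show "bdd_above ((\<lambda>z. cmod (poly (B k) z)) ` E)"
      by (intro bounded_imp_bdd_above compact_imp_bounded)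
  qed
  show "\<forall>\<^sub>F n in sequentially. \<forall>z\<in>E. cmod (poly (?P n) z) \<le> exp (\<epsilon> * real n)" if \<epsilon>: "0 < \<epsilon>" for \<epsilon>
  \<comment> \<open>For empty \<open>E\<close> the claim is vacuous, while
    \<open>sup_norm_on\<close> would be the supremum of an empty set.\<close>
  proof (cases "E = {}")
    case False
    then obtain z0 where z0: "z0 \<in> E" by blast
    have s0: "0 \<le> sup_norm_on E (B k)" for k using Bz[OF z0, of k] by (rule order_trans[OF norm_ge_zero])
    \<comment> \<open>One \<open>h\<close> each for the coefficients, the sup norms and the factor
      \<open>(n + 1) * D\<close>; the three together stay below \<open>\<epsilon>\<close>.\<close>
    define h where "h = \<epsilon> / 4"
    have h: "0 < h" using \<epsilon> by (simp add: h_def)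
    have "limsup (\<lambda>k. ereal (sup_norm_on E (B k) powr (1 / real k))) < ereal (exp h)"
      using B_sup h by (intro le_less_trans[OF B_sup]) simp
    then have "\<forall>\<^sub>F k in sequentially. ereal (sup_norm_on E (B k) powr (1 / real k)) < ereal (exp h)"
      by (rule Limsup_lessD)
    then have "\<forall>\<^sub>F k in sequentially. cmod (a k) * sup_norm_on E (B k) \<le> exp (2 * h * real k)"
      using a_up[OF h] eventually_gt_at_top[of 0]
    proof eventually_elim
      case (elim k)
      have "sup_norm_on E (B k) \<le> exp (h * real k)"
        by (rule exp_le_powr_root(1)) (use elim s0 in auto)
      then have "cmod (a k) * sup_norm_on E (B k) \<le> exp (h * real k) * exp (h * real k)"
        using elim s0 by (intro mult_mono) auto
      then show ?case by (simp add: mult_exp_exp algebra_simps)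
    qed
    then obtain D where D: "0 < D" "\<And>k. cmod (a k) * sup_norm_on E (B k) \<le> D * exp (2 * h * real k)"
      using h eventually_exp_bound_imp_all[of "\<lambda>k. cmod (a k) * sup_norm_on E (B k)" "2 * h"] by auto
    have bound: "cmod (poly (?P n) z) \<le> (real n + 1) * D * exp (2 * h * real n)" if z: "z \<in> E" for n z
    proof -
      have "cmod (poly (?P n) z) = cmod (\<Sum>k\<le>n. a k * poly (B k) z)" by (simp add: poly_sum)
      also have "\<dots> \<le> (\<Sum>k\<le>n. cmod (a k * poly (B k) z))" by (rule norm_sum)
      also have "\<dots> \<le> (\<Sum>k\<le>n. D * exp (2 * h * real n))"
      proof (rule sum_mono)
        fix k assume "k \<in> {..n}"
        then have kn: "k \<le> n" by simp
        have "cmod (a k * poly (B k) z) \<le> cmod (a k) * sup_norm_on E (B k)"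
          using Bz[OF z] by (simp add: norm_mult mult_left_mono)
        also have "\<dots> \<le> D * exp (2 * h * real k)" by (rule D)
        also have "\<dots> \<le> D * exp (2 * h * real n)" using D(1) kn h by (intro mult_left_mono) auto
        finally show "cmod (a k * poly (B k) z) \<le> D * exp (2 * h * real n)" .
      qed
      also have "\<dots> = (real n + 1) * D * exp (2 * h * real n)" by simp
      finally show ?thesis .
    qed
    have "(\<lambda>n. (real n + 1) * D * exp (- h * real n)) \<longlonglongrightarrow> 0" using h by real_asymp
    then have "\<forall>\<^sub>F n in sequentially. (real n + 1) * D * exp (- h * real n) < 1"
      by (rule order_tendstoD) simp
    then show ?thesis
    proof eventually_elim
      case (elim n)
      show ?case
      proof
        fix z assume z: "z \<in> E"
        have "(real n + 1) * D * exp (2 * h * real n)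
            = ((real n + 1) * D * exp (- h * real n)) * exp (3 * h * real n)"
          by (simp add: mult_exp_exp mult.assoc)
        also have "\<dots> \<le> 1 * exp (3 * h * real n)" using elim by (intro mult_right_mono) auto
        also have "\<dots> \<le> exp (\<epsilon> * real n)" using \<epsilon> by (simp add: h_def)
        finally show "cmod (poly (?P n) z) \<le> exp (\<epsilon> * real n)" using bound[OF z, of n] by linarith
      qed
    qed
  qed simp
qed auto

text \<open>The sum is measurable for the sigma-algebra \<open>N\<close> generated by the later
  coefficients, so all its events already belong to the second independent family.\<close>

lemma (in prob_space) indep_var_of_indep_generators:
  fixes A :: "nat \<Rightarrow> 'a \<Rightarrow> complex"
  assumes A: "\<And>k. A k \<in> borel_measurable M"
    and indep: "indep_set
        (sigma_sets (space M) {A 0 -` S \<inter> space M | S. S \<in> sets borel})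
        (sigma_sets (space M) {A n -` S \<inter> space M | n S. n \<ge> 1 \<and> S \<in> sets borel})"
  shows "indep_var borel (A 0) borel (\<lambda>\<omega>. \<Sum>k=1..n. A k \<omega> * c k)"
proof -
  let ?G = "{A n -` S \<inter> space M | n S. n \<ge> 1 \<and> S \<in> sets borel}"
  let ?Y = "\<lambda>\<omega>. \<Sum>k=1..n. A k \<omega> * c k"
  define N where "N = sigma (space M) ?G"
  have G: "?G \<subseteq> Pow (space M)" by auto
  have sp: "space N = space M" and st: "sets N = sigma_sets (space M) ?G"
    using G by (simp_all add: N_def)
  have AN: "A k \<in> borel_measurable N" if "1 \<le> k" for k
  proof (rule measurableI)
    fix S :: "complex set" assume "S \<in> sets borel"
    then have "A k -` S \<inter> space M \<in> ?G" using that by blast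
    then show "A k -` S \<inter> space N \<in> sets N" unfolding sp st by (rule sigma_sets.Basic)
  qed simp
  have YN: "?Y \<in> borel_measurable N" by (intro borel_measurable_sum borel_measurable_times AN) auto
  have sub: "sigma_sets (space M) {?Y -` S \<inter> space M | S. S \<in> sets borel} \<subseteq> sigma_sets (space M) ?G"
  proof (rule sigma_sets_mono)
    show "{?Y -` S \<inter> space M | S. S \<in> sets borel} \<subseteq> sigma_sets (space M) ?G"
      using measurable_sets[OF YN] unfolding sp st by blast
  qed
  have "indep_set (sigma_sets (space M) {A 0 -` S \<inter> space M | S. S \<in> sets borel})
      (sigma_sets (space M) {?Y -` S \<inter> space M | S. S \<in> sets borel})"
    using indep sub unfolding indep_sets2_eq by (meson order_trans subsetD)
  moreover have "?Y \<in> borel_measurable M" using A by measurable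
  ultimately show ?thesis unfolding indep_var_eq using A by blast
qed

theorem theorem2p5:
  fixes E :: "complex set"
    and B :: "nat \<Rightarrow> complex poly"
    and M :: "'a measure"
    and A :: "nat \<Rightarrow> 'a \<Rightarrow> complex"
  assumes E_compact: "compact E"
    and E_cap: "log_capacity E > 0"
    and B_deg: "\<And>k. degree (B k) \<le> k"
    and B_lead: "\<And>k. coeff (B k) k \<noteq> 0"
    and B_sup: "limsup (\<lambda>k. ereal (sup_norm_on E (B k) powr (1 / real k))) \<le> 1"
    and B_lead_lim: "(\<lambda>k. cmod (coeff (B k) k) powr (1 / real k)) \<longlonglongrightarrow> 1 / log_capacity E"
    and prob: "prob_space M"
    and A_rv: "\<And>k. A k \<in> borel_measurable M"
    and assm1: "\<exists>a > 1. \<exists>f :: real \<Rightarrow> real.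
        antimono_on {a..} f \<and> (\<forall>x \<ge> a. 0 \<le> f x \<and> f x \<le> 1) \<and>
        (\<integral>\<^sup>+ x \<in> {a..}. ennreal (f x / x) \<partial>lborel) < \<infinity> \<and>
        (\<forall>x \<ge> a. \<forall>k. 1 - measure M {\<omega> \<in> space M. cmod (A k \<omega>) \<le> x} \<le> f x)"
    and assm2: "\<exists>b. 0 < b \<and> b < 1 \<and> (\<exists>g :: real \<Rightarrow> real.
        mono_on {0..b} g \<and> (\<forall>x \<in> {0..b}. 0 \<le> g x \<and> g x \<le> 1) \<and>
        (\<integral>\<^sup>+ x \<in> {0..b}. ennreal (g x / x) \<partial>lborel) < \<infinity> \<and>
        (\<forall>x \<in> {0..b}. \<forall>k. measure M {\<omega> \<in> space M. cmod (A k \<omega>) \<le> x} \<le> g x))"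
    and indep: "prob_space.indep_set M
        (sigma_sets (space M) {A 0 -` S \<inter> space M | S. S \<in> sets borel})
        (sigma_sets (space M) {A n -` S \<inter> space M | n S. n \<ge> 1 \<and> S \<in> sets borel})"
    and A0_log: "\<exists>t > 1. \<exists>C :: real.
        \<forall>z. (\<integral>\<^sup>+ \<omega>. log_minus_pow t (cmod (A 0 \<omega> - z)) \<partial>M) \<le> ennreal C"
  shows "AE \<omega> in M. zeros_weak_conv
           (\<lambda>n. \<Sum>k\<le>n. smult (A k \<omega>) (B k)) (equilibrium_measure E)"
proof -
  interpret prob_space M by (rule prob)
  note [measurable] = A_rv
  define P where "P n \<omega> = (\<Sum>k\<le>n. smult (A k \<omega>) (B k))" for n \<omega>
  \<comment> \<open>The double negation comes from the bad event, itself a negated inequality, in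
    \<open>borel_cantelli_eventually\<close>.\<close>
  have up: "AE \<omega> in M. \<forall>\<^sub>F n in sequentially. \<not> \<not> cmod (A n \<omega>) \<le> exp (\<epsilon> * real n)" if \<epsilon>: "0 < \<epsilon>" for \<epsilon>
  proof -
    obtain a :: real and f :: "real \<Rightarrow> real" where a: "1 < a" and f: "antimono_on {a..} f" "\<forall>x\<ge>a. 0 \<le> f x \<and> f x \<le> 1"
      "(\<integral>\<^sup>+ x \<in> {a..}. ennreal (f x / x) \<partial>lborel) < \<infinity>"
      and tail: "\<forall>x\<ge>a. \<forall>k. 1 - prob {\<omega> \<in> space M. cmod (A k \<omega>) \<le> x} \<le> f x"
      using assm1 by (elim exE conjE) (rule that)
    obtain N where N: "\<forall>n\<ge>N. a \<le> exp (\<epsilon> * real n)" "summable (\<lambda>n. f (exp (\<epsilon> * real (n + N))))"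
      using summable_exp_of_antimono[OF a f \<epsilon>] by blast
    show ?thesis
    proof (rule borel_cantelli_eventually[where s="\<lambda>n. f (exp (\<epsilon> * real n))" and ?n0.0=N, OF _ _ N(2)])
      fix n assume "N \<le> n"
      then have "1 - prob {\<omega> \<in> space M. cmod (A n \<omega>) \<le> exp (\<epsilon> * real n)} \<le> f (exp (\<epsilon> * real n))"
        using N(1) tail by blast
      then show "prob {\<omega> \<in> space M. \<not> cmod (A n \<omega>) \<le> exp (\<epsilon> * real n)} \<le> f (exp (\<epsilon> * real n))"
        by (subst prob_neg) auto
    qed measurable
  qed
  have low: "AE \<omega> in M. \<forall>\<^sub>F n in sequentially. \<not> cmod (A n \<omega>) \<le> exp (- \<epsilon> * real n)" if \<epsilon>: "0 < \<epsilon>" for \<epsilon>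
  proof -
    obtain b :: real and g :: "real \<Rightarrow> real" where b: "0 < b" "b < 1" and g: "mono_on {0..b} g" "\<forall>x\<in>{0..b}. 0 \<le> g x \<and> g x \<le> 1"
      "(\<integral>\<^sup>+ x \<in> {0..b}. ennreal (g x / x) \<partial>lborel) < \<infinity>"
      and tail: "\<forall>x\<in>{0..b}. \<forall>k. prob {\<omega> \<in> space M. cmod (A k \<omega>) \<le> x} \<le> g x"
      using assm2 by (elim exE conjE) (rule that)
    obtain N where N: "\<forall>n\<ge>N. exp (- \<epsilon> * real n) \<le> b" "summable (\<lambda>n. g (exp (- \<epsilon> * real (n + N))))"
      using summable_exp_of_mono[OF b g \<epsilon>] by blast
    show ?thesis
    proof (rule borel_cantelli_eventually[where s="\<lambda>n. g (exp (- \<epsilon> * real n))" and ?n0.0=N, OF _ _ N(2)])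
      fix n assume "N \<le> n"
      then show "prob {\<omega> \<in> space M. cmod (A n \<omega>) \<le> exp (- \<epsilon> * real n)} \<le> g (exp (- \<epsilon> * real n))"
        using N(1) tail by auto
    qed measurable
  qed
  have Plow: "AE \<omega> in M. \<forall>\<^sub>F n in sequentially. \<not> cmod (poly (P n \<omega>) q) < exp (- \<epsilon> * real n)"
    if \<epsilon>: "0 < \<epsilon>" for q \<epsilon>
  proof -
    obtain t C where t: "1 < t" and C: "\<And>z. (\<integral>\<^sup>+ \<omega>. log_minus_pow t (cmod (A 0 \<omega> - z)) \<partial>M) \<le> ennreal C"
      using A0_log by blast
    define b0 where "b0 = coeff (B 0) 0"
    have b0: "b0 \<noteq> 0" using B_lead[of 0] by (simp add: b0_def)
    have B0: "poly (B 0) q = b0"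
    proof -
      obtain c where "B 0 = [:c:]" using B_deg[of 0] by (auto elim: degree_eq_zeroE)
      then show ?thesis by (simp add: b0_def)
    qed
    \<comment> \<open>As \<open>B 0\<close> is the constant \<open>b0\<close>, the value of
      \<open>P n\<close> at \<open>q\<close> is \<open>b0\<close> times the difference of
      \<open>A 0\<close> and this combination of later coefficients. A small value means that
      \<open>A 0\<close> visits a small ball with independent centre.\<close>
    define Y where "Y n \<omega> = (\<Sum>k=1..n. A k \<omega> * (- poly (B k) q / b0))" for n \<omega>
    have Ym[measurable]: "Y n \<in> borel_measurable M" for n unfolding Y_def by measurable
    have PY: "poly (P n \<omega>) q = b0 * (A 0 \<omega> - Y n \<omega>)" for n \<omega>
    proof -
      have "poly (P n \<omega>) q = (\<Sum>k\<le>n. A k \<omega> * poly (B k) q)" by (simp add: P_def poly_sum)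
      also have "\<dots> = A 0 \<omega> * b0 + (\<Sum>k=1..n. A k \<omega> * poly (B k) q)"
        unfolding atMost_atLeast0 by (subst sum.atLeast_Suc_atMost) (auto simp: B0)
      also have "(\<Sum>k=1..n. A k \<omega> * poly (B k) q) = - b0 * Y n \<omega>"
        unfolding Y_def sum_distrib_left using b0 by (intro sum.cong) auto
      finally show ?thesis by (simp add: algebra_simps)
    qed
    have ind: "indep_var borel (A 0) borel (Y n)" for n
      unfolding Y_def[abs_def] by (rule indep_var_of_indep_generators[OF A_rv indep])
    \<comment> \<open>Beyond \<open>n1\<close> the factor \<open>b0\<close> changes the exponent by
      at most half of \<open>\<epsilon> * n\<close>.\<close>
    obtain n1 :: nat where n1: "2 * \<bar>ln (cmod b0)\<bar> / \<epsilon> \<le> real n1" using real_arch_simple by blast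
    define s where "s n = \<bar>C\<bar> / (\<epsilon> * real n / 2) powr t" for n
    \<comment> \<open>The small ball bounds are a multiple of \<open>n powr (- t)\<close>; this is
      where \<open>t > 1\<close> enters.\<close>
    have "summable (\<lambda>n. \<bar>C\<bar> / (\<epsilon> / 2) powr t * real n powr (- t))"
      using t by (intro summable_mult) (simp add: summable_real_powr_iff)
    also have "(\<lambda>n. \<bar>C\<bar> / (\<epsilon> / 2) powr t * real n powr (- t)) = s"
      using \<epsilon> by (intro ext) (simp add: s_def powr_minus powr_mult powr_divide field_simps)
    finally have sums: "summable (\<lambda>n. s (n + Suc n1))" by (rule summable_ignore_initial_segment)
    show ?thesis
    proof (rule borel_cantelli_eventually[where s=s, OF _ _ sums])
      fix n assume n: "Suc n1 \<le> n"
      have n0: "0 < \<epsilon> * real n / 2" using n \<epsilon> by simp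
      have "2 * \<bar>ln (cmod b0)\<bar> \<le> \<epsilon> * real n1" using n1 \<epsilon> by (simp add: field_simps)
      also have "\<dots> \<le> \<epsilon> * real n" using n \<epsilon> by (intro mult_left_mono) auto
      finally have lb: "\<bar>ln (cmod b0)\<bar> \<le> \<epsilon> * real n / 2" by simp
      have "prob {\<omega> \<in> space M. cmod (poly (P n \<omega>) q) < exp (- \<epsilon> * real n)}
          \<le> prob {\<omega> \<in> space M. cmod (A 0 \<omega> - Y n \<omega>) < exp (- (\<epsilon> * real n / 2))}"
      proof (rule finite_measure_mono)
        show "{\<omega> \<in> space M. cmod (poly (P n \<omega>) q) < exp (- \<epsilon> * real n)}
            \<subseteq> {\<omega> \<in> space M. cmod (A 0 \<omega> - Y n \<omega>) < exp (- (\<epsilon> * real n / 2))}"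
        proof safe
          fix \<omega> assume "cmod (poly (P n \<omega>) q) < exp (- \<epsilon> * real n)"
          then have "cmod (A 0 \<omega> - Y n \<omega>) < exp (- \<epsilon> * real n) / cmod b0"
            using b0 unfolding PY norm_mult by (simp add: pos_less_divide_eq mult.commute)
          also have "\<dots> = exp (- \<epsilon> * real n - ln (cmod b0))" using b0 by (simp add: exp_diff)
          also have "\<dots> \<le> exp (- (\<epsilon> * real n / 2))" using lb by simp
          finally show "cmod (A 0 \<omega> - Y n \<omega>) < exp (- (\<epsilon> * real n / 2))" .
        qed
      qed measurable
      also have "\<dots> \<le> s n" unfolding s_def using t by (intro indep_small_ball_bound[OF ind C n0]) simp
      finally show "prob {\<omega> \<in> space M. cmod (poly (P n \<omega>) q) < exp (- \<epsilon> * real n)} \<le> s n" .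
    qed (simp add: PY)
  qed
  obtain Q :: "complex set" where Q: "countable Q" "\<forall>X. open X \<longrightarrow> X \<noteq> {} \<longrightarrow> (\<exists>d\<in>Q. d \<in> X)"
    using countable_dense_exists by blast
  have dense: "closure Q = UNIV"
  proof -
    have "z \<in> closure Q" for z
      unfolding closure_approachable
    proof (intro allI impI)
      fix e :: real assume "0 < e"
      then obtain d where "d \<in> Q" "d \<in> ball z e" using Q(2)[rule_format, of "ball z e"] by auto
      then show "\<exists>y\<in>Q. dist y z < e" by (auto simp: dist_commute)
    qed
    then show ?thesis by auto
  qed
  \<comment> \<open>The rates \<open>1 / Suc j\<close> stand for all positive
    \<open>\<epsilon>\<close>, so that only countably many null sets are united.\<close>
  let ?e = "\<lambda>j. 1 / real (Suc j)"
  have "AE \<omega> in M. \<forall>j. \<forall>\<^sub>F n in sequentially. \<not> \<not> cmod (A n \<omega>) \<le> exp (?e j * real n)"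
    unfolding AE_all_countable by (intro allI up) simp
  moreover have "AE \<omega> in M. \<forall>j. \<forall>\<^sub>F n in sequentially. \<not> cmod (A n \<omega>) \<le> exp (- ?e j * real n)"
    unfolding AE_all_countable by (intro allI low) simp
  moreover have "AE \<omega> in M. \<forall>q\<in>Q. \<forall>j. \<forall>\<^sub>F n in sequentially. \<not> cmod (poly (P n \<omega>) q) < exp (- ?e j * real n)"
    unfolding AE_ball_countable[OF Q(1)] AE_all_countable by (intro ballI allI Plow) simp
  ultimately show ?thesis
  proof eventually_elim
    case (elim \<omega>)
    have small: "\<exists>j. ?e j \<le> \<epsilon>" if "0 < \<epsilon>" for \<epsilon> :: real
      using reals_Archimedean[OF that] by (auto simp: inverse_eq_divide intro: less_imp_le)
    show ?case
    proof (rule zeros_weak_conv_of_coefficients[OF E_compact E_cap B_deg B_lead B_sup B_lead_lim _ _ dense])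
      fix \<epsilon> :: real assume "0 < \<epsilon>"
      then obtain j where j: "?e j \<le> \<epsilon>" using small by blast
      then have le: "?e j * real n \<le> \<epsilon> * real n" for n by (intro mult_right_mono) auto
      show "\<forall>\<^sub>F n in sequentially. cmod (A n \<omega>) \<le> exp (\<epsilon> * real n)"
        using elim(1)[rule_format, of j]
      proof eventually_elim
        case (elim n)
        then have "cmod (A n \<omega>) \<le> exp (?e j * real n)" by simp
        also have "\<dots> \<le> exp (\<epsilon> * real n)" using le[of n] by (simp only: exp_le_cancel_iff)
        finally show ?case .
      qed
      have lem: "exp (- \<epsilon> * real n) \<le> exp (- ?e j * real n)" for n
        using le[of n] by (simp only: exp_le_cancel_iff mult_minus_left neg_le_iff_le)
      show "\<forall>\<^sub>F n in sequentially. exp (- \<epsilon> * real n) \<le> cmod (A n \<omega>)"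
        using elim(2)[rule_format, of j]
      proof eventually_elim
        case (elim n)
        then show ?case using lem[of n] by linarith
      qed
      fix q assume "q \<in> Q"
      then have "\<forall>\<^sub>F n in sequentially. \<not> cmod (poly (P n \<omega>) q) < exp (- ?e j * real n)"
        using elim(3) by blast
      then show "\<forall>\<^sub>F n in sequentially. exp (- \<epsilon> * real n) \<le> cmod (poly (\<Sum>k\<le>n. smult (A k \<omega>) (B k)) q)"
      proof eventually_elim
        case (elim n)
        then show ?case using lem[of n] unfolding P_def by linarith
      qed
    qed
  qed
qed

end
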